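(* For every integer $\ell\ge 0$, all coefficients of the Laurent polynomial $d_\ell(Y)$ (the Laurent polynomial describing the behaviour at infinity of the two-point modular graph function $D_\ell(\tau)$) are polynomials with rational coefficients in the odd zeta values $\zeta(3),\zeta(5),\zeta(7),\dots$; that is, they belong to the ring $\mathcal{R}=\mathbb{Q}[\zeta(3),\zeta(5),\zeta(7),\ldots]$.
   Context: For $\tau$ in the complex upper half-plane put $q=e^{2\pi i\tau}$, $\Lambda_\tau=\mathbb{Z}\tau+\mathbb{Z}$, $\eta(\tau)=q^{1/24}\prod_{n\ge1}(1-q^n)$ and $$\theta_1(z,\tau)=2q^{1/8}\sin(\pi z)\prod_{n\ge1}(1-q^n)(1-q^ne^{2\pi i z})(1-q^ne^{-2\pi i z}).$$ The Green's function on the torus $\mathbb{C}/\Lambda_\tau$ is $$G(z,\tau)=-\log\left|\frac{\theta_1(z,\tau)}{\eta(\tau)}\right|^2+\frac{2\pi\,\mathrm{Im}(z)^2}{\mathrm{Im}(\tau)},$$ which is invariant under $z\mapsto z+\omega$, $\omega\in\Lambda_\tau$. For an integer $\ell\ge0$ the two-point modular graph function is $$D_\ell(\tau)=\iint_{\mathbb{C}/\Lambda_\tau}G(z,\tau)^\ell\,d\mu(z),\qquad d\mu(z)=\frac{i\,dz\,d\overline z}{2\,\mathrm{Im}(\tau)},$$ where $d\mu$ is the translation-invariant measure of total mass $1$. With $Y:=2\pi\,\mathrm{Im}(\tau)$, it is known that as $Y\to+\infty$ one has $D_\ell(\tau)=d_\ell(Y)$ up to exponentially small terms (i.e. up to $O(e^{-cY})$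 for some $c>0$) for a Laurent polynomial $d_\ell(Y)\in\mathbb{R}[Y,Y^{-1}]$, which is uniquely determined by this property. *)

theory Defs
  imports "HOL-Analysis.Analysis" "HOL-Library.Landau_Symbols" "HOL-Library.Poly_Mapping"
begin

text \<open>The fractional powers of the nome $q = e^{2 \pi i \tau}$ are
  $q^a = e^{2 \pi i a \tau}$. The factors are indexed from $0$, hence \<open>Suc n\<close>.\<close>

definition nome :: "complex \<Rightarrow> complex" where
  "nome \<tau> = exp (2 * of_real pi * \<i> * \<tau>)"

definition dedekind_eta :: "complex \<Rightarrow> complex" where
  "dedekind_eta \<tau> = exp (2 * of_real pi * \<i> * \<tau> / 24) * prodinf (\<lambda>n. 1 - nome \<tau> ^ Suc n)"

definition theta1 :: "complex \<Rightarrow> complex \<Rightarrow> complex" where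
  "theta1 z \<tau> = 2 * exp (2 * of_real pi * \<i> * \<tau> / 8) * sin (of_real pi * z) *
     prodinf (\<lambda>n. (1 - nome \<tau> ^ Suc n)
                  * (1 - nome \<tau> ^ Suc n * exp (2 * of_real pi * \<i> * z))
                  * (1 - nome \<tau> ^ Suc n * exp (- (2 * of_real pi * \<i> * z))))"

text \<open>The Green's function is singular at the lattice points; there \<open>ln 0 = 0\<close> gives it an
  irrelevant value on a null set.\<close>

definition green :: "complex \<Rightarrow> complex \<Rightarrow> real" where
  "green z \<tau> = - ln ((cmod (theta1 z \<tau> / dedekind_eta \<tau>))\<^sup>2) + 2 * pi * (Im z)\<^sup>2 / Im \<tau>"

definition fundamental_parallelogram :: "complex \<Rightarrow> complex set" where
  "fundamental_parallelogram \<tau> =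
     {of_real s * \<tau> + of_real t | s t. s \<in> {0..<1} \<and> t \<in> {0..<1}}"

text \<open>The integral over $\mathbb{C}/(\mathbb{Z}\tau + \mathbb{Z})$ of a lattice-periodic function is its
  integral over a fundamental domain. In $z = x + i y$ the measure
  $i\,dz\,d\bar z / (2\,\mathrm{Im}\,\tau)$ is $dx\,dy / \mathrm{Im}\,\tau$.\<close>

definition modular_graph_D :: "nat \<Rightarrow> complex \<Rightarrow> real" where
  "modular_graph_D l \<tau> =
     (LINT z:fundamental_parallelogram \<tau>|lborel. green z \<tau> ^ l) / Im \<tau>"

text \<open>Real Laurent polynomials are finitely supported coefficient families indexed by
  the integers.\<close>

type_synonym laurent_poly = "int \<Rightarrow>\<^sub>0 real"

definition laurent_eval :: "laurent_poly \<Rightarrow> real \<Rightarrow> real" where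
  "laurent_eval p Y = (\<Sum>k\<in>Poly_Mapping.keys p. Poly_Mapping.lookup p k * Y powi k)"

text \<open>The filter expresses \<open>Im \<tau> \<longrightarrow> \<infinity>\<close> without restricting \<open>Re \<tau>\<close>, so the error bound is
  uniform in \<open>Re \<tau>\<close>.\<close>

definition describes_D_at_infinity :: "nat \<Rightarrow> laurent_poly \<Rightarrow> bool" where
  "describes_D_at_infinity l d \<longleftrightarrow>
     (\<exists>c>0. (\<lambda>\<tau>. modular_graph_D l \<tau> - laurent_eval d (2 * pi * Im \<tau>))
        \<in> O[filtercomap (\<lambda>\<tau>. 2 * pi * Im \<tau>) at_top](\<lambda>\<tau>. exp (- c * (2 * pi * Im \<tau>))))"

definition zeta_value :: "nat \<Rightarrow> real" where
  "zeta_value k = suminf (\<lambda>n. 1 / real (Suc n) ^ k)"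

text \<open>The subring of the reals generated by the rationals and the odd zeta values.\<close>

inductive_set odd_zeta_ring :: "real set" where
  rat: "x \<in> \<rat> \<Longrightarrow> x \<in> odd_zeta_ring"
| zeta: "odd k \<Longrightarrow> k \<ge> 3 \<Longrightarrow> zeta_value k \<in> odd_zeta_ring"
| add: "x \<in> odd_zeta_ring \<Longrightarrow> y \<in> odd_zeta_ring \<Longrightarrow> x + y \<in> odd_zeta_ring"
| mult: "x \<in> odd_zeta_ring \<Longrightarrow> y \<in> odd_zeta_ring \<Longrightarrow> x * y \<in> odd_zeta_ring"

end

theory Submission
  imports Defs "HOL-Complex_Analysis.Complex_Analysis" "HOL-Real_Asymp.Real_Asymp"
begin

text \<open>
  Write $z = s\tau + t$ and $S = sY$. Up to an exponentially small error the Green function is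
  $Y(s^2 - s + 1/6) + P(S,t) + P(Y - S,t')$ with $P(S,t) = -2\log|1 - e^{-S + 2\pi i t}|$, and mixed
  powers of the two potentials contribute an exponentially small amount. Since
  $Y(s^2-s+1/6) = Y/6 - S + S^2/Y$, the coefficients of $d_\ell$ are rational
  combinations of rational numbers and of
  $K(2m,n) = \int_0^\infty S^{2m} \int_0^1 ((P-S)^n - (-S)^n)\,dt\,dS$.

  Parseval's identity for $(1-w)^{-x}$ turns the generating function of the moments
  $V_N(\mu) = \int_0^\infty \int_0^1 ((P-\mu S)^N - (-\mu S)^N)\,dt\,dS$ into
  $\sum_{k\ge1} ((x)_k/k!)^2/(2k + \mu x)$. Only even powers of $S$ occur, so it
  suffices to know $V_N(1+\nu) + V_N(1-\nu)$ for rational $\nu$; the corresponding sum is a well-poised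
  ${}_5F_4$, evaluated by a quotient of Gamma functions whose logarithm has only odd zeta values as
  Taylor coefficients: with $\alpha,\beta = x(1\pm\nu)/2$,
  \[ \sum_{k\ge0} \Bigl(\frac{(x)_k}{k!}\Bigr)^2 \Bigl(\frac1{2k + 2\beta} + \frac1{2k + 2\alpha}\Bigr)
     = \frac{x}{2\alpha\beta}\,
       \frac{\Gamma(1+\alpha)\Gamma(1+\beta)\Gamma(1-x)}{\Gamma(1+x)\Gamma(1-\alpha)\Gamma(1-\beta)}. \]
\<close>

section \<open>The ring of odd zeta values\<close>

text \<open>The odd moments K(2m+1,n) are never evaluated. They stay out because the polynomial part
  is a - S with a = Y/6 + S^2/Y even in S: expanding about a keeps P - S intact and multiplies its
  powers only by powers of S^2. In turn V_N(1+\<nu>) is a polynomial in \<nu> whose coefficients are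
  the K(j,N-j) up to binomials and signs, and symmetrising in \<nu> retains the even j. Rationality
  of \<nu> enters twice: it puts the Taylor coefficients of the logarithm into the ring, and
  dividing by differences of rational nodes recovers the coefficients of a polynomial from its
  values without leaving the ring. In that logarithm the even zeta values cancel between
  \<Gamma>(1+u) and \<Gamma>(1-u), Euler's constant because \<alpha> + \<beta> = x. The analytic
  obstacle is the logarithmic singularity of P at S = 0 together with the growth of the powers of S.
  Both are met by bounding N-th powers through N! 4^N exp(u/4): exp(P/4) is at worst of order
  S^(-1/2), and enough decay remains at infinity. Such bounds justify all exchanges of sums and
  integrals and give the exponentially small errors.\<close>

lemma ring_0 [simp, intro]: "0 \<in> odd_zeta_ring"
  and ring_1 [simp, intro]: "1 \<in> odd_zeta_ring"
  by (simp_all add: odd_zeta_ring.rat)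

lemma ring_mult_rat: "c \<in> \<rat> \<Longrightarrow> x \<in> odd_zeta_ring \<Longrightarrow> c * x \<in> odd_zeta_ring"
  by (rule odd_zeta_ring.mult[OF odd_zeta_ring.rat])

lemma ring_uminus: "x \<in> odd_zeta_ring \<Longrightarrow> -x \<in> odd_zeta_ring"
  using ring_mult_rat[of "-1" x] by simp

lemma ring_diff: "x \<in> odd_zeta_ring \<Longrightarrow> y \<in> odd_zeta_ring \<Longrightarrow> x - y \<in> odd_zeta_ring"
  using odd_zeta_ring.add[OF _ ring_uminus, of x y] by simp

lemma ring_sum: "(\<And>i. i \<in> I \<Longrightarrow> f i \<in> odd_zeta_ring) \<Longrightarrow> sum f I \<in> odd_zeta_ring"
  by (induction I rule: infinite_finite_induct) (simp_all add: odd_zeta_ring.add)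

text \<open>Splitting off a linear factor at a node z0 divides the values by z - z0. This is a
  nonzero rational at the other nodes, so the quotient again takes ring values on infinitely many
  rationals and induction on the degree applies. Ring elements need not be invertible in the ring,
  hence the rational nodes.\<close>

lemma poly_coeff_in_ring:
  assumes "infinite Z" "Z \<subseteq> \<rat>" "\<And>z. z \<in> Z \<Longrightarrow> poly p z \<in> odd_zeta_ring"
  shows "coeff p i \<in> odd_zeta_ring"
  using assms
proof (induction "degree p" arbitrary: p Z i rule: less_induct)
  case (less p Z i)
  show ?case
  proof (cases "degree p = 0")
    case True
    then obtain c where c: "p = [:c:]" using degree_eq_zeroE by blast
    obtain z where "z \<in> Z" using less.prems(1) by fastforce
    with less.prems(3) c have "c \<in> odd_zeta_ring" by force
    thus ?thesis by (simp add: c coeff_pCons split: nat.split)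
  next
    case False
    obtain z0 where z0: "z0 \<in> Z" using less.prems(1) by fastforce
    define q where "q = synthetic_div p z0"
    have pq: "p = pCons (poly p z0) q - smult z0 q"
      using synthetic_div_correct[of p z0] by (simp add: q_def algebra_simps)
    have q: "coeff q j \<in> odd_zeta_ring" for j
    proof (rule less.hyps)
      show "degree q < degree p" using False by (simp add: q_def degree_synthetic_div)
      show "infinite (Z - {z0})" using less.prems(1) by simp
      show "Z - {z0} \<subseteq> \<rat>" using less.prems(2) by auto
      fix z assume z: "z \<in> Z - {z0}"
      have "poly p z = poly p z0 + (z - z0) * poly q z"
        by (subst pq) (simp add: algebra_simps)
      hence "poly q z = 1 / (z - z0) * (poly p z - poly p z0)" using z by (simp add: field_simps)
      also have "\<dots> \<in> odd_zeta_ring"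
        using z z0 less.prems(2,3) by (intro ring_mult_rat ring_diff Rats_divide Rats_diff) auto
      finally show "poly q z \<in> odd_zeta_ring" .
    qed
    show ?thesis
      by (subst pq) (use q z0 less.prems(2,3) in \<open>auto simp: coeff_pCons split: nat.split intro!: ring_diff ring_mult_rat\<close>)
  qed
qed

lemma fps_power_in_ring:
  fixes G :: "complex fps"
  assumes "\<And>n. fps_nth G n \<in> of_real ` odd_zeta_ring"
  shows "fps_nth (G ^ i) n \<in> of_real ` odd_zeta_ring"
proof (induction i arbitrary: n)
  case 0
  show ?case by (cases "n = 0") (auto simp: image_iff intro: bexI[of _ 0] bexI[of _ 1])
next
  case (Suc i)
  obtain g where g: "\<And>n. fps_nth G n = of_real (g n)" "\<And>n. g n \<in> odd_zeta_ring" 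
    using assms unfolding image_iff by metis
  obtain h where h: "\<And>n. fps_nth (G ^ i) n = of_real (h n)" "\<And>n. h n \<in> odd_zeta_ring" 
    using Suc unfolding image_iff by metis
  have "fps_nth (G ^ Suc i) n = of_real (\<Sum>j=0..n. g j * h (n - j))"
    by (simp add: fps_mult_nth g h)
  thus ?case by (rule image_eqI) (intro ring_sum odd_zeta_ring.mult g h)
qed

text \<open>The v n must be the coefficients of the formal exponential of the series with
  coefficients l n. As l 0 = 0, only finitely many of its powers reach a given degree, so v n is a
  polynomial with rational coefficients in the l i. The sums are known for small positive real x
  only; the passage to formal series goes through complex analytic functions.\<close>

lemma exp_powser_coeff_in_ring:
  fixes l v :: "nat \<Rightarrow> real"
  assumes l: "\<And>n. l n \<in> odd_zeta_ring" "l 0 = 0" and "\<delta> > 0"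
    and summable: "\<And>x. 0 < x \<Longrightarrow> x < \<delta> \<Longrightarrow> summable (\<lambda>n. l n * x ^ n)"
    and sums: "\<And>x. 0 < x \<Longrightarrow> x < \<delta> \<Longrightarrow> (\<lambda>n. v n * x ^ n) sums exp (suminf (\<lambda>n. l n * x ^ n))"
  shows "v n \<in> odd_zeta_ring"
proof -
  define G where "G = Abs_fps (\<lambda>n. complex_of_real (l n))"
  define V where "V = Abs_fps (\<lambda>n. complex_of_real (v n))"
  define H where "H = fps_compose (fps_exp 1) G"
  have rad: "fps_conv_radius (Abs_fps (\<lambda>n. complex_of_real (c n))) > 0"
    if "\<And>x. 0 < x \<Longrightarrow> x < \<delta> \<Longrightarrow> summable (\<lambda>n. c n * x ^ n)" for c :: "nat \<Rightarrow> real"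
  proof -
    have "summable (\<lambda>n. c n * (\<delta>/2) ^ n)" using that[of "\<delta>/2"] \<open>\<delta> > 0\<close> by simp
    hence "summable (\<lambda>n. complex_of_real (c n * (\<delta>/2) ^ n))" by (rule summable_of_real)
    hence "summable (\<lambda>n. complex_of_real (c n) * of_real (\<delta>/2) ^ n)" by simp
    hence "fps_conv_radius (Abs_fps (\<lambda>n. complex_of_real (c n))) \<ge> ereal (norm (complex_of_real (\<delta>/2)))"
      unfolding fps_conv_radius_def by (intro conv_radius_geI) simp
    moreover have "norm (complex_of_real (\<delta>/2)) > 0" using \<open>\<delta> > 0\<close> by simp
    ultimately show ?thesis by (metis ereal_less(2) less_le_trans)
  qed
  have rG: "fps_conv_radius G > 0" unfolding G_def by (rule rad) (use summable in auto)
  have rV: "fps_conv_radius V > 0" unfolding V_def by (rule rad) (use sums in \<open>auto simp: sums_iff\<close>)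
  have ev: "eval_fps (Abs_fps (\<lambda>n. complex_of_real (c n))) (of_real x) = of_real (suminf (\<lambda>n. c n * x ^ n))"
    if "summable (\<lambda>n. c n * x ^ n)" for c x
    using suminf_of_real[OF that, where ?'a = complex] unfolding eval_fps_def by simp
  have "(exp \<circ> eval_fps G) has_fps_expansion H"
    unfolding H_def using has_fps_expansion_exp[of 1] l(2) rG
    by (intro has_fps_expansion_compose eval_fps_has_fps_expansion) (auto simp: G_def)
  moreover have "eval_fps V has_fps_expansion V"
    using rV by (rule eval_fps_has_fps_expansion)
  ultimately have D: "(\<lambda>z. eval_fps V z - (exp \<circ> eval_fps G) z) has_fps_expansion (V - H)"
    by (intro fps_expansion_intros)
  \<comment> \<open>A nonzero expansion would keep the difference away from 0 on a punctured disc,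
    but it vanishes at all small positive reals.\<close>
  have "V - H = 0"
  proof (rule ccontr)
    assume "V - H \<noteq> 0"
    hence "eventually (\<lambda>z. eval_fps V z - (exp \<circ> eval_fps G) z \<noteq> 0) (at 0)"
      using D unfolding has_fps_expansion_to_laurent
      by (intro has_laurent_expansion_nonzero_imp_eventually_nonzero[of _ "fps_to_fls (V - H)"]) auto
    then obtain e where e: "e > 0" "\<And>z. z \<noteq> 0 \<Longrightarrow> dist z 0 < e \<Longrightarrow> eval_fps V z - (exp \<circ> eval_fps G) z \<noteq> 0"
      unfolding eventually_at by blast
    define x where "x = min e \<delta> / 2"
    have x: "0 < x" "x < e" "x < \<delta>" using e(1) \<open>\<delta> > 0\<close> by (auto simp: x_def)
    have "eval_fps V (of_real x) - (exp \<circ> eval_fps G) (of_real x) = 0"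
      using summable[OF x(1,3)] sums[OF x(1,3)] by (simp add: V_def G_def ev sums_iff exp_of_real)
    thus False using e(2)[of "of_real x"] x by simp
  qed
  hence "V = H" by simp
  have G: "fps_nth (G ^ i) n \<in> of_real ` odd_zeta_ring" for i n
    by (rule fps_power_in_ring) (use l in \<open>auto simp: G_def\<close>)
  then obtain g where g: "\<And>i n. fps_nth (G ^ i) n = of_real (g i n)" "\<And>i n. g i n \<in> odd_zeta_ring"
    unfolding image_iff by metis
  have "complex_of_real (v n) = fps_nth H n" by (simp flip: \<open>V = H\<close> add: V_def)
  also have "\<dots> = of_real (\<Sum>i=0..n. 1 / fact i * g i n)"
    unfolding H_def fps_compose_nth by (simp add: g)
  finally have "v n = (\<Sum>i=0..n. 1 / fact i * g i n)" by (simp only: of_real_eq_iff)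
  also have "\<dots> \<in> odd_zeta_ring"
  proof (intro ring_sum ring_mult_rat g)
    fix i show "1 / fact i \<in> (\<rat> :: real set)" by (metis Rats_1 Rats_divide Rats_of_nat of_nat_fact)
  qed
  finally show ?thesis .
qed

section \<open>A well-poised hypergeometric sum\<close>

text \<open>Both sides are polynomials of degree below the number of nodes and agree at the nodes.
  The differences are oriented as \<open>e j - z\<close> because in the application z lies below
  every node, so these factors are positive and can be divided out.\<close>

lemma lagrange_interpolation:
  fixes p :: "'a :: field poly"
  assumes I: "finite I" "inj_on e I" and deg: "degree p < card I"
  shows "poly p z = (\<Sum>k\<in>I. poly p (e k) * (\<Prod>j\<in>I - {k}. (e j - z) / (e j - e k)))"
proof -
  define q where "q = (\<Sum>k\<in>I. smult (poly p (e k)) (\<Prod>j\<in>I - {k}. smult (1 / (e j - e k)) [:e j, -1:]))"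
  have "degree q \<le> card I - 1"
    unfolding q_def
  proof (rule degree_sum_le[OF I(1)])
    fix k assume k: "k \<in> I"
    have "degree (\<Prod>j\<in>I - {k}. smult (1 / (e j - e k)) [:e j, -1:]) \<le> (\<Sum>j\<in>I - {k}. 1)"
      using I(1) by (intro order.trans[OF degree_prod_sum_le] sum_mono) (auto)
    thus "degree (smult (poly p (e k)) (\<Prod>j\<in>I - {k}. smult (1 / (e j - e k)) [:e j, -1:])) \<le> card I - 1"
      using k I(1) by (intro order.trans[OF degree_smult_le]) (simp add: card_Diff_singleton)
  qed
  hence degq: "degree q < card I" using deg by linarith
  have val: "poly q z = (\<Sum>k\<in>I. poly p (e k) * (\<Prod>j\<in>I - {k}. (e j - z) / (e j - e k)))" for z
    by (simp add: q_def poly_sum poly_prod diff_divide_distrib)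
  have "p = q"
  proof (rule poly_eqI_degree)
    fix z assume "z \<in> e ` I"
    then obtain i where i: "i \<in> I" "z = e i" by auto
    have "poly q z = (\<Sum>k\<in>I. if k = i then poly p (e i) else 0)"
      unfolding val i
    proof (rule sum.cong[OF refl], goal_cases)
      case (1 k)
      have "(\<Prod>j\<in>I - {i}. (e j - e i) / (e j - e i)) = 1"
        by (rule prod.neutral) (use I(2) i(1) in \<open>auto simp: inj_on_def\<close>)
      moreover have "(\<Prod>j\<in>I - {k}. (e j - e i) / (e j - e k)) = 0" if "k \<noteq> i"
        by (rule prod_zero) (use I(1) i(1) that in auto)
      ultimately show ?case by auto
    qed
    thus "poly p z = poly q z" using i I(1) by simp
  qed (use deg degq I in \<open>auto simp: card_image\<close>)
  show ?thesis using val[of z] unfolding \<open>p = q\<close>[symmetric] .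
qed

text \<open>Square of the coefficient of w^k in (1-w)^(-x), as it occurs in Parseval's
  identity.\<close>

definition binom_sq :: "real \<Rightarrow> nat \<Rightarrow> real" where
  "binom_sq x k = (pochhammer x k / fact k)\<^sup>2"

text \<open>In Pochhammer symbols this is (-M)_k (M+1)_k / ((x-M)_k (M+1+x)_k): the two pairs, -M
  with M+1+x and M+1 with x-M, each of sum 1 + x, that truncation adds to a well-poised series with
  leading parameter x.\<close>

definition lagrange_corr :: "real \<Rightarrow> nat \<Rightarrow> nat \<Rightarrow> real" where
  "lagrange_corr x M k = (\<Prod>i<k. (real M - real i) / (real M - real i - x)) * (\<Prod>i<k. (real M + 1 + real i) / (real M + 1 + real i + x))"

lemma lagrange_corr_Suc:
  assumes "k \<le> M" "0 < x" "x < 1"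
  shows "lagrange_corr x (Suc M) k = lagrange_corr x M k * ((real M+1+x) * (real M+1-k-x) * (real M+1+k) / ((real M+1-x)*(real M+1-k)*(real M+1+k+x)))"
proof -
  \<comment> \<open>Raising M by one shifts the product by one index, so only its end factors
    change; k \<le> M keeps the denominators nonzero.\<close>
  have 1: "(\<Prod>i<k. (real (Suc M) - real i) / (real (Suc M) - real i - x)) =
     (\<Prod>i<k. (real M - real i) / (real M - real i - x)) * ((real M+1) * (real M+1-k-x) / ((real M+1-x) * (real M+1-k)))"
    using assms(1)
  proof (induction k)
    case 0
    have "real M + 1 - x \<noteq> 0" using assms by simp
    thus ?case by (simp add: divide_simps mult.commute add.commute)
  next
    case (Suc k)
    have "real k + 1 \<le> real M" using Suc.prems by linarith
    hence nz: "real M - k \<noteq> 0" "real M - k - x \<noteq> 0" "real M + 1 - k \<noteq> 0" "real M + 1 - k - x \<noteq> 0" "real M + 1 - x \<noteq> 0"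
      using assms by auto
    have e: "real M + 1 - real (Suc k) = real M - k" by simp
    have "(\<Prod>i<Suc k. (real (Suc M) - real i) / (real (Suc M) - real i - x)) =
        (\<Prod>i<k. (real M - real i) / (real M - real i - x)) * ((real M+1) * (real M+1-k-x) / ((real M+1-x) * (real M+1-k)))
         * ((real M + 1 - k) / (real M + 1 - k - x))"
      using Suc by (simp add: algebra_simps)
    also have "\<dots> = (\<Prod>i<k. (real M - real i) / (real M - real i - x)) * ((real M + 1) / (real M + 1 - x))"
      using nz unfolding mult.assoc by (intro arg_cong2[where f = "(*)"] refl) (simp add: divide_simps)
    also have "\<dots> = (\<Prod>i<Suc k. (real M - real i) / (real M - real i - x)) * ((real M+1) * (real M - k-x) / ((real M+1-x) * (real M-k)))"
      using nz unfolding prod.lessThan_Suc mult.assoc by (intro arg_cong2[where f = "(*)"] refl) (simp add: divide_simps)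
    finally show ?case by (simp only: e)
  qed
  have 2: "(\<Prod>i<k. (real (Suc M) + 1 + real i) / (real (Suc M) + 1 + real i + x)) =
     (\<Prod>i<k. (real M + 1 + real i) / (real M + 1 + real i + x)) * ((real M+1+k) * (real M+1+x) / ((real M+1+k+x) * (real M + 1)))"
  proof (induction k)
    case 0
    have "real M + 1 + x \<noteq> 0" using assms by simp
    thus ?case by (simp add: divide_simps mult.commute add.commute)
  next
    case (Suc k)
    have nz: "real M + 1 + k + x > 0" "real M + 1 + (k + 1) + x > 0" "real M + 1 + x > 0"
      using assms by auto
    have e: "real (Suc M) + 1 + real k = real M + 2 + real k" "real (Suc k) = real k + 1" by simp_all
    show ?case unfolding prod.lessThan_Suc Suc e using nz by (simp add: divide_simps) (simp add: algebra_simps)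
  qed
  \<comment> \<open>Here m stands for M + 1, the one factor that cancels between the two
    ratios.\<close>
  have "A * (m * b / (c * d)) * (B * (e * f / (g * m))) = A * B * (f * b * e / (c * d * g))"
    if "m \<noteq> 0" for A B b c d e f g m :: real
    using that by (simp add: mult_ac)
  note gen = this
  show ?thesis unfolding lagrange_corr_def 1 2 by (subst gen) auto
qed

text \<open>With e k = (k + x/2)^2 and E = (x\<nu>/2)^2 this is the coefficient of 1/(e k - E) in
  the partial fraction decomposition. Differences of nodes factor as e j - e k = (j - k)(j + k + x),
  and the numerator at a node as (j - x/2)^2 - e k = (j - k - x)(j + k).\<close>

definition partial_fraction_coeff :: "real \<Rightarrow> nat \<Rightarrow> nat \<Rightarrow> real" where
  "partial_fraction_coeff x M k = (\<Prod>j<M. (real (Suc j) + x) / (real (Suc j) - x)) * (\<Prod>j<M. (real (Suc j) - real k - x) * (real (Suc j) + real k))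
     / (\<Prod>j\<in>{..M}-{k}. (real j - real k) * (real j + real k + x))"

lemma partial_fraction_coeff_Suc:
  assumes "k \<le> M" "0 < x" "x < 1"
  shows "partial_fraction_coeff x (Suc M) k = partial_fraction_coeff x M k * ((M+1+x) * (real M+1-k-x) * (M+1+k) / ((M+1-x)*(real M+1-k)*(M+1+k+x)))"
proof -
  have ins: "{..Suc M} - {k} = insert (Suc M) ({..M}-{k})" using assms by auto
  have A: "(\<Prod>j\<in>{..Suc M}-{k}. (real j - real k) * (real j + real k + x)) = 
     (real (Suc M) - real k) * (real (Suc M) + real k + x) * (\<Prod>j\<in>{..M}-{k}. (real j - real k) * (real j + real k + x))"
    unfolding ins by (subst prod.insert) auto
  have "P * (a / b) * (Q * (c * d)) / (e * f * R) = P * Q / R * (a * c * d / (b * e * f))"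
    for P Q R a b c d e f :: real by (simp add: mult_ac)
  note gen = this
  show ?thesis unfolding partial_fraction_coeff_def A prod.lessThan_Suc gen by (simp add: add_ac)
qed

text \<open>At M = k no index exceeds k. Reversing the order of the factors therefore turns the
  products that measure the distance to k into Pochhammer symbols and factorials, and the two signs
  (-1)^k cancel.\<close>

lemma partial_fraction_coeff_diag:
  assumes "0 < x" "x < 1"
  shows "partial_fraction_coeff x k k = (2*k+x) * binom_sq x k / x * lagrange_corr x k k"
proof -
  have set: "{..k} - {k} = {..<k}" by auto
  have a: "(\<Prod>j<k. (real (Suc j) - k - x)) = (-1)^k * pochhammer x k"
  proof -
    have "(\<Prod>j<k. (real (Suc j) - k - x)) = (\<Prod>j<k. - (x + real j))"
      by (rule prod.reindex_bij_witness[of _ "\<lambda>j. k - Suc j" "\<lambda>j. k - Suc j"]) (auto simp: of_nat_diff)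
    also have "\<dots> = (-1)^k * (\<Prod>j<k. x + real j)" 
      by (subst prod_uminus) simp
    finally show ?thesis by (simp add: pochhammer_prod lessThan_atLeast0)
  qed
  have b: "(\<Prod>j<k. (real j - k)) = (-1)^k * fact k"
  proof -
    have "(\<Prod>j<k. (real j - k)) = (\<Prod>j<k. - real (Suc j))"
      by (rule prod.reindex_bij_witness[of _ "\<lambda>j. k - Suc j" "\<lambda>j. k - Suc j"]) (auto simp: of_nat_diff)
    also have "\<dots> = (-1)^k * (\<Prod>j<k. real (Suc j))" by (subst prod_uminus) simp
    finally show ?thesis by (simp add: fact_prod_Suc lessThan_atLeast0)
  qed
  have c: "(\<Prod>i<k. (real k - real i) / (real k - real i - x)) = fact k / (\<Prod>j<k. (real (Suc j) - x))"
  proof -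
    have "(\<Prod>i<k. (real k - real i) / (real k - real i - x)) = (\<Prod>j<k. real (Suc j) / (real (Suc j) - x))"
      by (rule prod.reindex_bij_witness[of _ "\<lambda>j. k - Suc j" "\<lambda>j. k - Suc j"]) (auto simp: of_nat_diff)
    thus ?thesis by (simp add: prod_dividef fact_prod_Suc lessThan_atLeast0)
  qed
  have d: "(\<Prod>j<k. (real (Suc j) + x)) * x = pochhammer x k * (x + k)"
  proof (induction k)
    case (Suc k)
    have "(\<Prod>j<Suc k. (real (Suc j) + x)) * x = ((\<Prod>j<k. (real (Suc j) + x)) * x) * (Suc k + x)"
      by simp
    also have "\<dots> = pochhammer x (Suc k) * (x + Suc k)"
      unfolding Suc by (simp add: pochhammer_Suc algebra_simps)
    finally show ?case .
  qed auto
  have e: "(\<Prod>j<k. (real k + 1 + real j + x)) * (k + x) = (\<Prod>j<k. (real j + real k + x)) * (2 * k + x)"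
  proof -
    have "(\<Prod>j<n. (real k + 1 + real j + x)) * (k + x) = (\<Prod>j<n. (real j + real k + x)) * (n + k + x)" for n
      proof (induction n)
      case (Suc n)
      have "(\<Prod>j<Suc n. (real k + 1 + real j + x)) * (k + x) = ((\<Prod>j<n. (real k + 1 + real j + x)) * (k + x)) * (real k + 1 + real n + x)"
        by simp
      also have "\<dots> = (\<Prod>j<Suc n. (real j + real k + x)) * (Suc n + k + x)"
        unfolding Suc by (simp add: algebra_simps)
      finally show ?case .
    qed auto
    from this[of k] show ?thesis by simp
  qed
  have pos: "(\<Prod>j<k. (real k + 1 + real j + x)) > 0" "(\<Prod>j<k. (real j + real k + x)) > 0" "(\<Prod>j<k. (real (Suc j) - x)) > 0"
    "pochhammer x k > 0"
    using assms by (auto intro!: prod_pos pochhammer_pos)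
  define A B C D F where "A = (\<Prod>j<k. (real k + 1 + real j + x))" and "B = (\<Prod>j<k. (real j + real k + x))" 
    and "C = (\<Prod>j<k. (real (Suc j) - x))" and "D = (\<Prod>j<k. (real (Suc j) + x))" and "F = (\<Prod>j<k. real k + 1 + real j)"
  note defs = A_def[symmetric] B_def[symmetric] C_def[symmetric] D_def[symmetric] F_def[symmetric]
  have F': "(\<Prod>j<k. real (Suc j) + real k) = F" unfolding F_def by (rule prod.cong) auto
  have B': "(\<Prod>j<k. real (j + k) + x) = B" unfolding B_def by (rule prod.cong) auto
  have s: "((-1)^k * (-1)^k :: real) = 1" by (simp flip: power_add)
  have l: "partial_fraction_coeff x k k = D / C * ((-1)^k * pochhammer x k * F) / ((-1)^k * fact k * B)"
    unfolding partial_fraction_coeff_def set prod.distrib prod_dividef a b defs F' B' ..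
  have r: "lagrange_corr x k k = fact k / C * (F / A)"
    unfolding lagrange_corr_def c unfolding prod_dividef defs F' ..
  have "D * A = (pochhammer x k * (2*k+x) / x) * B"
  proof -
    have "D * x * (A * (k + x)) = pochhammer x k * (x + k) * (B * (2*k+x))"
      using d e unfolding defs by simp
    hence "(k + x) * (D * A * x) = (k + x) * (pochhammer x k * (2*k+x) * B)" by (simp add: algebra_simps)
    moreover have "k + x \<noteq> 0" using assms by simp
    ultimately have "D * A * x = pochhammer x k * (2*k+x) * B" by (metis mult_left_cancel)
    thus ?thesis using assms by (simp add: field_simps)
  qed
  moreover have "A > 0" "B > 0" "C > 0" using pos unfolding defs by auto
  moreover have "D / B = q / A" if "D * A = q * B" "A > 0" "B > 0" for q
    using that by (simp add: divide_simps)
  ultimately have DB: "D / B = (pochhammer x k * (2*k+x) / x) / A" by blast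
  have "partial_fraction_coeff x k k = (D / B) * (pochhammer x k / fact k) * F / C"
    unfolding l by (simp add: field_simps)
  also have "\<dots> = (2*k+x) * binom_sq x k / x * lagrange_corr x k k"
    unfolding DB r binom_sq_def using \<open>A > 0\<close> \<open>C > 0\<close> assms by (simp add: field_simps power2_eq_square)
  finally show ?thesis by simp
qed

text \<open>Both sides acquire the same factor when M grows by one, so the identity reduces to M =
  k.\<close>

lemma partial_fraction_coeff_eq:
  assumes "k \<le> M" "0 < x" "x < 1"
  shows "partial_fraction_coeff x M k = (2*k+x) * binom_sq x k / x * lagrange_corr x M k"
  using assms(1)
proof (induction M rule: dec_induct)
  case base thus ?case using partial_fraction_coeff_diag assms by simp
next
  case (step M)
  thus ?case using partial_fraction_coeff_Suc[of k M x] lagrange_corr_Suc[of k M x] assms by simp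
qed

text \<open>Truncation of the Gamma quotient of the introduction. It is a rational function of
  $\nu^2$, and its partial fraction decomposition is the truncated hypergeometric sum, each term
  carrying a factor \<open>lagrange_corr\<close> that tends to $1$.\<close>

definition gamma_product :: "real \<Rightarrow> real \<Rightarrow> nat \<Rightarrow> real" where
  "gamma_product x \<nu> M = (\<Prod>j<M. ((real (Suc j) + x) * (real (Suc j) - x*(1+\<nu>)/2) * (real (Suc j) - x*(1-\<nu>)/2))
        / ((real (Suc j) - x) * (real (Suc j) + x*(1+\<nu>)/2) * (real (Suc j) + x*(1-\<nu>)/2)))"

text \<open>A case of Dougall's terminating 7F6 sum: leading parameter x, further parameters x,
  \<alpha>, \<beta>, M + 1 and -M, where \<alpha> + \<beta> = x supplies the balancing
  condition.\<close>

lemma gamma_product_eq: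
  assumes x: "0 < x" "x < 1" and \<nu>: "0 < \<nu>" "\<nu> < 1"
  shows "4 / (x\<^sup>2 * (1 - \<nu>\<^sup>2)) * gamma_product x \<nu> M = 
     (\<Sum>k\<le>M. (2*k+x) * binom_sq x k / x * lagrange_corr x M k / ((k + x/2)\<^sup>2 - (x*\<nu>/2)\<^sup>2))"
proof -
  define E where "E = (x*\<nu>/2)\<^sup>2"
  define e where "e = (\<lambda>k::nat. (k + x/2)\<^sup>2)"
  \<comment> \<open>The numerator of \<open>gamma_product\<close> has degree M in E against the M +
    1 poles e 0, ..., e M. Interpolation at the poles is thus exact, and the decomposition has no
    polynomial part.\<close>
  define p where "p = (\<Prod>j<M. [:(real (Suc j) - x/2)\<^sup>2, -1:])"
  have pe: "poly p z = (\<Prod>j<M. (real (Suc j) - x/2)\<^sup>2 - z)" for z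
    by (simp add: p_def poly_prod)
  have "degree p \<le> (\<Sum>j<M. 1)" unfolding p_def
    by (intro order.trans[OF degree_prod_sum_le] sum_mono) auto
  hence "degree p < card {..M}" by simp
  moreover have "inj_on e {..M}"
    using x by (auto simp: inj_on_def e_def power2_eq_iff)
  ultimately have L: "poly p E = (\<Sum>k\<le>M. poly p (e k) * (\<Prod>j\<in>{..M} - {k}. (e j - E) / (e j - e k)))"
    by (intro lagrange_interpolation) auto
  \<comment> \<open>\<nu> < 1 places E strictly below all nodes, including e 0.\<close>
  have xn: "x * \<nu> < x" using x \<nu> by simp
  have eE: "e j - E > 0" for j
  proof -
    have "x * \<nu> / 2 < j + x/2" using xn of_nat_0_le_iff[of j, where ?'a = real] by linarith
    hence "(x * \<nu> / 2)\<^sup>2 < (j + x/2)\<^sup>2" using x \<nu> by (intro power_strict_mono) auto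
    thus ?thesis by (simp add: e_def E_def)
  qed
  define Q where "Q = (\<Prod>j\<le>M. e j - E)"
  have Q: "Q > 0" unfolding Q_def using eE by (auto intro!: prod_pos)
  have "poly p E / Q = (\<Sum>k\<le>M. poly p (e k) / (\<Prod>j\<in>{..M} - {k}. (e j - e k)) / (e k - E))"
    unfolding L sum_divide_distrib
  proof (rule sum.cong[OF refl])
    fix k assume "k \<in> {..M}"
    hence Qk: "Q = (e k - E) * (\<Prod>j\<in>{..M} - {k}. e j - E)" unfolding Q_def by (subst prod.remove) auto
    have pos: "(\<Prod>j\<in>{..M} - {k}. e j - E) > 0" using eE by (auto intro!: prod_pos)
    have gen: "a * (P / D) / (b * P) = a / D / b" if "P > 0" for a b D P :: real
      using that by simp
    show "poly p (e k) * (\<Prod>j\<in>{..M} - {k}. (e j - E) / (e j - e k)) / Q = 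
      poly p (e k) / (\<Prod>j\<in>{..M} - {k}. (e j - e k)) / (e k - E)"
      unfolding Qk prod_dividef by (rule gen[OF pos])
  qed
  moreover define c where "c = (\<Prod>j<M. (real (Suc j) + x) / (real (Suc j) - x))"
  ultimately have main: "c * (poly p E / Q) = (\<Sum>k\<le>M. c * poly p (e k) / (\<Prod>j\<in>{..M} - {k}. (e j - e k)) / (e k - E))"
    by (simp add: sum_distrib_left)
  have R: "c * poly p (e k) / (\<Prod>j\<in>{..M} - {k}. (e j - e k)) = partial_fraction_coeff x M k" for k
  proof -
    have "poly p (e k) = (\<Prod>j<M. (real (Suc j) - real k - x) * (real (Suc j) + real k))"
      unfolding pe e_def by (rule prod.cong) (auto simp: power2_eq_square algebra_simps)
    moreover have "(\<Prod>j\<in>{..M} - {k}. (e j - e k)) = (\<Prod>j\<in>{..M}-{k}. (real j - real k) * (real j + real k + x))"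
      unfolding e_def by (rule prod.cong) (auto simp: power2_eq_square algebra_simps)
    ultimately show ?thesis unfolding partial_fraction_coeff_def c_def by simp
  qed
  have fac: "(j + x/2)\<^sup>2 - E = (j + x*(1+\<nu>)/2) * (j + x*(1-\<nu>)/2)"
        "(j - x/2)\<^sup>2 - E = (j - x*(1+\<nu>)/2) * (j - x*(1-\<nu>)/2)" for j :: real
    by (auto simp: E_def power2_eq_square field_simps)
  have "Q = (e 0 - E) * (\<Prod>j<M. e (Suc j) - E)"
    unfolding Q_def by (subst prod.atMost_shift) (simp add: lessThan_Suc_atMost)
  also have "(\<Prod>j<M. e (Suc j) - E) = (\<Prod>j<M. (real (Suc j) + x*(1+\<nu>)/2) * (real (Suc j) + x*(1-\<nu>)/2))"
    unfolding e_def fac ..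
  also have "e 0 - E = x\<^sup>2 * (1 - \<nu>\<^sup>2) / 4" by (simp add: e_def E_def field_simps power2_eq_square)
  finally have Q_eq: "Q = x\<^sup>2 * (1 - \<nu>\<^sup>2) / 4 *
    (\<Prod>j<M. (real (Suc j) + x*(1+\<nu>)/2) * (real (Suc j) + x*(1-\<nu>)/2))" .
  have gen: "a / b * (c * d / (w / 4 * (e * f))) = 4 / w * (a * c * d / (b * e * f))" for a b c d e f w :: real
    by (simp add: mult_ac)
  have "c * (poly p E / Q) = 4 / (x\<^sup>2 * (1 - \<nu>\<^sup>2)) * gamma_product x \<nu> M"
    unfolding pe c_def gamma_product_def fac Q_eq prod_dividef prod.distrib gen ..
  with main have "4 / (x\<^sup>2 * (1 - \<nu>\<^sup>2)) * gamma_product x \<nu> M = (\<Sum>k\<le>M. partial_fraction_coeff x M k / (e k - E))"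
    using R by simp
  also have "\<dots> = (\<Sum>k\<le>M. (2*k+x) * binom_sq x k / x * lagrange_corr x M k / (e k - E))"
    using partial_fraction_coeff_eq x by simp
  finally show ?thesis by (simp add: e_def E_def)
qed


section \<open>Passage from the truncated to the infinite sum\<close>

lemma lagrange_corr_bound:
  assumes "k \<le> M" "0 < x" "x < 1"
  shows "0 \<le> lagrange_corr x M k" "lagrange_corr x M k \<le> (\<Prod>i<k. real (Suc i) / (real (Suc i) - x))"
proof -
  have gt: "real M - real i - x > 0" if "i < k" for i
  proof -
    have "real M \<ge> real i + 1" using that assms by linarith
    thus ?thesis using assms by linarith
  qed
  show "0 \<le> lagrange_corr x M k"
    unfolding lagrange_corr_def using gt assms
    by (intro mult_nonneg_nonneg prod_nonneg) (auto intro!: divide_nonneg_pos simp: less_imp_le)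
  \<comment> \<open>Each factor decreases in M, so M = k is the worst case and the bound is uniform
    in M; reversing the product gives the stated form.\<close>
  have "(\<Prod>i<k. (real M - real i) / (real M - real i - x)) \<le> (\<Prod>i<k. (real k - real i) / (real k - real i - x))"
  proof (rule prod_mono)
    fix i assume "i \<in> {..<k}"
    hence i: "i < k" by auto
    have "real k \<ge> real i + 1" using i by linarith
    hence "real k - real i - x > 0" using assms by linarith
    moreover have "(real M - real i) * (real k - real i - x) \<le> (real k - real i) * (real M - real i - x)"
      using assms mult_right_mono[of "real k" "real M" x] by (simp add: algebra_simps)
    ultimately show "0 \<le> (real M - real i) / (real M - real i - x) \<and>
         (real M - real i) / (real M - real i - x) \<le> (real k - real i) / (real k - real i - x)"
      using gt[OF i] assms by (auto simp: field_simps)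
  qed
  also have "\<dots> = (\<Prod>i<k. real (Suc i) / (real (Suc i) - x))"
    by (rule prod.reindex_bij_witness[of _ "\<lambda>j. k - Suc j" "\<lambda>j. k - Suc j"]) (auto simp: of_nat_diff)
  finally have 1: "(\<Prod>i<k. (real M - real i) / (real M - real i - x)) \<le> (\<Prod>i<k. real (Suc i) / (real (Suc i) - x))" .
  have 2: "(\<Prod>i<k. (real M + 1 + real i) / (real M + 1 + real i + x)) \<le> 1"
    using assms by (intro prod_le_1) auto
  have "lagrange_corr x M k \<le> (\<Prod>i<k. real (Suc i) / (real (Suc i) - x)) * 1"
    unfolding lagrange_corr_def using 1 2 assms 
    by (intro mult_mono) (auto intro!: prod_nonneg divide_nonneg_pos)
  thus "lagrange_corr x M k \<le> (\<Prod>i<k. real (Suc i) / (real (Suc i) - x))" by simp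
qed

lemma lagrange_corr_limit: "(\<lambda>M. lagrange_corr x M k) \<longlonglongrightarrow> 1"
proof -
  have 1: "(\<lambda>M. (real M - real i) / (real M - real i - x)) \<longlonglongrightarrow> 1" for i by real_asymp
  have 2: "(\<lambda>M. (real M + 1 + real i) / (real M + 1 + real i + x)) \<longlonglongrightarrow> 1" for i by real_asymp
  have "(\<lambda>M. lagrange_corr x M k) \<longlonglongrightarrow> (\<Prod>i<k. 1) * (\<Prod>i<k. 1)"
    unfolding lagrange_corr_def by (intro tendsto_mult tendsto_prod 1 2)
  thus ?thesis by simp
qed

text \<open>The left-hand side behaves like k^(3x-2): k^(2x-2) from \<open>binom_sq\<close> and k^x
  from the product. For x \<le> 1/8 this is well below 1/k, and the rational bound of order 1/k is
  shaped so that the induction closes.\<close>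

lemma binom_sq_bound:
  assumes "0 < x" "x \<le> 1/8"
  shows "binom_sq x (Suc k) * (\<Prod>i<Suc k. real (Suc i) / (real (Suc i) - x)) \<le> (real k + 2) / (real k + 1)\<^sup>2"
proof (induction k)
  case 0
  have "x\<^sup>2 \<le> (1/8)\<^sup>2" using assms by (intro power_mono) auto
  hence "x\<^sup>2 / (1 - x) \<le> (1/8)\<^sup>2 / (7/8)" using assms by (intro frac_le) auto
  also have "\<dots> \<le> 2" by (simp add: power2_eq_square)
  finally show ?case by (simp add: binom_sq_def power2_eq_square)
next
  case (Suc k)
  define P where "P = (\<Prod>i<Suc k. real (Suc i) / (real (Suc i) - x))"
  define B where "B = binom_sq x (Suc k)"
  have B: "binom_sq x (Suc (Suc k)) = B * ((x + real k + 1) / (real k + 2))\<^sup>2"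
    by (simp add: B_def binom_sq_def pochhammer_Suc[of x "Suc k"] fact_Suc[of "Suc k"] power_mult_distrib power_divide mult_ac add_ac)
  have "(\<Prod>i<Suc (Suc k). real (Suc i) / (real (Suc i) - x)) = P * ((real k + 2) / (real k + 2 - x))"
    unfolding prod.lessThan_Suc[of _ "Suc k"] P_def by (simp add: add_ac)
  hence "binom_sq x (Suc (Suc k)) * (\<Prod>i<Suc (Suc k). real (Suc i) / (real (Suc i) - x))
      = B * P * (((x + real k + 1) / (real k + 2))\<^sup>2 * ((real k + 2) / (real k + 2 - x)))"
    unfolding B by simp
  also have "\<dots> \<le> (real k + 2) / (real k + 1)\<^sup>2 * (((x + real k + 1) / (real k + 2))\<^sup>2 * ((real k + 2) / (real k + 2 - x)))"
    using Suc assms unfolding B_def P_def by (intro mult_right_mono) auto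
  also have "\<dots> = (x + real k + 1)\<^sup>2 / ((real k + 1)\<^sup>2 * (real k + 2 - x))"
    using assms by (simp add: power2_eq_square divide_simps)
  also have "\<dots> \<le> (real k + 3) / (real k + 2)\<^sup>2"
  proof -
    define n where "n = real k"
    have n: "n \<ge> 0" by (simp add: n_def)
    \<comment> \<open>9/8 and 15/8 are the values of 1 + x and 2 - x in the extreme case x = 1/8;
      the difference of the two sides then has nonnegative coefficients in n.\<close>
    have "(x + n + 1)\<^sup>2 * (n+2)\<^sup>2 \<le> (n + 9/8)\<^sup>2 * (n+2)\<^sup>2"
      using assms n by (intro mult_right_mono power_mono) auto
    also have "\<dots> \<le> (n+3) * ((n+1)\<^sup>2 * (n + 15/8))"
    proof -
      have "(n+3) * ((n+1)\<^sup>2 * (n + 15/8)) - (n + 9/8)\<^sup>2 * (n+2)\<^sup>2 = 5/8 * n^3 + 135/64 * n^2 + 33/16 * n + 9/16"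
        by (simp add: power2_eq_square power3_eq_cube field_simps)
      moreover have "\<dots> \<ge> 0" using n by (intro add_nonneg_nonneg mult_nonneg_nonneg) auto
      ultimately show ?thesis by linarith
    qed
    also have "\<dots> \<le> (n+3) * ((n+1)\<^sup>2 * (n + 2 - x))"
      using assms n by (intro mult_left_mono) auto
    finally show ?thesis using assms n unfolding n_def[symmetric]
      by (simp add: divide_simps)
  qed
  finally show ?case by (simp add: add_ac)
qed

text \<open>Taylor coefficients in x, at fixed \<nu>, of the logarithm of the Gamma quotient. At n =
  1, where zeta diverges, the bracket is 0, so the value 0 is the true coefficient.\<close>

definition zeta_coeff :: "real \<Rightarrow> nat \<Rightarrow> real" where
  "zeta_coeff \<nu> n = (if odd n \<and> n \<ge> 3 then 2 / n * (1 - ((1+\<nu>)/2)^n - ((1-\<nu>)/2)^n) * zeta_value n else 0)"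

text \<open>This is 2 artanh u. Its oddness in u is the source of the restriction to odd zeta
  values.\<close>

lemma ln_quotient_sums:
  fixes u :: real assumes "\<bar>u\<bar> < 1"
  shows "(\<lambda>k. 2 * u ^ (2*k+1) / real (2*k+1)) sums ln ((1+u)/(1-u))"
proof -
  have "((1+u)/(1-u) - 1) / ((1+u)/(1-u) + 1) = u"
    using assms by (simp add: divide_simps abs_less_iff)
  moreover have "(1+u)/(1-u) > 0" using assms by auto
  ultimately show ?thesis using ln_series_quadratic[of "(1+u)/(1-u)"] by simp
qed

text \<open>The logarithm of each factor consists of three artanh terms, at x/j, a/j and b/j.
  Summing over j first turns the k-th coefficient into a partial sum of zeta(2k+1), and Tannery's
  theorem takes M to infinity.\<close>

lemma gamma_product_limit:
  assumes x: "0 < x" "x < 1" and \<nu>: "0 < \<nu>" "\<nu> < 1"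
  shows "summable (\<lambda>n. zeta_coeff \<nu> n * x ^ n)"
    "gamma_product x \<nu> \<longlonglongrightarrow> exp (suminf (\<lambda>n. zeta_coeff \<nu> n * x ^ n))"
proof -
  define g where "g = (\<lambda>u::real. ln ((1+u)/(1-u)))"
  define a where "a = x*(1+\<nu>)/2"
  define b where "b = x*(1-\<nu>)/2"
  have ab: "0 < a" "a < x" "0 < b" "b < x" "a + b = x"
    using x \<nu> by (auto simp: a_def b_def field_simps intro!: add_pos_pos)
  define c where "c = (\<lambda>k. 2 * (x ^ (2*k+1) - a ^ (2*k+1) - b ^ (2*k+1)) / real (2*k+1))"
  define H where "H = (\<lambda>k M. \<Sum>j<M. 1 / real (Suc j) ^ (2*k+1))"
  have phi: "gamma_product x \<nu> M = exp (\<Sum>j<M. g (x / Suc j) - g (a / Suc j) - g (b / Suc j))" for M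
  proof -
    have eg: "exp (g (u / n)) = (n + u) / (n - u)" if "0 < u" "u < n" for u n :: real
    proof -
      have "(1 + u/n) / (1 - u/n) = (n + u) / (n - u)" using that by (simp add: field_simps)
      moreover have "(n + u) / (n - u) > 0" using that by simp
      ultimately show ?thesis by (simp add: g_def)
    qed
    have "exp (g (x / Suc j) - g (a / Suc j) - g (b / Suc j)) =
       ((real (Suc j) + x) * (real (Suc j) - a) * (real (Suc j) - b))
        / ((real (Suc j) - x) * (real (Suc j) + a) * (real (Suc j) + b))" for j
      using ab x unfolding exp_diff by (subst (1 2 3) eg) auto
    thus ?thesis unfolding exp_sum[OF finite_lessThan] gamma_product_def a_def b_def by simp
  qed
  have S: "(\<lambda>k. c k * H k M) sums (\<Sum>j<M. g (x / Suc j) - g (a / Suc j) - g (b / Suc j))" for M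
  proof -
    have "(\<lambda>k. \<Sum>j<M. 2 * (x / Suc j) ^ (2*k+1) / real (2*k+1) - 2 * (a / Suc j) ^ (2*k+1) / real (2*k+1)
              - 2 * (b / Suc j) ^ (2*k+1) / real (2*k+1)) sums (\<Sum>j<M. g (x / Suc j) - g (a / Suc j) - g (b / Suc j))"
      unfolding g_def using ab x
      by (intro sums_sum sums_diff ln_quotient_sums) auto
    moreover have "(\<Sum>j<M. 2 * (x / Suc j) ^ (2*k+1) / real (2*k+1) - 2 * (a / Suc j) ^ (2*k+1) / real (2*k+1)
              - 2 * (b / Suc j) ^ (2*k+1) / real (2*k+1)) = c k * H k M" for k
      unfolding H_def c_def sum_distrib_left
      by (rule sum.cong[OF refl]) (simp add: power_divide diff_divide_distrib right_diff_distrib left_diff_distrib mult_ac)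
    ultimately show ?thesis by simp
  qed
  have sq: "summable (\<lambda>j. 1 / real (Suc j) ^ m)" if "m \<ge> 2" for m
    using inverse_power_summable[OF that, where ?'a = real]
    by (subst (asm) summable_Suc_iff[symmetric]) (simp add: inverse_eq_divide)
  define Z where "Z = suminf (\<lambda>j. 1 / real (Suc j) ^ 2)"
  \<comment> \<open>For k = 0 the sum over j is harmonic and diverges; a + b = x removes it.\<close>
  have c0: "c 0 = 0" using ab by (simp add: c_def)
  have T: "eventually (\<lambda>M. summable (\<lambda>k. norm (c k * H k M))) sequentially \<and>
     summable (\<lambda>k. norm (c k * (if k = 0 then 0 else zeta_value (2*k+1)))) \<and>
     ((\<lambda>M. suminf (\<lambda>k. c k * H k M)) \<longlongrightarrow> suminf (\<lambda>k. c k * (if k = 0 then 0 else zeta_value (2*k+1)))) sequentially"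
  \<comment> \<open>Dominating series: H is at most Z = zeta(2), each of the three powers is at most
    x^k, and a factor 2 stands in front of them.\<close>
  proof (rule tannerys_theorem[where M = "\<lambda>k. 6 * Z * x ^ k"])
    fix k show "(\<lambda>M. c k * H k M) \<longlonglongrightarrow> c k * (if k = 0 then 0 else zeta_value (2*k+1))"
    proof (cases "k = 0")
      case False
      hence "(\<lambda>j. 1 / real (Suc j) ^ (2*k+1)) sums zeta_value (2*k+1)"
        unfolding zeta_value_def by (intro summable_sums sq) auto
      thus ?thesis using False unfolding H_def sums_def by (auto intro!: tendsto_intros)
    qed (simp add: c0)
  next
    have "norm (c k * H k M) \<le> 6 * Z * x ^ k" if "k \<ge> 1" for k M
    proof -
      have "H k M \<le> (\<Sum>j<M. 1 / real (Suc j) ^ 2)"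
        unfolding H_def using that by (intro sum_mono divide_left_mono power_increasing) auto
      also have "\<dots> \<le> Z" unfolding Z_def by (intro sum_le_suminf sq) auto
      finally have H: "H k M \<le> Z" .
      have H0: "H k M \<ge> 0" unfolding H_def by (intro sum_nonneg) auto
      have "x ^ (2*k+1) \<le> x ^ k" using x by (intro power_decreasing) auto
      moreover have "0 \<le> a ^ (2*k+1)" "a ^ (2*k+1) \<le> x ^ (2*k+1)" "0 \<le> b ^ (2*k+1)" "b ^ (2*k+1) \<le> x ^ (2*k+1)"
        using ab by (auto intro!: power_mono simp del: power_Suc power_Suc2)
      moreover have "0 \<le> x ^ k" using x by simp
      ultimately have "\<bar>x ^ (2*k+1) - a ^ (2*k+1) - b ^ (2*k+1)\<bar> \<le> 3 * x ^ k"
        by linarith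
      hence "2 * \<bar>x ^ (2*k+1) - a ^ (2*k+1) - b ^ (2*k+1)\<bar> / real (2*k+1) \<le> 2 * (3 * x ^ k) / 1"
        by (intro frac_le) auto
      hence "\<bar>c k\<bar> \<le> 6 * x ^ k" unfolding c_def abs_divide abs_mult by simp
      hence "\<bar>c k\<bar> * H k M \<le> (6 * x ^ k) * Z" using H H0 x by (intro mult_mono) auto
      thus ?thesis using H0 by (simp add: abs_mult mult_ac)
    qed
    thus "eventually (\<lambda>(k,M). norm (c k * H k M) \<le> 6 * Z * x ^ k) (at_top \<times>\<^sub>F sequentially)"
      by (auto simp: eventually_prod_sequentially)
  qed (use x in auto)
  have eq: "c k * (if k = 0 then 0 else zeta_value (2*k+1)) = zeta_coeff \<nu> (2*k+1) * x ^ (2*k+1)" for k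
  proof -
    have three: "2 * k + 1 \<ge> 3" if "k \<noteq> 0" for k :: nat using that by simp
    have "a ^ n = ((1+\<nu>)/2) ^ n * x ^ n" "b ^ n = ((1-\<nu>)/2) ^ n * x ^ n" for n
      unfolding a_def b_def power_mult_distrib[symmetric] by (simp_all add: mult.commute)
    hence "x ^ n - a ^ n - b ^ n = x ^ n * (1 - ((1+\<nu>)/2) ^ n - ((1-\<nu>)/2) ^ n)" for n
      by (simp only: right_diff_distrib mult.commute mult_1_right)
    thus ?thesis
      using three[of k] unfolding zeta_coeff_def c_def by (simp del: power_Suc)
  qed
  have iff: "(\<lambda>k. zeta_coeff \<nu> (2*k+1) * x ^ (2*k+1)) sums s \<longleftrightarrow> (\<lambda>n. zeta_coeff \<nu> n * x ^ n) sums s" for s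
  proof (rule sums_mono_reindex[where g = "\<lambda>k. 2*k+1"])
    show "strict_mono (\<lambda>k::nat. 2*k+1)" by (auto simp: strict_mono_def)
    fix n :: nat assume nin: "n \<notin> range (\<lambda>k. 2 * k + 1)"
    have "even n"
    proof (rule ccontr)
      assume "odd n"
      then obtain k where "n = 2 * k + 1" by (elim oddE)
      with nin show False by auto
    qed
    thus "zeta_coeff \<nu> n * x ^ n = 0" by (simp add: zeta_coeff_def)
  qed
  have "summable (\<lambda>k. norm (zeta_coeff \<nu> (2*k+1) * x ^ (2*k+1)))"
    using T unfolding eq by (elim conjE)
  hence "summable (\<lambda>k. zeta_coeff \<nu> (2*k+1) * x ^ (2*k+1))" by (rule summable_norm_cancel)
  hence sm: "(\<lambda>n. zeta_coeff \<nu> n * x ^ n) sums (suminf (\<lambda>k. zeta_coeff \<nu> (2*k+1) * x ^ (2*k+1)))"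
    unfolding iff[symmetric] by (rule summable_sums)
  thus "summable (\<lambda>n. zeta_coeff \<nu> n * x ^ n)" by (rule sums_summable)
  have "(\<lambda>M. \<Sum>j<M. g (x / Suc j) - g (a / Suc j) - g (b / Suc j)) \<longlonglongrightarrow> (suminf (\<lambda>n. zeta_coeff \<nu> n * x ^ n))"
    using T unfolding eq sums_unique[OF sm, symmetric] sums_unique[OF S, symmetric] by (elim conjE)
  from tendsto_exp[OF this] show "gamma_product x \<nu> \<longlonglongrightarrow> exp (suminf (\<lambda>n. zeta_coeff \<nu> n * x ^ n))"
    unfolding phi[symmetric] by simp
qed

text \<open>Limit M to infinity in \<open>gamma_product_eq\<close>, multiplied by x/2. The two
  denominators have product 4((k + x/2)^2 - (x\<nu>/2)^2), so their reciprocals add up to k + x/2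
  over that difference of squares.\<close>

lemma binom_sq_sums:
  assumes x: "0 < x" "x \<le> 1/8" and \<nu>: "0 < \<nu>" "\<nu> < 1"
  shows "(\<lambda>k. binom_sq x k * (1 / (2 * real k + x*(1-\<nu>)) + 1 / (2 * real k + x*(1+\<nu>)))) sums
    (2 / (x * (1 - \<nu>\<^sup>2)) * exp (suminf (\<lambda>n. zeta_coeff \<nu> n * x ^ n)))"
proof -
  define d where "d = (\<lambda>k::nat. (real k + x/2)\<^sup>2 - (x*\<nu>/2)\<^sup>2)"
  define t where "t = (\<lambda>k. (2*real k+x) * binom_sq x k / x / d k)"
  \<comment> \<open>Padding with 0 beyond M presents the truncated sums as series over all
    k.\<close>
  define a where "a = (\<lambda>k M. if k \<le> M then t k * lagrange_corr x M k else 0)"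
  have x1: "x < 1" using x by simp
  have bnn: "binom_sq x k \<ge> 0" for k by (simp add: binom_sq_def)
  have dk: "d k \<ge> (real k)\<^sup>2" for k
  proof -
    have "(x*\<nu>/2)\<^sup>2 \<le> (x/2)\<^sup>2" using x \<nu> by (intro power_mono) auto
    moreover have "(real k + x/2)\<^sup>2 = (real k)\<^sup>2 + real k * x + (x/2)\<^sup>2" by (simp add: power2_eq_square algebra_simps)
    moreover have "real k * x \<ge> 0" using x by simp
    ultimately show ?thesis by (simp add: d_def)
  qed
  have A: "suminf (\<lambda>k. a k M) = 4 / (x\<^sup>2 * (1 - \<nu>\<^sup>2)) * gamma_product x \<nu> M" for M
  proof -
    have "suminf (\<lambda>k. a k M) = (\<Sum>k\<le>M. a k M)" by (rule suminf_finite) (auto simp: a_def)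
    also have "\<dots> = 4 / (x\<^sup>2 * (1 - \<nu>\<^sup>2)) * gamma_product x \<nu> M"
      unfolding gamma_product_eq[OF x(1) x1 \<nu>] by (rule sum.cong) (auto simp: a_def t_def d_def)
    finally show ?thesis .
  qed
  have T: "eventually (\<lambda>M. summable (\<lambda>k. norm (a k M))) sequentially \<and> summable (\<lambda>k. norm (t k)) \<and>
     ((\<lambda>M. suminf (\<lambda>k. a k M)) \<longlongrightarrow> suminf t) sequentially"
  proof (rule tannerys_theorem[where M = "\<lambda>k. 6 / x * (1 / real k ^ 2)"])
    fix k
    have "(\<lambda>M. t k * lagrange_corr x M k) \<longlonglongrightarrow> t k * 1" by (intro tendsto_intros lagrange_corr_limit)
    moreover have "eventually (\<lambda>M. a k M = t k * lagrange_corr x M k) sequentially"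
      using eventually_ge_at_top[of k] by eventually_elim (auto simp: a_def)
    ultimately show "(\<lambda>M. a k M) \<longlonglongrightarrow> t k" by (subst tendsto_cong) auto
  next
    \<comment> \<open>k = 0 is left out: there \<open>1 / real k ^ 2\<close> is 0 by convention
      while the term is not, so domination holds only eventually in k.\<close>
    have "norm (a k M) \<le> 6 / x * (1 / real k ^ 2)" if "k \<ge> 1" for k M
    proof (cases "k \<le> M")
      case True
      obtain m where m: "k = Suc m" using \<open>k \<ge> 1\<close> by (metis Suc_le_D One_nat_def)
      define n where "n = real k"
      have n: "n \<ge> 1" using that by (simp add: n_def)
      have dn: "d k \<ge> n\<^sup>2" using dk[of k] by (simp add: n_def)
      have n2: "n\<^sup>2 > 0" using n by simp
      have d0: "d k > 0" using dn n2 by linarith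
      have "binom_sq x k * lagrange_corr x M k \<le> binom_sq x k * (\<Prod>i<k. real (Suc i) / (real (Suc i) - x))"
        by (intro mult_left_mono lagrange_corr_bound bnn) (use True x x1 in auto)
      also have "\<dots> \<le> (n + 1) / n\<^sup>2"
        using binom_sq_bound[OF x, of m] by (simp add: n_def m add_ac)
      finally have 1: "binom_sq x k * lagrange_corr x M k \<le> (n + 1) / n\<^sup>2" .
      have 2: "(2*n+x) / d k \<le> (2*n+x) / n\<^sup>2"
        by (intro divide_left_mono mult_pos_pos d0 n2 dn) (use n x in auto)
      have "(binom_sq x k * lagrange_corr x M k) * ((2*n+x) / d k) \<le> ((n + 1) / n\<^sup>2) * ((2*n+x) / n\<^sup>2)"
        using 1 2 n x d0 n2 by (intro mult_mono) (auto intro!: divide_nonneg_pos)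
      also have "\<dots> \<le> ((2*n) / n\<^sup>2) * ((3*n) / n\<^sup>2)"
        using n x by (intro mult_mono divide_right_mono) auto
      also have "\<dots> = 6 / n\<^sup>2" using n by (simp add: power2_eq_square)
      finally have 3: "(binom_sq x k * lagrange_corr x M k) * ((2*n+x) / d k) \<le> 6 / n\<^sup>2" .
      have "a k M = (binom_sq x k * lagrange_corr x M k) * ((2*n+x) / d k) / x"
        using True by (simp add: a_def t_def n_def mult_ac)
      moreover have "\<dots> \<le> 6 / n\<^sup>2 / x" using 3 x by (intro divide_right_mono) auto
      moreover have "(binom_sq x k * lagrange_corr x M k) * ((2*n+x) / d k) / x \<ge> 0"
        using lagrange_corr_bound(1)[OF True x(1) x1] bnn[of k] n x d0 n2 by (intro divide_nonneg_nonneg mult_nonneg_nonneg) auto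
      ultimately have "\<bar>a k M\<bar> \<le> 6 / n\<^sup>2 / x" by simp
      thus ?thesis by (simp add: n_def mult.commute)
    qed (use x in \<open>auto simp: a_def\<close>)
    thus "eventually (\<lambda>(k,M). norm (a k M) \<le> 6 / x * (1 / real k ^ 2)) (at_top \<times>\<^sub>F sequentially)"
      by (auto simp: eventually_prod_sequentially)
    show "summable (\<lambda>k. 6 / x * (1 / real k ^ 2))"
      using inverse_power_summable[of 2, where ?'a = real] by (intro summable_mult) (simp add: inverse_eq_divide)
  qed auto
  have "(\<lambda>M. suminf (\<lambda>k. a k M)) \<longlonglongrightarrow> 4 / (x\<^sup>2 * (1 - \<nu>\<^sup>2)) * exp (suminf (\<lambda>n. zeta_coeff \<nu> n * x ^ n))"
    unfolding A by (intro tendsto_mult tendsto_const gamma_product_limit x x1 \<nu>)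
  with T have "suminf t = 4 / (x\<^sup>2 * (1 - \<nu>\<^sup>2)) * exp (suminf (\<lambda>n. zeta_coeff \<nu> n * x ^ n))"
    using LIMSEQ_unique by blast
  moreover have "summable t" using T by (blast intro: summable_norm_cancel)
  ultimately have "t sums (4 / (x\<^sup>2 * (1 - \<nu>\<^sup>2)) * exp (suminf (\<lambda>n. zeta_coeff \<nu> n * x ^ n)))"
    by (simp add: sums_iff)
  hence "(\<lambda>k. x / 2 * t k) sums (x / 2 * (4 / (x\<^sup>2 * (1 - \<nu>\<^sup>2)) * exp (suminf (\<lambda>n. zeta_coeff \<nu> n * x ^ n))))"
    by (rule sums_mult)
  also have "(\<lambda>k. x / 2 * t k) = (\<lambda>k. binom_sq x k * (1 / (2 * real k + x*(1-\<nu>)) + 1 / (2 * real k + x*(1+\<nu>))))"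
  proof
    fix k
    have p: "2 * real k + x*(1-\<nu>) > 0" "2 * real k + x*(1+\<nu>) > 0"
      using x \<nu> by (auto intro!: add_nonneg_pos mult_pos_pos)
    have d: "d k = (2 * real k + x*(1-\<nu>)) * (2 * real k + x*(1+\<nu>)) / 4"
      by (simp add: d_def power2_eq_square field_simps)
    have s: "1 / (2 * real k + x*(1-\<nu>)) + 1 / (2 * real k + x*(1+\<nu>)) = 
      (4 * real k + 2 * x) / ((2 * real k + x*(1-\<nu>)) * (2 * real k + x*(1+\<nu>)))"
      using p by (simp add: add_frac_eq) (simp add: algebra_simps)
    have gen: "x / 2 * ((2 * y + x) * b / x / (D / 4)) = b * ((4 * y + 2 * x) / D)" for y b D
      using x(1) by (cases "D = 0") (auto simp: field_simps)
    show "x / 2 * t k = binom_sq x k * (1 / (2 * real k + x*(1-\<nu>)) + 1 / (2 * real k + x*(1+\<nu>)))"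
      unfolding s t_def d by (rule gen)
  qed
  also have "x / 2 * (4 / (x\<^sup>2 * (1 - \<nu>\<^sup>2)) * exp (suminf (\<lambda>n. zeta_coeff \<nu> n * x ^ n))) = 
     2 / (x * (1 - \<nu>\<^sup>2)) * exp (suminf (\<lambda>n. zeta_coeff \<nu> n * x ^ n))"
    using x(1) by (simp add: power2_eq_square)
  finally show ?thesis .
qed

section \<open>Power estimates\<close>

text \<open>(P+u)^N - u^N is a polynomial in P and u with nonnegative coefficients, so inserting
  upper bounds for |P| and |u| bounds its absolute value.\<close>

lemma abs_power_diff_le:
  fixes P u p b :: real
  assumes "\<bar>P\<bar> \<le> p" "\<bar>u\<bar> \<le> b"
  shows "\<bar>(P + u) ^ N - u ^ N\<bar> \<le> (p + b) ^ N - b ^ N"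
proof (induction N)
  case (Suc N)
  have "(P + u) ^ Suc N - u ^ Suc N = (P + u) * ((P + u) ^ N - u ^ N) + P * u ^ N"
    by (simp add: algebra_simps)
  also have "\<bar>\<dots>\<bar> \<le> \<bar>P + u\<bar> * \<bar>(P + u) ^ N - u ^ N\<bar> + \<bar>P\<bar> * \<bar>u\<bar> ^ N"
    by (intro order.trans[OF abs_triangle_ineq]) (simp add: abs_mult power_abs)
  also have "\<dots> \<le> (p + b) * ((p + b) ^ N - b ^ N) + p * b ^ N"
    using assms Suc by (intro add_mono mult_mono power_mono) auto
  also have "\<dots> = (p + b) ^ Suc N - b ^ Suc N" by (simp add: algebra_simps)
  finally show ?case .
qed auto

text \<open>All terms are nonnegative, so partial sums stay below the full sum exp(x(p+b)) -
  exp(xb). Uniformity in n makes this a majorant for the moment series; one summand alone bounds an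
  individual power.\<close>

lemma power_diff_exp_sum_le:
  fixes p b x :: real
  assumes "0 \<le> p" "0 \<le> b" "0 \<le> x"
  shows "(\<Sum>N<n. x ^ N / fact N * ((p + b) ^ N - b ^ N)) \<le> exp (x * b) * (exp (x * p) - 1)"
proof -
  have e: "(\<lambda>N. x ^ N / fact N * y ^ N) sums exp (x * y)" for y :: real
    using exp_converges[of "x * y"] by (simp add: power_mult_distrib divide_inverse mult_ac)
  have s: "(\<lambda>N. x ^ N / fact N * ((p + b) ^ N - b ^ N)) sums (exp (x * (p + b)) - exp (x * b))"
    using sums_diff[OF e[of "p + b"] e[of b]] by (simp add: right_diff_distrib)
  have "(\<Sum>N<n. x ^ N / fact N * ((p + b) ^ N - b ^ N)) \<le> exp (x * (p + b)) - exp (x * b)"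
    unfolding sums_unique[OF s]
    using assms by (intro sum_le_suminf sums_summable[OF s] mult_nonneg_nonneg) (auto intro!: power_mono)
  also have "\<dots> = exp (x * b) * (exp (x * p) - 1)"
    by (simp add: distrib_left right_diff_distrib exp_add mult.commute)
  finally show ?thesis .
qed

lemma mult_frac_le_imp_le: "a / f * y \<le> r \<Longrightarrow> 0 < a \<Longrightarrow> 0 < f \<Longrightarrow> y \<le> f / a * r"
  for a f y r :: real
  by (simp add: field_simps)

text \<open>Unlike exp(xp), the factor exp(xp) - 1 tends to 0 with p and so retains the decay of the
  potential for large S.\<close>

lemma power_diff_exp_le:
  fixes p b x :: real
  assumes "0 \<le> p" "0 \<le> b" "0 < x"
  shows "(p + b) ^ N - b ^ N \<le> fact N / x ^ N * (exp (x * b) * (exp (x * p) - 1))"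
proof -
  have "x ^ N / fact N * ((p + b) ^ N - b ^ N) \<le> (\<Sum>N<Suc N. x ^ N / fact N * ((p + b) ^ N - b ^ N))"
    using assms by (intro member_le_sum mult_nonneg_nonneg) (auto intro!: power_mono)
  also have "\<dots> \<le> exp (x * b) * (exp (x * p) - 1)" using assms by (intro power_diff_exp_sum_le) auto
  finally show ?thesis by (rule mult_frac_le_imp_le) (use assms in auto)
qed

text \<open>The part of $(B+P+Q)^l$ that involves both $P$ and $Q$. The bounds in this section replace
  powers by small multiples of exponentials, so that a single integrable function dominates all moments.\<close>

definition cross_term :: "nat \<Rightarrow> real \<Rightarrow> real \<Rightarrow> real \<Rightarrow> real" where
  "cross_term l B P Q = (B + P + Q) ^ l - (B + P) ^ l - (B + Q) ^ l + B ^ l"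

lemma cross_term_Suc: "cross_term (Suc l) B P Q = (B + P + Q) * cross_term l B P Q
   + Q * ((P + B) ^ l - B ^ l) + P * ((Q + B) ^ l - B ^ l)"
  by (simp add: cross_term_def algebra_simps)

text \<open>The recursion \<open>cross_term_Suc\<close> builds the mixed part with plus signs only,
  so the triangle inequality can be applied at every stage.\<close>

lemma abs_cross_term_le:
  assumes "\<bar>B\<bar> \<le> b" "\<bar>P\<bar> \<le> p" "\<bar>Q\<bar> \<le> q"
  shows "\<bar>cross_term l B P Q\<bar> \<le> cross_term l b p q"
proof (induction l)
  case (Suc l)
  have "\<bar>cross_term (Suc l) B P Q\<bar> \<le> \<bar>B + P + Q\<bar> * \<bar>cross_term l B P Q\<bar>
     + \<bar>Q\<bar> * \<bar>(P + B) ^ l - B ^ l\<bar> + \<bar>P\<bar> * \<bar>(Q + B) ^ l - B ^ l\<bar>"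
    unfolding cross_term_Suc by (simp flip: abs_mult)
  also have "\<dots> \<le> (b + p + q) * cross_term l b p q + q * ((p + b) ^ l - b ^ l) + p * ((q + b) ^ l - b ^ l)"
    using assms Suc by (intro add_mono mult_mono abs_power_diff_le) auto
  finally show ?case unfolding cross_term_Suc .
qed (simp add: cross_term_def)

text \<open>In the exponential generating function over l the inclusion-exclusion factors. Both
  exp(xp) - 1 and exp(xq) - 1 appear, each small where its potential is; keeping the l-th term gives
  the bound.\<close>

lemma cross_term_exp_le:
  assumes "0 \<le> b" "0 \<le> p" "0 \<le> q" "0 < x"
  shows "cross_term l b p q \<le> fact l / x ^ l * (exp (x * b) * (exp (x * p) - 1) * (exp (x * q) - 1))"
proof -
  have nn: "cross_term N b p q \<ge> 0" for N
    using abs_cross_term_le[of b b p p q q N] assms by simp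
  have e: "(\<lambda>N. x ^ N / fact N * y ^ N) sums exp (x * y)" for y :: real
    using exp_converges[of "x * y"] by (simp add: power_mult_distrib divide_inverse mult_ac)
  have "(\<lambda>N. x ^ N / fact N * (b + p + q) ^ N - x ^ N / fact N * (b + p) ^ N
     - x ^ N / fact N * (b + q) ^ N + x ^ N / fact N * b ^ N) sums
      (exp (x * (b + p + q)) - exp (x * (b + p)) - exp (x * (b + q)) + exp (x * b))"
    by (intro sums_add sums_diff e)
  also have "(\<lambda>N. x ^ N / fact N * (b + p + q) ^ N - x ^ N / fact N * (b + p) ^ N
     - x ^ N / fact N * (b + q) ^ N + x ^ N / fact N * b ^ N) = (\<lambda>N. x ^ N / fact N * cross_term N b p q)"
    by (simp add: cross_term_def fun_eq_iff algebra_simps)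
  finally have s: "(\<lambda>N. x ^ N / fact N * cross_term N b p q) sums 
    (exp (x * (b + p + q)) - exp (x * (b + p)) - exp (x * (b + q)) + exp (x * b))" .
  have "x ^ l / fact l * cross_term l b p q \<le> (\<Sum>N<Suc l. x ^ N / fact N * cross_term N b p q)"
    using assms nn by (intro member_le_sum) auto
  also have "\<dots> \<le> exp (x * (b + p + q)) - exp (x * (b + p)) - exp (x * (b + q)) + exp (x * b)"
    unfolding sums_unique[OF s] using assms nn by (intro sum_le_suminf sums_summable[OF s]) auto
  also have "\<dots> = exp (x * b) * (exp (x * p) - 1) * (exp (x * q) - 1)"
    by (simp add: distrib_left left_diff_distrib right_diff_distrib exp_add mult_ac)
  finally show ?thesis by (rule mult_frac_le_imp_le) (use assms in auto)
qed

section \<open>The potential of one pair of factors\<close>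

text \<open>Both intervals are open: S > 0 then holds on the whole space, which is where the
  potential is controlled, and the endpoints are null sets.\<close>

definition unit_measure :: "real measure" where "unit_measure = restrict_space lborel {0<..<1}"
definition pos_measure :: "real measure" where "pos_measure = restrict_space lborel {0<..}"

lemma space_unit [simp]: "space unit_measure = {0<..<1}"
  and space_pos [simp]: "space pos_measure = {0<..}"
  by (simp_all add: unit_measure_def pos_measure_def space_restrict_space)

lemma sets_unit [measurable_cong]: "sets unit_measure = sets (restrict_space borel {0<..<1})"
  and sets_pos [measurable_cong]: "sets pos_measure = sets (restrict_space borel {0<..})"
  by (simp_all add: unit_measure_def pos_measure_def sets_restrict_space)

lemma measurable_unit: "f \<in> borel_measurable borel \<Longrightarrow> f \<in> borel_measurable unit_measure"
  and measurable_pos: "f \<in> borel_measurable borel \<Longrightarrow> f \<in> borel_measurable pos_measure"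
  by (simp_all add: unit_measure_def pos_measure_def measurable_restrict_space1)

lemma id_measurable [measurable]: "(\<lambda>x. x) \<in> borel_measurable unit_measure"
  "(\<lambda>x. x) \<in> borel_measurable pos_measure"
  by (simp_all add: measurable_unit measurable_pos)

lemma finite_measure_unit: "finite_measure unit_measure"
  by (rule finite_measureI) (simp add: unit_measure_def emeasure_restrict_space space_restrict_space)

lemma measure_unit [simp]: "measure unit_measure {0<..<1} = 1"
  by (simp add: unit_measure_def measure_restrict_space)

lemma integrable_unit_bounded:
  fixes f :: "real \<Rightarrow> 'b :: {banach, second_countable_topology}"
  assumes "f \<in> borel_measurable unit_measure" "\<And>t. norm (f t) \<le> B"
  shows "integrable unit_measure f"
proof -
  interpret finite_measure unit_measure by (rule finite_measure_unit)
  show ?thesis by (rule integrable_const_bound[of _ B]) (use assms in auto)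
qed

lemma integral_unit_const [simp]: "(LINT t|unit_measure. (c::'b::{banach, second_countable_topology})) = c"
proof -
  interpret finite_measure unit_measure by (rule finite_measure_unit)
  show ?thesis by (simp add: measure_unit)
qed

definition log_potential :: "real \<Rightarrow> real \<Rightarrow> real" where
  "log_potential S t = - 2 * ln (cmod (1 - of_real (exp (- S)) * cis (2 * pi * t)))"

text \<open>For S > 0 the maximum of \<open>log_potential\<close> in absolute value over t, attained
  at the integers.\<close>

definition potential_bound :: "real \<Rightarrow> real" where "potential_bound S = - 2 * ln (1 - exp (- S))"

text \<open>$e^{S/2}((1-e^{-S})^{-1/2} - 1) \le (e^S-1)^{-1/2}$, and the right-hand side has the
  primitive $2\arctan\sqrt{e^S-1}$.\<close>

definition dominator :: "real \<Rightarrow> real" where "dominator S = 1 / sqrt (exp S - 1)"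

lemma log_potential_measurable [measurable]: "case_prod log_potential \<in> borel_measurable (borel \<Otimes>\<^sub>M borel)"
  unfolding log_potential_def cis_conv_exp by measurable

lemma potential_bound_nonneg: "S > 0 \<Longrightarrow> potential_bound S \<ge> 0"
  by (simp add: potential_bound_def ln_le_zero_iff)

text \<open>By 1 + r \<le> 1/(1 - r) the upper bound for |1 - w| becomes the reciprocal of the lower
  one, so one expression serves both signs of the logarithm.\<close>

lemma ln_cmod_le:
  assumes "cmod w \<le> r" "r < 1"
  shows "\<bar>ln (cmod (1 - w))\<bar> \<le> - ln (1 - r)"
proof -
  have r: "r \<ge> 0" using assms norm_ge_zero[of w] by linarith
  have l: "1 - r \<le> cmod (1 - w)" using norm_triangle_ineq2[of 1 w] assms by simp
  have u: "cmod (1 - w) \<le> 1 + r" using norm_triangle_ineq4[of 1 w] assms by simp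
  have "(1 + r) * (1 - r) \<le> 1" by (simp add: algebra_simps)
  hence "1 + r \<le> 1 / (1 - r)" using assms by (simp add: field_simps)
  hence "cmod (1 - w) \<le> 1 / (1 - r)" using u by simp
  hence "ln (cmod (1 - w)) \<le> ln (1 / (1 - r))" using l assms by (subst ln_le_cancel_iff) auto
  moreover have "ln (1 - r) \<le> ln (cmod (1 - w))" using l assms by (subst ln_le_cancel_iff) auto
  ultimately show ?thesis using assms by (simp add: ln_div)
qed

lemma log_potential_le: "S > 0 \<Longrightarrow> \<bar>log_potential S t\<bar> \<le> potential_bound S"
  using ln_cmod_le[of "of_real (exp (- S)) * cis (2 * pi * t)" "exp (- S)"]
  by (simp add: log_potential_def potential_bound_def norm_mult abs_mult)

lemma log_potential_plus_int: "log_potential S (t + of_int n) = log_potential S t"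
proof -
  have "cis (2 * pi * (t + of_int n)) = cis (2 * pi * t) * cis (2 * pi * of_int n)"
    unfolding cis_mult distrib_left ..
  also have "cis (2 * pi * of_int n) = 1" by (rule cis_multiple_2pi) simp
  finally show ?thesis by (simp add: log_potential_def)
qed

lemma log_potential_minus: "log_potential S (- t) = log_potential S t"
proof -
  have "1 - of_real (exp (- S)) * cis (2 * pi * - t) = cnj (1 - of_real (exp (- S)) * cis (2 * pi * t))"
    by (simp add: cis_cnj)
  thus ?thesis unfolding log_potential_def by (metis complex_mod_cnj)
qed

lemma dominator_pos: "S > 0 \<Longrightarrow> dominator S > 0" by (simp add: dominator_def)

text \<open>The weight 1/4 turns the potential into (1 - e^{-S})^(-1/2), an integrable singularity
  at 0. All later estimates of the potential use this weight or a smaller one.\<close>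

lemma exp_potential_bound: 
  assumes "S > 0" shows "exp (potential_bound S / 4) = exp (S / 2) * dominator S"
proof -
  have p: "1 - exp (- S) > 0" using assms by simp
  have "exp (potential_bound S / 4) = 1 / exp (ln (1 - exp (- S)) / 2)"
    by (simp add: potential_bound_def exp_minus inverse_eq_divide)
  also have "exp (ln (1 - exp (- S)) / 2) = sqrt (1 - exp (- S))"
    using p by (simp add: ln_sqrt[symmetric])
  also have "1 - exp (- S) = (exp S - 1) / exp S" by (simp add: exp_minus field_simps)
  also have "sqrt \<dots> = sqrt (exp S - 1) / exp (S / 2)"
    by (simp add: real_sqrt_divide) (metis exp_half_le2 exp_double field_sum_of_halves mult_2 real_sqrt_unique exp_ge_zero)
  finally show ?thesis by (simp add: dominator_def)
qed

lemma exp_potential_bound_le: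
  assumes "S > 0" shows "exp (S / 2) * (exp (potential_bound S / 4) - 1) \<le> dominator S"
proof -
  define s where "s = sqrt (exp S - 1)"
  have s: "s > 0" "s\<^sup>2 = exp S - 1" using assms by (auto simp: s_def)
  \<comment> \<open>The claim amounts to e(e - s) \<le> 1, which follows from e^2 - s^2 = 1 and s
    \<le> e.\<close>
  define e where "e = exp (S / 2)"
  have e: "e > 0" "e\<^sup>2 = exp S" by (auto simp: e_def simp flip: exp_double)
  have "s\<^sup>2 \<le> e\<^sup>2" using s e by simp
  hence se: "s \<le> e" by (rule power2_le_imp_le) (use e(1) in simp)
  hence "s * s \<le> e * s" using s(1) by (intro mult_right_mono) auto
  moreover have "e * (e - s) = e\<^sup>2 - e * s" "s * s = s\<^sup>2" by (auto simp: power2_eq_square algebra_simps)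
  ultimately have "e * (e - s) \<le> 1" using s(2) e(2) by linarith
  hence "e * (e - s) / s \<le> 1 / s" using s(1) by (intro divide_right_mono) auto
  moreover have "e * (e - s) / s = e * (e * (1 / s) - 1)" using s(1) by (simp add: field_simps)
  ultimately have "e * (e * (1 / s) - 1) \<le> 1 / s" by simp
  thus ?thesis using exp_potential_bound[OF assms] by (simp add: dominator_def s_def e_def)
qed

lemma dominator_integrable: "integrable pos_measure dominator"
proof -
  have "set_integrable lborel (einterval 0 \<infinity>) dominator"
  proof (rule interval_integral_FTC_nonneg(1)[where F = "\<lambda>S. 2 * arctan (sqrt (exp S - 1))" and A = 0 and B = pi])
    fix S :: real assume "0 < ereal S"
    hence S: "S > 0" by simp
    have "((\<lambda>S. 2 * arctan (sqrt (exp S - 1))) has_real_derivative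
        2 * (inverse (sqrt (exp S - 1)) / 2 * exp S) / (1 + (sqrt (exp S - 1))\<^sup>2)) (at S)"
      using S by (auto intro!: derivative_eq_intros)
    also have "2 * (inverse (sqrt (exp S - 1)) / 2 * exp S) / (1 + (sqrt (exp S - 1))\<^sup>2) = dominator S"
      using S by (simp add: dominator_def field_simps)
    finally show "((\<lambda>S. 2 * arctan (sqrt (exp S - 1))) has_real_derivative dominator S) (at S)" .
    show "isCont dominator S" unfolding dominator_def using S by (auto intro!: continuous_intros)
  next
    show "AE x in lborel. 0 < ereal x \<longrightarrow> ereal x < \<infinity> \<longrightarrow> 0 \<le> dominator x"
      by (auto intro!: AE_I2 less_imp_le[OF dominator_pos])
    have "((\<lambda>S. 2 * arctan (sqrt (exp S - 1))) \<longlongrightarrow> 2 * arctan (sqrt (exp 0 - 1))) (at_right 0)"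
      by (intro tendsto_intros)
    thus "(((\<lambda>S. 2 * arctan (sqrt (exp S - 1))) \<circ> real_of_ereal) \<longlongrightarrow> 0) (at_right 0)"
      by (simp add: zero_ereal_def ereal_tendsto_simps)
    have "filterlim (\<lambda>S. sqrt (exp S - 1)) at_top (at_top :: real filter)" by real_asymp
    hence "((\<lambda>S. 2 * arctan (sqrt (exp S - 1))) \<longlongrightarrow> 2 * (pi / 2)) at_top"
      by (intro tendsto_mult tendsto_const filterlim_compose[OF tendsto_arctan_at_top])
    thus "(((\<lambda>S. 2 * arctan (sqrt (exp S - 1))) \<circ> real_of_ereal) \<longlongrightarrow> pi) (at_left \<infinity>)"
      by (simp add: ereal_tendsto_simps)
  qed simp
  moreover have "einterval 0 \<infinity> = {0<..}" by (auto simp: einterval_def)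
  ultimately show ?thesis
    by (simp add: pos_measure_def set_integrable_def integrable_restrict_space)
qed

section \<open>Integration over one period\<close>

lemma integral_unit:
  fixes f :: "real \<Rightarrow> 'b :: {banach, second_countable_topology}"
  shows "(LINT t|unit_measure. f t) = (LINT t|lborel. indicator {0<..<1} t *\<^sub>R f t)"
  unfolding unit_measure_def by (rule integral_restrict_space) auto

text \<open>Only the fractional part d of c matters. The period [d, 1 + d) is cut at 1 and its
  second piece moved back by 1; the choice of endpoints changes null sets only.\<close>

lemma integral_unit_shift:
  fixes f :: "real \<Rightarrow> 'b :: {banach, second_countable_topology}"
  assumes [measurable]: "f \<in> borel_measurable borel" and bd: "\<And>t. norm (f t) \<le> B"
    and per: "\<And>t n. f (t + of_int n) = f t"
  shows "(LINT t|unit_measure. f (t + c)) = (LINT t|unit_measure. f t)"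
proof -
  define d where "d = frac c"
  have d: "0 \<le> d" "d < 1" by (auto simp: d_def frac_lt_1)
  have "c = d + of_int \<lfloor>c\<rfloor>" by (simp add: d_def frac_def)
  hence fc: "f (t + c) = f (t + d)" for t by (metis add.assoc per)
  have int: "integrable lborel (\<lambda>t. indicator {a..<b} t *\<^sub>R f t)" for a b :: real
  proof (rule integrableI_bounded_set_indicator[where B = B])
    show "emeasure lborel {a..<b} < \<infinity>" by (cases "a \<le> b") auto
  qed (use bd in auto)
  have ne: "AE t in lborel. t \<noteq> (a::real)" for a by (rule AE_lborel_singleton)
  have "(LINT t|unit_measure. f (t + c)) = (LINT t|lborel. indicator {0<..<1} t *\<^sub>R f (t + d))"
    by (simp add: integral_unit fc)
  also have "\<dots> = (LINT t|lborel. indicator {d<..<1 + d} t *\<^sub>R f t)"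
    by (subst (2) lborel_integral_real_affine[of 1 _ d])
       (auto simp: indicator_def add.commute intro!: Bochner_Integration.integral_cong)
  also have "\<dots> = (LINT t|lborel. indicator {d..<1} t *\<^sub>R f t + indicator {1..<1 + d} t *\<^sub>R f t)"
  proof (rule integral_cong_AE)
    show "AE t in lborel. indicator {d<..<1 + d} t *\<^sub>R f t = indicator {d..<1} t *\<^sub>R f t + indicator {1..<1 + d} t *\<^sub>R f t"
      using ne[of d] by eventually_elim (use d in \<open>auto simp: indicator_def\<close>)
  qed auto
  also have "\<dots> = (LINT t|lborel. indicator {d..<1} t *\<^sub>R f t) + (LINT t|lborel. indicator {1..<1 + d} t *\<^sub>R f t)"
    by (intro Bochner_Integration.integral_add int)
  also have "(LINT t|lborel. indicator {1..<1 + d} t *\<^sub>R f t) = (LINT t|lborel. indicator {0..<d} t *\<^sub>R f t)"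
    using per[of _ 1] by (subst lborel_integral_real_affine[of 1 _ 1])
       (auto simp: indicator_def add.commute intro!: Bochner_Integration.integral_cong)
  also have "(LINT t|lborel. indicator {d..<1} t *\<^sub>R f t) + (LINT t|lborel. indicator {0..<d} t *\<^sub>R f t)
     = (LINT t|lborel. indicator {d..<1} t *\<^sub>R f t + indicator {0..<d} t *\<^sub>R f t)"
    by (intro Bochner_Integration.integral_add[symmetric] int)
  also have "\<dots> = (LINT t|unit_measure. f t)"
    unfolding integral_unit
  proof (rule integral_cong_AE)
    show "AE t in lborel. indicator {d..<1} t *\<^sub>R f t + indicator {0..<d} t *\<^sub>R f t = indicator {0<..<1} t *\<^sub>R f t"
      using ne[of 0] by eventually_elim (use d in \<open>auto simp: indicator_def\<close>)
  qed auto
  finally show ?thesis .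
qed

text \<open>Weierstrass M-test: under a measure of total mass 1 the bounds c k also bound the
  integrals.\<close>

lemma integral_unit_sums:
  fixes g :: "nat \<Rightarrow> real \<Rightarrow> 'b :: {banach, second_countable_topology}"
  assumes [measurable]: "\<And>k. g k \<in> borel_measurable borel"
    and bd: "\<And>k t. norm (g k t) \<le> c k" and c: "summable c"
    and sums: "\<And>t. (\<lambda>k. g k t) sums h t"
  shows "(\<lambda>k. LINT t|unit_measure. g k t) sums (LINT t|unit_measure. h t)"
proof -
  have m: "g k \<in> borel_measurable unit_measure" for k by (intro measurable_unit) simp
  have int: "integrable unit_measure (g k)" for k
    by (rule integrable_unit_bounded[OF m bd])
  have c0: "c k \<ge> 0" for k using order.trans[OF norm_ge_zero bd[of k 0]] .
  have le: "(LINT t|unit_measure. norm (g k t)) \<le> c k" for k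
  proof -
    have "(LINT t|unit_measure. norm (g k t)) \<le> (LINT t|unit_measure. c k)"
      using int bd by (intro integral_mono integrable_norm integrable_unit_bounded[where B = "c k"]) (auto simp: c0)
    thus ?thesis by simp
  qed
  have "(\<lambda>k. LINT t|unit_measure. g k t) sums (LINT t|unit_measure. (suminf (\<lambda>k. g k t)))"
  proof (rule sums_integral[OF int])
    show "AE t in unit_measure. summable (\<lambda>k. norm (g k t))"
      by (intro AE_I2 summable_comparison_test[OF _ c]) (auto simp: bd)
    show "summable (\<lambda>k. LINT t|unit_measure. norm (g k t))"
      by (rule summable_comparison_test[OF _ c]) (auto simp: le)
  qed
  thus ?thesis using sums by (simp add: sums_iff)
qed

text \<open>Translation by half a period of the character, 1/(2n), changes its sign, while
  periodicity leaves the integral unchanged.\<close>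

lemma integral_unit_cis:
  "(LINT t|unit_measure. cis (2 * pi * of_int n * t)) = (if n = 0 then 1 else 0)"
proof (cases "n = 0")
  case False
  have m: "(\<lambda>t. cis (2 * pi * of_int n * t)) \<in> borel_measurable borel"
    unfolding cis_conv_exp by measurable
  have "cis (2 * pi * of_int n * (t + of_int k)) = cis (2 * pi * of_int n * t)" for t k
  proof -
    have "cis (2 * pi * of_int n * (t + of_int k)) = cis (2 * pi * of_int n * t) * cis (2 * pi * of_int (n * k))"
      unfolding cis_mult by (simp add: algebra_simps)
    also have "cis (2 * pi * of_int (n * k)) = 1" by (rule cis_multiple_2pi) simp
    finally show ?thesis by simp
  qed
  hence "(LINT t|unit_measure. cis (2 * pi * of_int n * (t + 1 / (2 * of_int n)))) =
     (LINT t|unit_measure. cis (2 * pi * of_int n * t))"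
    by (intro integral_unit_shift[OF m, where B = 1]) auto
  moreover have "cis (2 * pi * of_int n * (t + 1 / (2 * of_int n))) = - cis (2 * pi * of_int n * t)" for t
  proof -
    have "2 * pi * of_int n * (t + 1 / (2 * of_int n)) = 2 * pi * of_int n * t + pi"
      using False by (simp add: field_simps)
    thus ?thesis by (simp flip: cis_mult)
  qed
  ultimately show ?thesis using False by simp
qed simp

text \<open>exp(xP) = |1 - w|^(-2x) = |f|^2 with w = e^{-S + 2 pi i t} and f = (1-w)^(-x). Parseval
  is obtained by integrating the series of f termwise twice; the summability of the coefficients b
  provides the majorants.\<close>

lemma exp_log_potential_integral:
  assumes "S > 0" "x > 0"
  shows "(\<lambda>k. binom_sq x k * exp (- (2 * real k * S))) sums (LINT t|unit_measure. exp (x * log_potential S t))"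
proof -
  define r where "r = exp (- S)"
  have r: "0 < r" "r < 1" using assms by (auto simp: r_def)
  define b where "b = (\<lambda>k. pochhammer x k / fact k * r ^ k)"
  have b0: "b k \<ge> 0" for k using assms r by (auto simp: b_def intro!: mult_nonneg_nonneg divide_nonneg_pos pochhammer_nonneg)
  define e where "e = (\<lambda>(k::int) t. cis (2 * pi * of_int k * t))"
  have e_meas [measurable]: "e k \<in> borel_measurable borel" for k
    unfolding e_def cis_conv_exp by measurable
  have e_mult: "e j t * e k t = e (j + k) t" for j k t
    unfolding e_def cis_mult by (simp add: algebra_simps)
  have e_cnj: "cnj (e j t) = e (- j) t" for j t by (simp add: e_def cis_cnj)
  have e_norm: "norm (e j t) = 1" for j t by (simp add: e_def)
  have e_int: "(LINT t|unit_measure. e n t) = (if n = 0 then 1 else 0)" for n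
    unfolding e_def by (rule integral_unit_cis)
  \<comment> \<open>The sign of the binomial coefficient at -x cancels against that of
    (-w)^k.\<close>
  have gb: "(- of_real x gchoose k) * (- w) ^ k = of_real (pochhammer x k / fact k) * w ^ k" for w :: complex and k
  proof -
    have "(- complex_of_real x gchoose k) = (- 1) ^ k * of_real (pochhammer x k / fact k)"
      by (simp add: gbinomial_pochhammer pochhammer_of_real)
    moreover have "(- w) ^ k = (- 1) ^ k * w ^ k" by (rule power_minus)
    moreover have "((- 1) ^ k * (- 1) ^ k :: complex) = 1" by (simp flip: power_mult_distrib)
    ultimately show ?thesis by (simp add: mult_ac)
  qed
  have bs: "summable b"
  proof -
    have "(\<lambda>k. (- of_real x gchoose k) * (- complex_of_real r) ^ k) sums (1 + - complex_of_real r) powr (- of_real x)"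
      using r by (intro gen_binomial_complex) auto
    hence "summable (\<lambda>k. complex_of_real (b k))" unfolding gb by (simp add: b_def sums_iff)
    thus ?thesis by (simp add: summable_of_real_iff)
  qed
  define w where "w = (\<lambda>t. complex_of_real r * e 1 t)"
  define f where "f = (\<lambda>t. (1 - w t) powr (- complex_of_real x))"
  have wk: "w t ^ k = of_real (r ^ k) * e (int k) t" for t k
  proof -
    have "e 1 t ^ k = e (int k) t" unfolding e_def Complex.DeMoivre by (rule arg_cong[where f = cis]) simp
    thus ?thesis by (simp add: w_def power_mult_distrib)
  qed
  have wn: "norm (w t) < 1" for t using r by (simp add: w_def norm_mult e_norm)
  have w1: "1 - w t \<noteq> 0" for t using wn[of t] by auto
  have fs: "(\<lambda>k. of_real (b k) * e (int k) t) sums f t" for t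
  proof -
    have "(\<lambda>k. (- of_real x gchoose k) * (- w t) ^ k) sums (1 + - w t) powr (- of_real x)"
      using wn[of t] by (intro gen_binomial_complex) auto
    thus ?thesis unfolding gb wk f_def b_def by (simp add: mult_ac)
  qed
  have f_meas [measurable]: "f \<in> borel_measurable borel"
  proof -
    have "f = (\<lambda>t. suminf (\<lambda>k. of_real (b k) * e (int k) t))" using fs by (simp add: sums_iff fun_eq_iff)
    also have "\<dots> \<in> borel_measurable borel" by measurable
    finally show ?thesis .
  qed
  have cnj_meas [measurable]: "(\<lambda>t. cnj (f t)) \<in> borel_measurable borel"
    by (rule borel_measurable_continuous_on[OF _ f_meas]) (intro continuous_intros)
  define C where "C = suminf b"
  have fC: "norm (f t) \<le> C" for t
  proof -
    have "norm (suminf (\<lambda>k. of_real (b k) * e (int k) t)) \<le> suminf (\<lambda>k. norm (of_real (b k) * e (int k) t))"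
      using bs b0 by (intro summable_norm) (simp add: norm_mult e_norm)
    thus ?thesis using fs b0 by (simp add: sums_iff norm_mult e_norm C_def)
  qed
  \<comment> \<open>Orthogonality: of the conjugate series only the term j = k survives.\<close>
  have inner: "(LINT t|unit_measure. e (int k) t * cnj (f t)) = of_real (b k)" for k
  proof -
    have "(\<lambda>j. of_real (b j) * e (int k - int j) t) sums (e (int k) t * cnj (f t))" for t
    proof -
      have "(\<lambda>j. e (int k) t * cnj (of_real (b j) * e (int j) t)) sums (e (int k) t * cnj (f t))"
        by (intro sums_mult iffD2[OF sums_cnj fs])
      moreover have "e (int k) t * cnj (of_real (b j) * e (int j) t) = of_real (b j) * e (int k - int j) t" for j
        using e_mult[of "int k" t "- int j"] by (simp add: e_cnj)
      ultimately show ?thesis by (simp only:)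
    qed
    hence "(\<lambda>j. LINT t|unit_measure. of_real (b j) * e (int k - int j) t) sums (LINT t|unit_measure. e (int k) t * cnj (f t))"
      using bs b0 by (intro integral_unit_sums[where c = b]) (auto simp: norm_mult e_norm)
    moreover have "(LINT t|unit_measure. of_real (b j) * e (int k - int j) t) = (if j = k then of_real (b k) else 0)" for j
      by (simp add: e_int)
    ultimately have "(\<lambda>j. if j = k then complex_of_real (b k) else 0) sums (LINT t|unit_measure. e (int k) t * cnj (f t))"
      by simp
    moreover have "(\<lambda>j. if j = k then complex_of_real (b k) else 0) sums of_real (b k)"
      using sums_single[of k "\<lambda>_. complex_of_real (b k)"] by simp
    ultimately show ?thesis using sums_unique2 by blast
  qed
  have "(\<lambda>k. LINT t|unit_measure. of_real (b k) * (e (int k) t * cnj (f t))) sums (LINT t|unit_measure. f t * cnj (f t))"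
  proof (rule integral_unit_sums[where c = "\<lambda>k. b k * C"])
    show "(\<lambda>k. of_real (b k) * (e (int k) t * cnj (f t))) sums (f t * cnj (f t))" for t
      using sums_mult2[OF fs[of t], of "cnj (f t)"] by (simp add: mult_ac)
    show "summable (\<lambda>k. b k * C)" using bs by (rule summable_mult2)
    show "norm (of_real (b k) * (e (int k) t * cnj (f t))) \<le> b k * C" for k t
      using b0 fC by (simp add: norm_mult e_norm mult_left_mono)
  qed measurable
  also have "(\<lambda>k. LINT t|unit_measure. of_real (b k) * (e (int k) t * cnj (f t))) = (\<lambda>k. complex_of_real ((b k)\<^sup>2))"
    using inner by (simp add: power2_eq_square)
  also have "(\<lambda>t. f t * cnj (f t)) = (\<lambda>t. complex_of_real (exp (x * log_potential S t)))"
  proof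
    fix t
    have "norm (f t) = norm (1 - w t) powr (- x)"
      unfolding f_def using norm_powr_real_powr'[of "- x" "1 - w t"] by simp
    also have "\<dots> = exp (- x * ln (cmod (1 - w t)))" using w1[of t] by (simp add: powr_def)
    finally have "(norm (f t))\<^sup>2 = exp (x * log_potential S t)"
      by (simp add: log_potential_def w_def r_def e_def flip: exp_double)
    thus "f t * cnj (f t) = complex_of_real (exp (x * log_potential S t))"
      by (metis complex_norm_square)
  qed
  finally have "(\<lambda>k. complex_of_real ((b k)\<^sup>2)) sums of_real (LINT t|unit_measure. exp (x * log_potential S t))"
    by simp
  hence "(\<lambda>k. (b k)\<^sup>2) sums (LINT t|unit_measure. exp (x * log_potential S t))"
    by (simp only: sums_of_real_iff)
  also have "(\<lambda>k. (b k)\<^sup>2) = (\<lambda>k. binom_sq x k * exp (- (2 * real k * S)))"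
  proof
    fix k
    have "(r ^ k)\<^sup>2 = exp (- (2 * real k * S))"
      unfolding r_def exp_of_nat_mult[symmetric] exp_double[symmetric] by (simp add: mult_ac)
    thus "(b k)\<^sup>2 = binom_sq x k * exp (- (2 * real k * S))"
      by (simp add: b_def binom_sq_def power_mult_distrib power_divide)
  qed
  finally show ?thesis .
qed

section \<open>Moments of the potential\<close>

lemma log_potential_measurable_raw [measurable (raw)]:
  "f \<in> borel_measurable M \<Longrightarrow> g \<in> borel_measurable M \<Longrightarrow> (\<lambda>x. log_potential (f x) (g x)) \<in> borel_measurable M"
  using measurable_compose[OF measurable_Pair[of f M borel g borel] log_potential_measurable] by simp

text \<open>Where the potential is negligible the N-th power is close to (-\<mu>S)^N, which is not
  integrable on the half-line; its removal leaves a decaying function. Slope 1 is that of the Green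
  function, the other slopes are auxiliary.\<close>

definition fibre_moment :: "nat \<Rightarrow> real \<Rightarrow> real \<Rightarrow> real" where
  "fibre_moment N \<mu> S = (LINT t|unit_measure. (log_potential S t - \<mu> * S) ^ N - (- \<mu> * S) ^ N)"

lemma fibre_moment_measurable [measurable]: "fibre_moment N \<mu> \<in> borel_measurable borel"
proof -
  interpret finite_measure unit_measure by (rule finite_measure_unit)
  show ?thesis unfolding fibre_moment_def by measurable
qed

lemma moment_bound:
  assumes "S > 0" "\<mu> \<ge> 0"
  shows "\<bar>(log_potential S t - \<mu> * S) ^ N - (- \<mu> * S) ^ N\<bar> \<le> (potential_bound S + \<mu> * S) ^ N - (\<mu> * S) ^ N"
  using abs_power_diff_le[OF log_potential_le[OF assms(1), of t], of "- \<mu> * S" "\<mu> * S" N] assms by simp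

lemma moment_integrable:
  assumes "S > 0" "\<mu> \<ge> 0"
  shows "integrable unit_measure (\<lambda>t. (log_potential S t - \<mu> * S) ^ N - (- \<mu> * S) ^ N)"
proof (rule integrable_unit_bounded)
  show "norm ((log_potential S t - \<mu> * S) ^ N - (- \<mu> * S) ^ N) \<le> (potential_bound S + \<mu> * S) ^ N - (\<mu> * S) ^ N" for t
    using moment_bound[OF assms] by simp
qed measurable

lemma integral_unit_le:
  fixes f :: "real \<Rightarrow> real"
  assumes "f \<in> borel_measurable unit_measure" "\<And>t. \<bar>f t\<bar> \<le> B"
  shows "\<bar>LINT t|unit_measure. f t\<bar> \<le> B"
proof -
  have i: "integrable unit_measure f" using assms by (intro integrable_unit_bounded[where B = B]) auto
  have "\<bar>LINT t|unit_measure. f t\<bar> \<le> (LINT t|unit_measure. \<bar>f t\<bar>)"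
    using integral_norm_bound[of unit_measure f] by simp
  also have "\<dots> \<le> (LINT t|unit_measure. B)"
    using i assms by (intro integral_mono integrable_unit_bounded[where B = "\<bar>B\<bar>"])
      (auto intro: order.trans[OF assms(2) abs_ge_self])
  finally show ?thesis by simp
qed

lemma fibre_moment_bound:
  assumes "S > 0" "\<mu> \<ge> 0"
  shows "\<bar>fibre_moment N \<mu> S\<bar> \<le> (potential_bound S + \<mu> * S) ^ N - (\<mu> * S) ^ N"
  unfolding fibre_moment_def using moment_bound[OF assms] by (intro integral_unit_le) auto

text \<open>In the exponential generating function the slope becomes the factor exp(-x\<mu>S) and
  the subtracted power becomes the -1.\<close>

lemma fibre_moment_sums:
  assumes "S > 0" "\<mu> \<ge> 0" "x > 0"
  shows "(\<lambda>N. x ^ N / fact N * fibre_moment N \<mu> S) sums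
    (exp (- (x * \<mu> * S)) * ((LINT t|unit_measure. exp (x * log_potential S t)) - 1))"
proof -
  define g where "g = (\<lambda>N t. x ^ N / fact N * ((log_potential S t - \<mu> * S) ^ N - (- \<mu> * S) ^ N))"
  define c where "c = (\<lambda>N. x ^ N / fact N * ((potential_bound S + \<mu> * S) ^ N - (\<mu> * S) ^ N))"
  have e: "(\<lambda>N. x ^ N / fact N * y ^ N) sums exp (x * y)" for y :: real
    using exp_converges[of "x * y"] by (simp add: power_mult_distrib divide_inverse mult_ac)
  have gs: "(\<lambda>N. g N t) sums (exp (x * (log_potential S t - \<mu> * S)) - exp (x * (- \<mu> * S)))" for t
    using sums_diff[OF e[of "log_potential S t - \<mu> * S"] e[of "- \<mu> * S"]] by (simp add: g_def right_diff_distrib)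
  have cs: "summable c"
    using sums_diff[OF e[of "potential_bound S + \<mu> * S"] e[of "\<mu> * S"]] by (simp add: c_def right_diff_distrib sums_iff)
  have "(\<lambda>N. LINT t|unit_measure. g N t) sums
     (LINT t|unit_measure. exp (x * (log_potential S t - \<mu> * S)) - exp (x * (- \<mu> * S)))"
  proof (rule integral_unit_sums[OF _ _ cs gs])
    show "g N \<in> borel_measurable borel" for N unfolding g_def by measurable
    show "norm (g N t) \<le> c N" for N t
      unfolding g_def c_def using moment_bound[OF assms(1,2), of t N] assms
      by (simp add: abs_mult mult_left_mono divide_right_mono)
  qed
  also have "(\<lambda>N. LINT t|unit_measure. g N t) = (\<lambda>N. x ^ N / fact N * fibre_moment N \<mu> S)"
    unfolding g_def fibre_moment_def by (simp add: fun_eq_iff)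
  also have "(LINT t|unit_measure. exp (x * (log_potential S t - \<mu> * S)) - exp (x * (- \<mu> * S))) = 
    (LINT t|unit_measure. exp (- (x * \<mu> * S)) * (exp (x * log_potential S t) - 1))"
    by (simp add: right_diff_distrib exp_diff exp_minus field_simps)
  also have "\<dots> = exp (- (x * \<mu> * S)) * ((LINT t|unit_measure. exp (x * log_potential S t)) - 1)"
  proof -
    have "integrable unit_measure (\<lambda>t. exp (x * log_potential S t))"
    proof (rule integrable_unit_bounded)
      show "norm (exp (x * log_potential S t)) \<le> exp (x * potential_bound S)" for t
        using log_potential_le[OF assms(1), of t] assms(3) by simp
    qed measurable
    hence "(LINT t|unit_measure. exp (x * log_potential S t) - 1) = (LINT t|unit_measure. exp (x * log_potential S t)) - 1"
      using integrable_unit_bounded[of "\<lambda>_. 1::real" 1] by (subst Bochner_Integration.integral_diff) auto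
    thus ?thesis by simp
  qed
  finally show ?thesis .
qed

text \<open>Monotonicity in x reduces to the weight 1/4, where a factor e^{S/2} is affordable. If
  only e^{cS} is present, e^{-(1/2-c)S} is left over as decay for tails.\<close>

lemma exp_potential_bound_dominator:
  assumes "S > 0" "0 \<le> c" "c \<le> 1/2" "0 \<le> x" "x \<le> 1/4"
  shows "exp (c * S) * (exp (x * potential_bound S) - 1) \<le> exp (- ((1/2 - c) * S)) * dominator S"
proof -
  have "x * potential_bound S \<le> potential_bound S / 4" using mult_right_mono[OF assms(5) potential_bound_nonneg[OF assms(1)]] by simp
  hence "exp (c * S) * (exp (x * potential_bound S) - 1) \<le> exp (c * S) * (exp (potential_bound S / 4) - 1)" by simp
  also have "\<dots> = exp (- ((1/2 - c) * S)) * (exp (S / 2) * (exp (potential_bound S / 4) - 1))"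
    by (simp add: algebra_simps flip: exp_add)
  also have "\<dots> \<le> exp (- ((1/2 - c) * S)) * dominator S"
    using exp_potential_bound_le[OF assms(1)] by (intro mult_left_mono) auto
  finally show ?thesis .
qed

lemma exp_dominator_le: "S > 0 \<Longrightarrow> 0 \<le> c \<Longrightarrow> exp (- (c * S)) * dominator S \<le> dominator S"
  using dominator_pos[of S] by simp

text \<open>At weight 1/4 the slope contributes e^{\<mu>S/4}, and the affordable growth e^{S/2}
  corresponds to \<mu> \<le> 2. This range contains the slopes 1 + \<nu> and 1 - \<nu>.\<close>

lemma fibre_moment_integrable:
  assumes "0 \<le> \<mu>" "\<mu> \<le> 2"
  shows "integrable pos_measure (fibre_moment N \<mu>)"
proof (rule Bochner_Integration.integrable_bound)
  show "integrable pos_measure (\<lambda>S. fact N / (1/4) ^ N * dominator S)"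
    by (intro integrable_mult_right dominator_integrable)
  show "AE S in pos_measure. norm (fibre_moment N \<mu> S) \<le> norm (fact N / (1/4) ^ N * dominator S)"
  proof (rule AE_I2)
    fix S assume "S \<in> space pos_measure"
    hence S: "S > 0" by simp
    have "\<bar>fibre_moment N \<mu> S\<bar> \<le> (potential_bound S + \<mu> * S) ^ N - (\<mu> * S) ^ N" using S assms by (intro fibre_moment_bound) auto
    also have "\<dots> \<le> fact N / (1/4) ^ N * (exp (1/4 * (\<mu> * S)) * (exp (1/4 * potential_bound S) - 1))"
      using S assms potential_bound_nonneg[OF S] by (intro power_diff_exp_le) auto
    also have "\<dots> \<le> fact N / (1/4) ^ N * dominator S"
    proof (intro mult_left_mono)
      have "exp (\<mu> / 4 * S) * (exp (1/4 * potential_bound S) - 1) \<le> exp (- ((1/2 - \<mu> / 4) * S)) * dominator S"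
        using assms S by (intro exp_potential_bound_dominator) auto
      also have "\<dots> \<le> dominator S" using assms S by (intro exp_dominator_le) auto
      finally show "exp (1/4 * (\<mu> * S)) * (exp (1/4 * potential_bound S) - 1) \<le> dominator S" by simp
    qed auto
    also have "\<dots> \<le> norm (fact N / (1/4) ^ N * dominator S)" by (simp only: real_norm_def abs_ge_self)
    finally show "norm (fibre_moment N \<mu> S) \<le> norm (fact N / (1/4) ^ N * dominator S)" by (simp only: real_norm_def)
  qed
qed (intro measurable_pos, simp)

section \<open>Generating function of the total moments\<close>

definition total_moment :: "nat \<Rightarrow> real \<Rightarrow> real" where
  "total_moment N \<mu> = (LINT S|pos_measure. fibre_moment N \<mu> S)"

lemma dominated_sums_pos:
  fixes g :: "nat \<Rightarrow> real \<Rightarrow> real"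
  assumes int: "\<And>k. integrable pos_measure (g k)"
    and sums: "\<And>S. S > 0 \<Longrightarrow> (\<lambda>k. g k S) sums h S"
    and h: "h \<in> borel_measurable pos_measure"
    and bd: "\<And>S n. S > 0 \<Longrightarrow> \<bar>\<Sum>k<n. g k S\<bar> \<le> dominator S"
  shows "(\<lambda>k. LINT S|pos_measure. g k S) sums (LINT S|pos_measure. h S)"
proof -
  have "(\<lambda>n. LINT S|pos_measure. (\<Sum>k<n. g k S)) \<longlonglongrightarrow> (LINT S|pos_measure. h S)"
  proof (rule integral_dominated_convergence[where w = dominator])
    show "AE S in pos_measure. (\<lambda>n. \<Sum>k<n. g k S) \<longlonglongrightarrow> h S"
      using sums by (intro AE_I2) (auto simp: sums_def)
    show "AE S in pos_measure. norm (\<Sum>k<n. g k S) \<le> dominator S" for n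
      using bd by (intro AE_I2) auto
    show "(\<lambda>S. \<Sum>k<n. g k S) \<in> borel_measurable pos_measure" for n
      using int by (intro borel_measurable_sum) auto
  qed (use h dominator_integrable in auto)
  moreover have "(LINT S|pos_measure. (\<Sum>k<n. g k S)) = (\<Sum>k<n. LINT S|pos_measure. g k S)" for n
    by (intro Bochner_Integration.integral_sum int)
  ultimately show ?thesis by (simp add: sums_def)
qed

lemma exp_integral_pos:
  assumes "c > 0"
  shows "integrable pos_measure (\<lambda>S. exp (- (c * S)))" "(LINT S|pos_measure. exp (- (c * S))) = 1 / c"
proof -
  define F where "F = (\<lambda>S. - exp (- (c * S)) / c)"
  have F: "(F has_real_derivative exp (- (c * S))) (at S)" for S
    unfolding F_def using assms by (auto intro!: derivative_eq_intros)
  have "(F \<longlongrightarrow> F 0) (at_right 0)"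
    using assms unfolding F_def by (intro tendsto_intros) auto
  hence A: "((F \<circ> real_of_ereal) \<longlongrightarrow> - 1 / c) (at_right 0)"
    by (simp add: zero_ereal_def ereal_tendsto_simps F_def)
  have "(F \<longlongrightarrow> 0) at_top" unfolding F_def using assms by real_asymp
  hence B: "((F \<circ> real_of_ereal) \<longlongrightarrow> 0) (at_left \<infinity>)"
    by (simp add: ereal_tendsto_simps)
  have "set_integrable lborel (einterval 0 \<infinity>) (\<lambda>S. exp (- (c * S)))" "(LBINT S=0..\<infinity>. exp (- (c * S))) = 0 - (- 1 / c)"
    by (rule interval_integral_FTC_nonneg[OF _ F _ _ A B]; simp)+
  moreover have "einterval 0 \<infinity> = {0<..}" by (auto simp: einterval_def)
  ultimately show "integrable pos_measure (\<lambda>S. exp (- (c * S)))" "(LINT S|pos_measure. exp (- (c * S))) = 1 / c"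
    by (simp_all add: pos_measure_def set_integrable_def set_lebesgue_integral_def
      integrable_restrict_space integral_restrict_space interval_lebesgue_integral_def)
qed

lemma binom_sq_nonneg [simp]: "binom_sq x k \<ge> 0" by (simp add: binom_sq_def)

text \<open>The integral of one function \<open>H\<close> over S is evaluated twice, as the moment
  series in N and as the Parseval series in k. The -1 in \<open>H\<close> removes the constant
  Parseval term, whence \<open>Suc k\<close>. Since x\<mu> \<le> 1/2, the partial sums of both
  series lie below \<open>dominator\<close>.\<close>

lemma total_moment_sums:
  assumes x: "0 < x" "x \<le> 1/8" and \<mu>: "0 \<le> \<mu>" "\<mu> \<le> 2"
  shows "(\<lambda>k. binom_sq x (Suc k) / (2 * real (Suc k) + x * \<mu>)) sums (suminf (\<lambda>N. x ^ N / fact N * total_moment N \<mu>))"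
    "summable (\<lambda>N. x ^ N / fact N * total_moment N \<mu>)"
proof -
  interpret U: finite_measure unit_measure by (rule finite_measure_unit)
  define H where "H = (\<lambda>S. exp (- (x * \<mu> * S)) * ((LINT t|unit_measure. exp (x * log_potential S t)) - 1))"
  have H_meas: "H \<in> borel_measurable pos_measure"
    unfolding H_def by (intro measurable_pos) measurable
  have x4: "x \<le> 1/4" using x by simp
  have xm: "x * \<mu> \<le> 1/2" using mult_mono[OF x4 \<mu>(2)] x \<mu> by simp
  have xm0: "0 \<le> x * \<mu>" using x \<mu> by simp
  have 1: "(\<lambda>N. LINT S|pos_measure. x ^ N / fact N * fibre_moment N \<mu> S) sums (LINT S|pos_measure. H S)"
  proof (rule dominated_sums_pos)
    show "integrable pos_measure (\<lambda>S. x ^ N / fact N * fibre_moment N \<mu> S)" for N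
      using \<mu> by (intro integrable_mult_right fibre_moment_integrable)
    show "(\<lambda>N. x ^ N / fact N * fibre_moment N \<mu> S) sums H S" if "S > 0" for S
      unfolding H_def using that x \<mu> by (intro fibre_moment_sums) auto
    fix S :: real and n :: nat assume S: "S > 0"
    have "\<bar>\<Sum>N<n. x ^ N / fact N * fibre_moment N \<mu> S\<bar> \<le> (\<Sum>N<n. \<bar>x ^ N / fact N * fibre_moment N \<mu> S\<bar>)"
      by (rule sum_abs)
    also have "\<dots> \<le> (\<Sum>N<n. x ^ N / fact N * ((potential_bound S + \<mu> * S) ^ N - (\<mu> * S) ^ N))"
    proof (rule sum_mono)
      fix N
      have "\<bar>x ^ N / fact N * fibre_moment N \<mu> S\<bar> = x ^ N / fact N * \<bar>fibre_moment N \<mu> S\<bar>"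
        using x by (simp add: abs_mult)
      also have "\<dots> \<le> x ^ N / fact N * ((potential_bound S + \<mu> * S) ^ N - (\<mu> * S) ^ N)"
        using x S \<mu> by (intro mult_left_mono fibre_moment_bound) auto
      finally show "\<bar>x ^ N / fact N * fibre_moment N \<mu> S\<bar> \<le> x ^ N / fact N * ((potential_bound S + \<mu> * S) ^ N - (\<mu> * S) ^ N)" .
    qed
    also have "\<dots> \<le> exp (x * (\<mu> * S)) * (exp (x * potential_bound S) - 1)"
      using x S \<mu> potential_bound_nonneg[OF S] by (intro power_diff_exp_sum_le) auto
    also have "\<dots> = exp ((x * \<mu>) * S) * (exp (x * potential_bound S) - 1)" by (simp add: mult.assoc)
    also have "\<dots> \<le> exp (- ((1/2 - x * \<mu>) * S)) * dominator S"
      using x x4 S xm xm0 by (intro exp_potential_bound_dominator) auto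
    also have "\<dots> \<le> dominator S" using xm S by (intro exp_dominator_le) auto
    finally show "\<bar>\<Sum>N<n. x ^ N / fact N * fibre_moment N \<mu> S\<bar> \<le> dominator S" .
  qed (rule H_meas)
  hence V: "(\<lambda>N. x ^ N / fact N * total_moment N \<mu>) sums (LINT S|pos_measure. H S)"
    by (simp add: total_moment_def)
  thus "summable (\<lambda>N. x ^ N / fact N * total_moment N \<mu>)" by (rule sums_summable)
  have HS: "(\<lambda>k. binom_sq x (Suc k) * exp (- ((2 * real (Suc k) + x * \<mu>) * S))) sums H S" if S: "S > 0" for S
  proof -
    have "(\<lambda>k. binom_sq x k * exp (- (2 * real k * S))) sums (LINT t|unit_measure. exp (x * log_potential S t))"
      using S x by (intro exp_log_potential_integral) auto
    hence "(\<lambda>k. binom_sq x (Suc k) * exp (- (2 * real (Suc k) * S))) sums ((LINT t|unit_measure. exp (x * log_potential S t)) - 1)"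
      by (drule_tac sums_split_initial_segment[of _ _ 1]) (simp add: binom_sq_def)
    from sums_mult[OF this, of "exp (- (x * \<mu> * S))"] show ?thesis
      unfolding H_def by (simp add: algebra_simps exp_diff exp_minus exp_add divide_inverse)
  qed
  have pos: "2 * real (Suc k) + x * \<mu> > 0" for k using xm0 by simp
  have "(\<lambda>k. LINT S|pos_measure. binom_sq x (Suc k) * exp (- ((2 * real (Suc k) + x * \<mu>) * S))) sums (LINT S|pos_measure. H S)"
  proof (rule dominated_sums_pos[OF _ HS H_meas])
    show "integrable pos_measure (\<lambda>S. binom_sq x (Suc k) * exp (- ((2 * real (Suc k) + x * \<mu>) * S)))" for k
      using pos by (intro integrable_mult_right exp_integral_pos)
    fix S :: real and n assume S: "S > 0"
    have "\<bar>\<Sum>k<n. binom_sq x (Suc k) * exp (- ((2 * real (Suc k) + x * \<mu>) * S))\<bar> = (\<Sum>k<n. binom_sq x (Suc k) * exp (- ((2 * real (Suc k) + x * \<mu>) * S)))"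
      by (intro abs_of_nonneg sum_nonneg) auto
    also have "\<dots> \<le> H S"
      unfolding sums_unique[OF HS[OF S]] by (intro sum_le_suminf sums_summable[OF HS[OF S]]) auto
    \<comment> \<open>exp(-x\<mu>S) is replaced by the larger exp(x\<mu>S) so that the bound for the
      moment series applies again.\<close>
    also have "H S \<le> exp ((x * \<mu>) * S) * (exp (x * potential_bound S) - 1)"
    proof -
      have "exp (x * log_potential S t) \<le> exp (x * potential_bound S)" for t using log_potential_le[OF S, of t] x by simp
      hence "\<bar>LINT t|unit_measure. exp (x * log_potential S t)\<bar> \<le> exp (x * potential_bound S)"
        by (intro integral_unit_le measurable_unit) auto
      hence "(LINT t|unit_measure. exp (x * log_potential S t)) - 1 \<le> exp (x * potential_bound S) - 1" by simp
      moreover have "exp (x * potential_bound S) - 1 \<ge> 0" using x potential_bound_nonneg[OF S] by simp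
      moreover have "exp (- (x * \<mu> * S)) \<le> exp (x * \<mu> * S)" using xm0 S by simp
      ultimately show ?thesis unfolding H_def
        by (smt (verit) exp_gt_zero mult_left_mono mult_right_mono)
    qed
    also have "\<dots> \<le> exp (- ((1/2 - x * \<mu>) * S)) * dominator S"
      using x x4 S xm xm0 by (intro exp_potential_bound_dominator) auto
    also have "\<dots> \<le> dominator S" using xm S by (intro exp_dominator_le) auto
    finally show "\<bar>\<Sum>k<n. binom_sq x (Suc k) * exp (- ((2 * real (Suc k) + x * \<mu>) * S))\<bar> \<le> dominator S" .
  qed
  thus "(\<lambda>k. binom_sq x (Suc k) / (2 * real (Suc k) + x * \<mu>)) sums (suminf (\<lambda>N. x ^ N / fact N * total_moment N \<mu>))"
    unfolding sums_unique[OF V, symmetric] using exp_integral_pos(2)[OF pos] by simp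
qed

lemma zeta_coeff_in_ring:
  assumes "\<nu> \<in> \<rat>" shows "zeta_coeff \<nu> n \<in> odd_zeta_ring"
proof -
  have "2 / real n * (1 - ((1+\<nu>)/2)^n - ((1-\<nu>)/2)^n) \<in> \<rat>"
    using assms by (intro Rats_mult Rats_diff Rats_divide Rats_power Rats_add) auto
  hence "2 / real n * (1 - ((1+\<nu>)/2)^n - ((1-\<nu>)/2)^n) * zeta_value n \<in> odd_zeta_ring" if "odd n \<and> n \<ge> 3"
    using that by (intro ring_mult_rat odd_zeta_ring.zeta) auto
  thus ?thesis unfolding zeta_coeff_def by (cases "odd n \<and> n \<ge> 3") (simp_all only: if_P if_not_P ring_0 simp_thms)
qed

text \<open>Equating the Parseval series for both slopes with the hypergeometric sum gives \<Sum>
  x^N/N! W N = 2(E - 1)/(x(1 - \<nu>^2)), where the logarithm of E, and hence E, has Taylor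
  coefficients in the ring.\<close>

lemma total_moment_in_ring:
  assumes \<nu>: "0 < \<nu>" "\<nu> < 1" "\<nu> \<in> \<rat>"
  shows "total_moment N (1 + \<nu>) + total_moment N (1 - \<nu>) \<in> odd_zeta_ring"
proof -
  define W where "W = (\<lambda>N. total_moment N (1 + \<nu>) + total_moment N (1 - \<nu>))"
  \<comment> \<open>Taylor coefficients of E = 1 + x(1 - \<nu>^2)/2 \<Sum> x^N/N! W N; the factor x
    causes the index shift.\<close>
  define v where "v = (\<lambda>n. case n of 0 \<Rightarrow> 1 | Suc N \<Rightarrow> (1 - \<nu>\<^sup>2) / 2 / fact N * W N)"
  have n2: "1 - \<nu>\<^sup>2 > 0" using \<nu> by (simp add: power_less_one_iff)
  have "v (Suc N) \<in> odd_zeta_ring"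
  proof (rule exp_powser_coeff_in_ring[where l = "zeta_coeff \<nu>" and \<delta> = "1/8"])
    fix x :: real assume x: "0 < x" "x < 1/8"
    define E where "E = exp (suminf (\<lambda>n. zeta_coeff \<nu> n * x ^ n))"
    show "summable (\<lambda>n. zeta_coeff \<nu> n * x ^ n)"
      using gamma_product_limit(1)[of x \<nu>] x \<nu> by simp
    have a: "(\<lambda>k. binom_sq x (Suc k) / (2 * real (Suc k) + x * (1 - \<nu>)) + binom_sq x (Suc k) / (2 * real (Suc k) + x * (1 + \<nu>)))
       sums (suminf (\<lambda>N. x ^ N / fact N * total_moment N (1 - \<nu>)) + suminf (\<lambda>N. x ^ N / fact N * total_moment N (1 + \<nu>)))"
      using x \<nu> by (intro sums_add total_moment_sums) auto
    have "(\<lambda>k. binom_sq x k * (1 / (2 * real k + x*(1-\<nu>)) + 1 / (2 * real k + x*(1+\<nu>)))) sums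
      (2 / (x * (1 - \<nu>\<^sup>2)) * E)"
      unfolding E_def using x \<nu> by (intro binom_sq_sums) auto
    hence "(\<lambda>k. binom_sq x (Suc k) * (1 / (2 * real (Suc k) + x*(1-\<nu>)) + 1 / (2 * real (Suc k) + x*(1+\<nu>)))) sums
      (2 / (x * (1 - \<nu>\<^sup>2)) * E - (1 / (x*(1-\<nu>)) + 1 / (x*(1+\<nu>))))"
      by (drule_tac sums_split_initial_segment[of _ _ 1]) (simp add: binom_sq_def)
    \<comment> \<open>The k = 0 term of the hypergeometric sum equals its prefactor, so dropping it
      replaces E by E - 1.\<close>
    moreover have "1 / (x*(1-\<nu>)) + 1 / (x*(1+\<nu>)) = 2 / (x * (1 - \<nu>\<^sup>2))"
      using x \<nu> n2 by (simp add: divide_simps power2_eq_square) (simp add: algebra_simps)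
    ultimately have "(\<lambda>k. binom_sq x (Suc k) / (2 * real (Suc k) + x * (1 - \<nu>)) + binom_sq x (Suc k) / (2 * real (Suc k) + x * (1 + \<nu>)))
       sums (2 / (x * (1 - \<nu>\<^sup>2)) * (E - 1))"
      by (simp add: right_diff_distrib distrib_left)
    with a have eq: "suminf (\<lambda>N. x ^ N / fact N * total_moment N (1 - \<nu>)) + suminf (\<lambda>N. x ^ N / fact N * total_moment N (1 + \<nu>)) = 
      2 / (x * (1 - \<nu>\<^sup>2)) * (E - 1)" using sums_unique2 by blast
    have "(\<lambda>N. x ^ N / fact N * total_moment N (1 - \<nu>) + x ^ N / fact N * total_moment N (1 + \<nu>)) sums (2 / (x * (1 - \<nu>\<^sup>2)) * (E - 1))"
      unfolding eq[symmetric] using x \<nu> by (intro sums_add summable_sums total_moment_sums) auto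
    hence "(\<lambda>N. x * (1 - \<nu>\<^sup>2) / 2 * (x ^ N / fact N * total_moment N (1 - \<nu>) + x ^ N / fact N * total_moment N (1 + \<nu>))) sums
      (x * (1 - \<nu>\<^sup>2) / 2 * (2 / (x * (1 - \<nu>\<^sup>2)) * (E - 1)))" by (rule sums_mult)
    also have "x * (1 - \<nu>\<^sup>2) / 2 * (2 / (x * (1 - \<nu>\<^sup>2)) * (E - 1)) = E - 1"
      using x n2 by simp
    also have "(\<lambda>N. x * (1 - \<nu>\<^sup>2) / 2 * (x ^ N / fact N * total_moment N (1 - \<nu>) + x ^ N / fact N * total_moment N (1 + \<nu>))) = 
      (\<lambda>N. v (Suc N) * x ^ Suc N)"
      by (simp add: v_def W_def fun_eq_iff field_simps)
    finally have "(\<lambda>n. v n * x ^ n) sums (E - 1 + v 0 * x ^ 0)" by (subst (asm) sums_Suc_iff)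
    thus "(\<lambda>n. v n * x ^ n) sums exp (suminf (\<lambda>n. zeta_coeff \<nu> n * x ^ n))"
      by (simp add: v_def E_def)
  qed (use zeta_coeff_in_ring[OF \<nu>(3)] in \<open>auto simp: zeta_coeff_def\<close>)
  hence "2 * fact N / (1 - \<nu>\<^sup>2) * v (Suc N) \<in> odd_zeta_ring"
  proof (rule ring_mult_rat[rotated])
    have "2 * of_nat (fact N) / (1 - \<nu>\<^sup>2) \<in> \<rat>"
      using \<nu> by (intro Rats_divide Rats_mult Rats_diff Rats_power Rats_of_nat) auto
    thus "2 * fact N / (1 - \<nu>\<^sup>2) \<in> \<rat>" by simp
  qed
  also have "2 * fact N / (1 - \<nu>\<^sup>2) * v (Suc N) = W N" using n2 by (simp add: v_def)
  finally show ?thesis by (simp add: W_def)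
qed

section \<open>The integrals K(j,n), for j of either parity, as coefficients in the slope\<close>

definition weighted_moment :: "nat \<Rightarrow> nat \<Rightarrow> real" where
  "weighted_moment j n = (LINT S|pos_measure. S ^ j * fibre_moment n 1 S)"

text \<open>S^j is absorbed into the power because S is at most
  \<open>potential_bound S + S\<close>, at the price of the exponent j + n. The factor e^{-S/4} is
  what weight 1/4 leaves over at slope 1.\<close>

lemma weighted_moment_bound:
  assumes "S > 0"
  shows "\<bar>S ^ j * fibre_moment n 1 S\<bar> \<le> fact (j + n) * 4 ^ (j + n) * (exp (- (S / 4)) * dominator S)"
proof -
  have b: "potential_bound S \<ge> 0" by (rule potential_bound_nonneg[OF assms])
  have "\<bar>S ^ j * fibre_moment n 1 S\<bar> \<le> S ^ j * ((potential_bound S + S) ^ n - S ^ n)"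
    using fibre_moment_bound[OF assms, of 1 n] assms by (simp add: abs_mult)
  also have "\<dots> \<le> (potential_bound S + S) ^ (j + n) - S ^ (j + n)"
  proof -
    have "S ^ j * (potential_bound S + S) ^ n \<le> (potential_bound S + S) ^ j * (potential_bound S + S) ^ n"
      using b assms by (intro mult_right_mono power_mono) auto
    thus ?thesis by (simp add: power_add right_diff_distrib)
  qed
  also have "\<dots> \<le> fact (j + n) / (1/4) ^ (j + n) * (exp (1/4 * S) * (exp (1/4 * potential_bound S) - 1))"
    using assms b by (intro power_diff_exp_le) auto
  also have "\<dots> \<le> fact (j + n) / (1/4) ^ (j + n) * (exp (- ((1/2 - 1/4) * S)) * dominator S)"
    using assms by (intro mult_left_mono exp_potential_bound_dominator) auto
  finally show ?thesis by (simp add: power_one_over)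
qed

lemma weighted_moment_integrable: "integrable pos_measure (\<lambda>S. S ^ j * fibre_moment n 1 S)"
proof (rule Bochner_Integration.integrable_bound)
  show "integrable pos_measure (\<lambda>S. fact (j + n) * 4 ^ (j + n) * dominator S)"
    by (intro integrable_mult_right dominator_integrable)
  show "AE S in pos_measure. norm (S ^ j * fibre_moment n 1 S) \<le> norm (fact (j + n) * 4 ^ (j + n) * dominator S)"
  proof (rule AE_I2)
    fix S assume "S \<in> space pos_measure"
    hence S: "S > 0" by simp
    have "exp (- (S / 4)) * dominator S \<le> dominator S" using exp_dominator_le[OF S, of "1/4"] by simp
    hence "fact (j + n) * 4 ^ (j + n) * (exp (- (S / 4)) * dominator S) \<le> fact (j + n) * 4 ^ (j + n) * dominator S"
      by (intro mult_left_mono) auto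
    also have "\<dots> \<le> norm (fact (j + n) * 4 ^ (j + n) * dominator S)" by (simp only: real_norm_def abs_ge_self)
    finally show "norm (S ^ j * fibre_moment n 1 S) \<le> norm (fact (j + n) * 4 ^ (j + n) * dominator S)"
      using weighted_moment_bound[OF S, of j n] unfolding real_norm_def by linarith
  qed
qed (intro measurable_pos, measurable)

text \<open>P - (1+\<nu>)S = -\<nu>S + (P - S): changing the slope is a binomial expansion, and
  powers of \<nu> mark powers of S.\<close>

lemma fibre_moment_shift:
  assumes S: "S > 0" and \<mu>: "0 \<le> \<mu>"
  shows "fibre_moment N (1 + \<nu>) S = (\<Sum>j\<le>N. real (N choose j) * (- \<nu>) ^ j * (S ^ j * fibre_moment (N - j) 1 S))"
proof -
  have "(log_potential S t - (1 + \<nu>) * S) ^ N - (- (1 + \<nu>) * S) ^ N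
     = (\<Sum>j\<le>N. real (N choose j) * (- \<nu> * S) ^ j * ((log_potential S t - 1 * S) ^ (N - j) - (- 1 * S) ^ (N - j)))" for t
  proof -
    have "(log_potential S t - (1 + \<nu>) * S) ^ N = (- \<nu> * S + (log_potential S t - 1 * S)) ^ N" 
      "(- (1 + \<nu>) * S) ^ N = (- \<nu> * S + (- 1 * S)) ^ N" by (simp_all add: algebra_simps)
    thus ?thesis unfolding binomial_ring by (simp add: right_diff_distrib sum_subtractf)
  qed
  hence "fibre_moment N (1 + \<nu>) S = (\<Sum>j\<le>N. LINT t|unit_measure. real (N choose j) * (- \<nu> * S) ^ j * ((log_potential S t - 1 * S) ^ (N - j) - (- 1 * S) ^ (N - j)))"
    unfolding fibre_moment_def using S
    by (simp only:) (intro Bochner_Integration.integral_sum integrable_mult_right moment_integrable, auto)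
  thus ?thesis by (simp only: integral_mult_right_zero fibre_moment_def[symmetric]) (simp only: power_mult_distrib mult_ac)
qed

text \<open>The symmetrised total moments are values at rational \<nu> of a polynomial whose
  coefficient at 2m is 2 binom(N,2m) K(2m,N-2m), while its odd coefficients vanish. With N = 2m + n
  this is the wanted moment up to a nonzero rational factor.\<close>

lemma weighted_moment_even_in_ring: "weighted_moment (2 * m) n \<in> odd_zeta_ring"
proof -
  define N where "N = 2 * m + n"
  define c where "c = (\<lambda>j. real (N choose j) * ((- 1) ^ j + 1) * weighted_moment j (N - j))"
  define p where "p = (\<Sum>j\<le>N. monom (c j) j)"
  have V: "total_moment N (1 + \<nu>) = (\<Sum>j\<le>N. real (N choose j) * (- \<nu>) ^ j * weighted_moment j (N - j))" for \<nu>
  proof -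
    have "total_moment N (1 + \<nu>) = (LINT S|pos_measure. (\<Sum>j\<le>N. real (N choose j) * (- \<nu>) ^ j * (S ^ j * fibre_moment (N - j) 1 S)))"
      unfolding total_moment_def by (intro Bochner_Integration.integral_cong refl fibre_moment_shift) auto
    also have "\<dots> = (\<Sum>j\<le>N. LINT S|pos_measure. real (N choose j) * (- \<nu>) ^ j * (S ^ j * fibre_moment (N - j) 1 S))"
      by (intro Bochner_Integration.integral_sum integrable_mult_right weighted_moment_integrable)
    finally show ?thesis by (simp add: weighted_moment_def)
  qed
  have "coeff p (2 * m) \<in> odd_zeta_ring"
  proof (rule poly_coeff_in_ring)
    show "infinite ({0<..<1} \<inter> \<rat> :: real set)"
    proof
      assume fin: "finite ({0<..<1} \<inter> \<rat> :: real set)"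
      have "inj (\<lambda>n. 1 / real (n + 2))" by (auto simp: inj_def)
      moreover have "range (\<lambda>n. 1 / real (n + 2)) \<subseteq> {0<..<1} \<inter> \<rat>" by auto
      ultimately show False using fin by (meson finite_imageD finite_subset infinite_UNIV_nat)
    qed
    fix \<nu> :: real assume \<nu>: "\<nu> \<in> {0<..<1} \<inter> \<rat>"
    have "poly p \<nu> = (\<Sum>j\<le>N. c j * \<nu> ^ j)" by (simp add: p_def poly_sum poly_monom)
    also have "\<dots> = total_moment N (1 + \<nu>) + total_moment N (1 + (- \<nu>))"
      unfolding V sum.distrib[symmetric] c_def
      by (intro sum.cong refl) (simp add: power_minus[of \<nu>] algebra_simps)
    finally show "poly p \<nu> \<in> odd_zeta_ring" using total_moment_in_ring[of \<nu> N] \<nu> by simp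
  qed auto
  also have "coeff p (2 * m) = c (2 * m)" by (simp add: p_def coeff_sum N_def)
  also define a where "a = 2 * real (N choose (2 * m))"
  have "c (2 * m) = a * weighted_moment (2 * m) n" by (simp add: c_def N_def a_def)
  finally have "1 / a * (a * weighted_moment (2 * m) n) \<in> odd_zeta_ring"
    by (rule ring_mult_rat[rotated]) (auto simp: a_def)
  moreover have "a \<noteq> 0" by (simp add: a_def N_def)
  ultimately show ?thesis by simp
qed

section \<open>The Green function\<close>

text \<open>The Weierstrass inequalities bound the modulus of the product between 1 - A and exp A,
  where A \<le> 2\<rho> by the geometric series. The condition \<rho> \<le> 1/4 keeps 1 - 2\<rho> at
  least 1/2, which yields 4\<rho> for the negative logarithm.\<close>

lemma prodinf_bound:
  fixes a :: "nat \<Rightarrow> complex"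
  assumes a: "\<And>n. norm (a n) \<le> \<rho> ^ Suc n" and \<rho>: "0 < \<rho>" "\<rho> \<le> 1/4"
  shows "convergent_prod (\<lambda>n. 1 - a n)" "prodinf (\<lambda>n. 1 - a n) \<noteq> 0"
    "\<bar>ln (cmod (prodinf (\<lambda>n. 1 - a n)))\<bar> \<le> 4 * \<rho>"
proof -
  have geo: "(\<lambda>n. \<rho> ^ Suc n) sums (\<rho> / (1 - \<rho>))"
    using sums_mult[OF geometric_sums[of \<rho>], of \<rho>] \<rho> by simp
  have s: "summable (\<lambda>n. norm (a n))"
    by (rule summable_comparison_test[OF _ sums_summable[OF geo]]) (use a in auto)
  have lt: "norm (a n) < 1" for n
  proof -
    have "\<rho> ^ Suc n \<le> \<rho>" using \<rho> by (simp add: mult_left_le power_le_one)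
    thus ?thesis using a[of n] \<rho> by linarith
  qed
  have "convergent_prod (\<lambda>n. 1 + (- a n))"
    using s lt by (intro summable_imp_convergent_prod_complex) (auto, metis less_irrefl norm_one)
  thus conv: "convergent_prod (\<lambda>n. 1 - a n)" by simp
  have "1 - a n \<noteq> 0" for n using lt[of n] by auto
  with conv show "prodinf (\<lambda>n. 1 - a n) \<noteq> 0" by (rule prodinf_nonzero)
  define A where "A = (\<lambda>n. \<Sum>i\<le>n. norm (a i))"
  have A: "A n \<le> 2 * \<rho>" for n
  proof -
    have "A n \<le> (\<Sum>i\<le>n. \<rho> ^ Suc i)" unfolding A_def by (intro sum_mono a)
    also have "\<dots> \<le> \<rho> / (1 - \<rho>)"
      unfolding sums_unique[OF geo] by (intro sum_le_suminf sums_summable[OF geo]) (use \<rho> in auto)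
    also have "\<dots> \<le> \<rho> / (1/2)" using \<rho> by (intro divide_left_mono) auto
    finally show ?thesis by simp
  qed
  have A0: "A n \<ge> 0" for n unfolding A_def by (intro sum_nonneg) auto
  have low: "1 - A n \<le> norm (\<Prod>i\<le>n. 1 - a i)" for n
  proof (induction n)
    case 0
    show ?case using norm_triangle_ineq2[of 1 "a 0"] by (simp add: A_def)
  next
    case (Suc n)
    have "1 - A (Suc n) = 1 - A n - norm (a (Suc n))" by (simp add: A_def)
    also have "\<dots> \<le> (1 - A n) * (1 - norm (a (Suc n)))"
      using A0[of n] by (simp add: algebra_simps)
    also have "\<dots> \<le> norm (\<Prod>i\<le>n. 1 - a i) * (1 - norm (a (Suc n)))"
      using Suc lt[of "Suc n"] by (intro mult_right_mono) auto
    also have "\<dots> \<le> norm (\<Prod>i\<le>n. 1 - a i) * norm (1 - a (Suc n))"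
      using norm_triangle_ineq2[of 1 "a (Suc n)"] by (intro mult_left_mono) auto
    finally show ?case by (simp add: norm_mult)
  qed
  have up: "norm (\<Prod>i\<le>n. 1 - a i) \<le> exp (2 * \<rho>)" for n
  proof -
    have "norm (\<Prod>i\<le>n. 1 - a i) = (\<Prod>i\<le>n. norm (1 - a i))" by (rule prod_norm[symmetric])
    also have "\<dots> \<le> (\<Prod>i\<le>n. exp (norm (a i)))"
    proof (intro prod_mono conjI)
      fix i show "norm (1 - a i) \<le> exp (norm (a i))"
        using norm_triangle_ineq4[of 1 "a i"] exp_ge_add_one_self[of "norm (a i)"]
        unfolding norm_one by linarith
    qed auto
    also have "\<dots> = exp (A n)" by (simp add: A_def exp_sum)
    also have "\<dots> \<le> exp (2 * \<rho>)" using A by simp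
    finally show ?thesis .
  qed
  define p where "p = cmod (prodinf (\<lambda>n. 1 - a n))"
  have lim: "(\<lambda>n. norm (\<Prod>i\<le>n. 1 - a i)) \<longlonglongrightarrow> p"
    unfolding p_def by (intro tendsto_norm convergent_prod_LIMSEQ conv)
  have "p \<le> exp (2 * \<rho>)" by (rule LIMSEQ_le_const2[OF lim]) (use up in auto)
  have "1 - 2 * \<rho> \<le> norm (\<Prod>i\<le>n. 1 - a i)" for n using low[of n] A[of n] by linarith
  hence l: "1 - 2 * \<rho> \<le> p" by (intro LIMSEQ_le_const[OF lim]) auto
  have p0: "p > 0" using l \<rho> by linarith
  have "ln p \<le> ln (exp (2 * \<rho>))" using p0 \<open>p \<le> exp (2 * \<rho>)\<close> by (subst ln_le_cancel_iff) auto
  moreover have "- ln p \<le> 4 * \<rho>"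
  proof -
    have "- ln p = ln (1 / p)" using p0 by (simp add: ln_div)
    also have "\<dots> \<le> 1 / p - 1" using p0 by (intro ln_le_minus_one) auto
    also have "\<dots> \<le> 1 / (1 - 2 * \<rho>) - 1" using l \<rho> by (intro diff_right_mono divide_left_mono mult_pos_pos p0) auto
    also have "\<dots> = 2 * \<rho> / (1 - 2 * \<rho>)" using \<rho> by (simp add: field_simps)
    also have "\<dots> \<le> 2 * \<rho> / (1/2)" using \<rho> by (intro divide_left_mono) auto
    finally show ?thesis by simp
  qed
  ultimately show "\<bar>ln (cmod (prodinf (\<lambda>n. 1 - a n)))\<bar> \<le> 4 * \<rho>"
    unfolding p_def[symmetric] using \<rho> by auto
qed

text \<open>The sine supplies the factor 1 - e^{2 pi i z}, absent from the infinite product, that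
  becomes the first potential.\<close>

lemma cmod_sin_pi: "2 * cmod (sin (of_real pi * z)) = exp (pi * Im z) * cmod (1 - exp (2 * of_real pi * \<i> * z))"
proof -
  have "2 * \<i> * sin (of_real pi * z) = - exp (- (\<i> * (of_real pi * z))) * (1 - exp (2 * of_real pi * \<i> * z))"
    by (simp add: sin_exp_eq right_diff_distrib flip: exp_add)
       (simp add: algebra_simps)
  hence "cmod (2 * \<i> * sin (of_real pi * z)) = cmod (- exp (- (\<i> * (of_real pi * z))) * (1 - exp (2 * of_real pi * \<i> * z)))"
    by (rule arg_cong)
  thus ?thesis by (simp add: norm_mult)
qed

text \<open>Only two factors are not 1 + O(e^{-Y}) uniformly in s: 1 - w from the sine and 1 - q/w
  from the head of the product. In the quotient by \<eta> the factors 1 - q^n cancel, and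
  q^{1/8-1/24} = q^{1/12} gives Y/6. The two remaining products contribute 2(4 + 4)e^{-Y} = 16
  e^{-Y}.\<close>

lemma green_expansion:
  fixes \<tau> :: complex and s t :: real
  defines "Y \<equiv> 2 * pi * Im \<tau>"
  assumes Y: "exp (- Y) \<le> 1/4" and s: "0 < s" "s < 1"
  shows "\<bar>green (of_real s * \<tau> + of_real t) \<tau> -
    (Y * (s\<^sup>2 - s + 1/6) + log_potential (s * Y) (s * Re \<tau> + t) + log_potential ((1 - s) * Y) (t + (s - 1) * Re \<tau>))\<bar> \<le> 16 * exp (- Y)"
proof -
  define z where "z = of_real s * \<tau> + of_real t"
  define \<rho> where "\<rho> = exp (- Y)"
  have \<rho>: "0 < \<rho>" "\<rho> \<le> 1/4" using Y by (auto simp: \<rho>_def)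
  have Y0: "Y > 0" 
  proof (rule ccontr)
    assume "\<not> Y > 0"
    hence "exp (- Y) \<ge> 1" by simp
    thus False using Y by linarith
  qed
  have im: "Im \<tau> > 0" using Y0 by (simp add: Y_def zero_less_mult_iff)
  define q where "q = nome \<tau>"
  define w where "w = exp (2 * of_real pi * \<i> * z)"
  define w' where "w' = exp (- (2 * of_real pi * \<i> * z))"
  have nq: "norm q = \<rho>" by (simp add: q_def nome_def \<rho>_def Y_def)
  have nw: "norm w = exp (- (s * Y))" by (simp add: w_def z_def Y_def)
  have nw': "norm w' = exp (s * Y)" by (simp add: w'_def z_def Y_def)
  define B where "B = (\<lambda>n. 1 - q ^ Suc n)"
  define C where "C = (\<lambda>n. 1 - q ^ Suc n * w)"
  define D where "D = (\<lambda>n. 1 - q ^ Suc n * w')"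
  \<comment> \<open>D without its first factor: q w' has modulus close to 1 when s is close to 1, so
    it is split off before the product bound is used.\<close>
  define D' where "D' = (\<lambda>n. 1 - q ^ Suc (Suc n) * w')"
  have B: "convergent_prod B" "prodinf B \<noteq> 0"
    unfolding B_def by (rule prodinf_bound[OF _ \<rho>], simp add: norm_power norm_mult nq)+
  have nC: "norm (q ^ Suc n * w) \<le> \<rho> ^ Suc n" for n
  proof -
    have "norm w \<le> 1" using Y0 s by (simp add: nw)
    thus ?thesis unfolding norm_mult norm_power nq using \<rho> by (intro mult_left_le) auto
  qed
  have C: "convergent_prod C" "prodinf C \<noteq> 0" "\<bar>ln (cmod (prodinf C))\<bar> \<le> 4 * \<rho>"
    unfolding C_def by (rule prodinf_bound[OF nC \<rho>])+
  have qw': "norm (q * w') = exp (- ((1 - s) * Y))"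
    by (simp add: norm_mult nq nw' \<rho>_def algebra_simps flip: exp_add)
  have nD: "norm (q ^ Suc (Suc n) * w') \<le> \<rho> ^ Suc n" for n
  proof -
    have "q ^ Suc (Suc n) * w' = q ^ Suc n * (q * w')" by simp
    also have "norm \<dots> = \<rho> ^ Suc n * exp (- ((1 - s) * Y))"
      by (simp only: norm_mult[of "q ^ Suc n"] norm_power nq qw')
    also have "\<dots> \<le> \<rho> ^ Suc n" using \<rho> Y0 s by (intro mult_left_le) auto
    finally show ?thesis .
  qed
  have D': "convergent_prod D'" "prodinf D' \<noteq> 0" "\<bar>ln (cmod (prodinf D'))\<bar> \<le> 4 * \<rho>"
    unfolding D'_def by (rule prodinf_bound[OF nD \<rho>])+
  have D'_eq: "D' = (\<lambda>n. D (Suc n))" by (simp add: D_def D'_def)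
  have convD: "convergent_prod D"
    using D'(1) unfolding D'_eq by (simp add: convergent_prod_Suc_iff)
  have D0: "D 0 \<noteq> 0"
  proof -
    have "norm (q * w') < 1" using qw' Y0 s by simp
    thus ?thesis by (auto simp: D_def)
  qed
  have prodD: "prodinf D = D 0 * prodinf D'"
    unfolding D'_eq using prodinf_split_head[OF convD D0] D0 by simp
  have w1: "1 - w \<noteq> 0"
  proof -
    have "norm w < 1" using nw Y0 s by simp
    thus ?thesis by auto
  qed
  have "prodinf (\<lambda>n. B n * C n * D n) = prodinf B * prodinf C * prodinf D"
    using B C convD by (simp add: prodinf_mult convergent_prod_mult)
  hence th: "theta1 z \<tau> = 2 * exp (2 * of_real pi * \<i> * \<tau> / 8) * sin (of_real pi * z) * (prodinf B * prodinf C * (D 0 * prodinf D'))"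
    unfolding theta1_def B_def C_def D_def q_def w_def w'_def prodD[unfolded D_def q_def w'_def] by simp
  have et: "dedekind_eta \<tau> = exp (2 * of_real pi * \<i> * \<tau> / 24) * prodinf B"
    unfolding dedekind_eta_def B_def q_def ..
  have "cmod (theta1 z \<tau> / dedekind_eta \<tau>) = 
     exp (- (Y / 8)) * (2 * cmod (sin (of_real pi * z))) * (cmod (prodinf C) * (cmod (D 0) * cmod (prodinf D'))) / exp (- (Y / 24))"
    unfolding th et using B(2) by (simp add: norm_mult norm_divide Y_def mult_ac)
  also have "\<dots> = exp (- (Y / 12) + s * Y / 2) * cmod (1 - w) * (cmod (prodinf C) * (cmod (D 0) * cmod (prodinf D')))"
  proof -
    have "exp (- (Y / 8)) * (e * m) * P / exp (- (Y / 24)) = exp (- (Y / 12)) * e * m * P" for e m P :: real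
    proof -
      have "exp (- (Y / 8)) = exp (- (Y / 12)) * exp (- (Y / 24))" by (simp flip: exp_add)
      thus ?thesis by simp
    qed
    moreover have "exp (pi * Im z) = exp (s * Y / 2)" by (simp add: z_def Y_def)
    ultimately show ?thesis unfolding cmod_sin_pi w_def exp_add by (simp only:)
  qed
  finally have "ln (cmod (theta1 z \<tau> / dedekind_eta \<tau>)) = 
     (- (Y / 12) + s * Y / 2) + ln (cmod (1 - w)) + (ln (cmod (prodinf C)) + (ln (cmod (D 0)) + ln (cmod (prodinf D'))))"
    using w1 C(2) D0 D'(2) by (simp add: ln_mult)
  moreover have "ln ((cmod (theta1 z \<tau> / dedekind_eta \<tau>))\<^sup>2) = 2 * ln (cmod (theta1 z \<tau> / dedekind_eta \<tau>))"
    by (cases "cmod (theta1 z \<tau> / dedekind_eta \<tau>) = 0") (simp_all add: ln_realpow)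
  moreover have "log_potential (s * Y) (s * Re \<tau> + t) = - 2 * ln (cmod (1 - w))"
  proof -
    have "2 * of_real pi * \<i> * z = of_real (- (s * Y)) + \<i> * of_real (2 * pi * (s * Re \<tau> + t))"
      by (simp add: complex_eq_iff z_def Y_def algebra_simps)
    hence "w = of_real (exp (- (s * Y))) * cis (2 * pi * (s * Re \<tau> + t))"
      unfolding w_def by (simp only: exp_add exp_of_real cis_conv_exp)
    thus ?thesis by (simp add: log_potential_def)
  qed
  \<comment> \<open>The phase of q w' is the negative of the stated one; evenness of the potential
    in t gives both potentials the same orientation.\<close>
  moreover have "log_potential ((1 - s) * Y) (t + (s - 1) * Re \<tau>) = - 2 * ln (cmod (D 0))"
  proof -
    have "2 * of_real pi * \<i> * \<tau> + - (2 * of_real pi * \<i> * z) = 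
        of_real (- ((1 - s) * Y)) + \<i> * of_real (2 * pi * (- (t + (s - 1) * Re \<tau>)))"
      by (simp add: complex_eq_iff z_def Y_def algebra_simps)
    hence "q * w' = of_real (exp (- ((1 - s) * Y))) * cis (2 * pi * (- (t + (s - 1) * Re \<tau>)))"
      unfolding q_def nome_def w'_def exp_add[symmetric] by (simp only: exp_add exp_of_real cis_conv_exp)
    hence "log_potential ((1 - s) * Y) (- (t + (s - 1) * Re \<tau>)) = - 2 * ln (cmod (D 0))"
      by (simp add: log_potential_def D_def)
    thus ?thesis unfolding log_potential_minus .
  qed
  moreover have "2 * pi * (Im z)\<^sup>2 / Im \<tau> = Y * s\<^sup>2"
    using im by (simp add: z_def Y_def power2_eq_square)
  ultimately have "green z \<tau> = Y * (s\<^sup>2 - s + 1/6) + log_potential (s * Y) (s * Re \<tau> + t) + log_potential ((1 - s) * Y) (t + (s - 1) * Re \<tau>)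
     - 2 * ln (cmod (prodinf C)) - 2 * ln (cmod (prodinf D'))"
    unfolding green_def by (simp add: algebra_simps)
  thus ?thesis using C(3) D'(3) unfolding z_def[symmetric] \<rho>_def by linarith
qed

lemma convergent_prod_nome:
  assumes "Im \<tau> > 0"
  shows "convergent_prod (\<lambda>n. 1 - nome \<tau> ^ Suc n * c)"
proof -
  have "norm (nome \<tau>) < 1" using assms by (simp add: nome_def)
  hence "summable (\<lambda>n. norm (nome \<tau>) ^ n * norm (nome \<tau> * c))"
    by (intro summable_mult2 summable_geometric) auto
  hence "summable (\<lambda>n. norm ((1 - nome \<tau> ^ Suc n * c) - 1))"
    by (simp add: norm_mult norm_power mult_ac)
  hence "abs_convergent_prod (\<lambda>n. 1 - nome \<tau> ^ Suc n * c)"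
    by (simp only: abs_convergent_prod_conv_summable)
  thus ?thesis by (rule abs_convergent_prod_imp_convergent_prod)
qed

lemma green_measurable:
  assumes "Im \<tau> > 0"
  shows "(\<lambda>z. green z \<tau>) \<in> borel_measurable borel"
proof -
  define f where "f = (\<lambda>z n. (1 - nome \<tau> ^ Suc n)
                  * (1 - nome \<tau> ^ Suc n * exp (2 * of_real pi * \<i> * z))
                  * (1 - nome \<tau> ^ Suc n * exp (- (2 * of_real pi * \<i> * z))))"
  have "convergent_prod (f z)" for z
    unfolding f_def using convergent_prod_nome[OF assms, of 1]
    by (intro convergent_prod_mult convergent_prod_nome assms) simp
  hence lim: "(\<lambda>n. \<Prod>i\<le>n. f z i) \<longlonglongrightarrow> prodinf (f z)" for z by (rule convergent_prod_LIMSEQ)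
  have "(\<lambda>z. \<Prod>i\<le>n. f z i) \<in> borel_measurable borel" for n
    unfolding f_def by measurable
  hence [measurable]: "(\<lambda>z. prodinf (f z)) \<in> borel_measurable borel"
    using lim by (rule borel_measurable_LIMSEQ_metric)
  have "continuous_on UNIV (\<lambda>z. sin (complex_of_real pi * z))" by (intro continuous_intros)
  hence [measurable]: "(\<lambda>z. sin (complex_of_real pi * z)) \<in> borel_measurable borel"
    by (rule borel_measurable_continuous_onI)
  have "(\<lambda>z. theta1 z \<tau>) = (\<lambda>z. 2 * exp (2 * of_real pi * \<i> * \<tau> / 8) * sin (of_real pi * z) * prodinf (f z))"
    by (simp add: theta1_def f_def fun_eq_iff)
  also have "\<dots> \<in> borel_measurable borel" by measurable
  finally have [measurable]: "(\<lambda>z. theta1 z \<tau>) \<in> borel_measurable borel" .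
  show ?thesis unfolding green_def by measurable
qed

section \<open>Coordinates (s,t) on the torus and Fubini\<close>

definition torus_map :: "complex \<Rightarrow> real \<times> real \<Rightarrow> complex" where
  "torus_map \<tau> = (\<lambda>(s, t). of_real s * \<tau> + of_real t)"

lemma torus_map_measurable [measurable]: "torus_map \<tau> \<in> borel_measurable (borel \<Otimes>\<^sub>M borel)"
  unfolding torus_map_def by measurable

text \<open>The map is real-linear with determinant of modulus Im \<tau>. For a box, the slice of
  the preimage at fixed s is empty or an interval translated by -s Re \<tau>, so its length does not
  vary with s.\<close>

lemma lborel_torus_map:
  assumes a: "Im \<tau> > 0"
  shows "lborel = density (distr (lborel \<Otimes>\<^sub>M lborel) borel (torus_map \<tau>)) (\<lambda>_. ennreal (Im \<tau>))"
proof (rule lborel_eqI)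
  fix l u :: complex assume lu: "\<And>b. b \<in> Basis \<Longrightarrow> l \<bullet> b \<le> u \<bullet> b"
  have re: "Re l \<le> Re u" and im: "Im l \<le> Im u" using lu[of 1] lu[of \<i>] by (auto simp: Basis_complex_def)
  let ?a = "Im \<tau>"
  have box: "box l u = {z. Re l < Re z \<and> Re z < Re u \<and> Im l < Im z \<and> Im z < Im u}"
    by (auto simp: box_def Basis_complex_def)
  define S where "S = {Im l / ?a<..<Im u / ?a}"
  have sl: "Pair s -` (torus_map \<tau> -` box l u \<inter> space (lborel \<Otimes>\<^sub>M lborel)) =
      (if s \<in> S then {Re l - s * Re \<tau> <..< Re u - s * Re \<tau>} else {})" for s
    using a by (auto simp: torus_map_def box S_def field_simps space_pair_measure)
  have "emeasure (density (distr (lborel \<Otimes>\<^sub>M lborel) borel (torus_map \<tau>)) (\<lambda>_. ennreal ?a)) (box l u) =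
     ennreal ?a * emeasure (lborel \<Otimes>\<^sub>M lborel) (torus_map \<tau> -` box l u \<inter> space (lborel \<Otimes>\<^sub>M lborel))"
    by (simp add: emeasure_density_const emeasure_distr)
  also have "emeasure (lborel \<Otimes>\<^sub>M lborel) (torus_map \<tau> -` box l u \<inter> space (lborel \<Otimes>\<^sub>M lborel)) = 
     (\<integral>\<^sup>+ s. emeasure lborel (Pair s -` (torus_map \<tau> -` box l u \<inter> space (lborel \<Otimes>\<^sub>M lborel))) \<partial>lborel)"
    by (rule lborel.emeasure_pair_measure_alt) (intro measurable_sets[of _ _ borel], auto)
  also have "\<dots> = (\<integral>\<^sup>+ s. ennreal (Re u - Re l) * indicator S s \<partial>lborel)"
    unfolding sl using re by (intro nn_integral_cong) auto
  also have "\<dots> = ennreal (Re u - Re l) * emeasure lborel S"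
    by (simp add: S_def nn_integral_cmult_indicator)
  also have "emeasure lborel S = ennreal ((Im u - Im l) / ?a)"
    using a im by (simp add: S_def divide_right_mono diff_divide_distrib)
  also have "ennreal ?a * (ennreal (Re u - Re l) * ennreal ((Im u - Im l) / ?a)) = ennreal ((Re u - Re l) * (Im u - Im l))"
    using a re im by (simp flip: ennreal_mult)
  also have "(Re u - Re l) * (Im u - Im l) = (\<Prod>b\<in>Basis. (u - l) \<bullet> b)"
    by (simp add: Basis_complex_def)
  finally show "emeasure (density (distr (lborel \<Otimes>\<^sub>M lborel) borel (torus_map \<tau>)) (\<lambda>_. ennreal ?a)) (box l u)
     = (\<Prod>b\<in>Basis. (u - l) \<bullet> b)" .
qed simp

lemma integral_unit':
  fixes f :: "real \<Rightarrow> real"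
  assumes [measurable]: "f \<in> borel_measurable borel"
  shows "(LINT t|lborel. indicator {0..<1} t * f t) = (LINT t|unit_measure. f t)"
proof -
  have "AE t in lborel. indicator {0..<1} t * f t = indicator {0<..<1} t *\<^sub>R f t"
    using AE_lborel_singleton[of "0::real"] by eventually_elim (auto simp: indicator_def)
  thus ?thesis unfolding integral_unit by (intro integral_cong_AE) auto
qed

lemma parallelogram_measurable:
  assumes a: "Im \<tau> > 0"
  shows "fundamental_parallelogram \<tau> \<in> sets borel"
    "torus_map \<tau> (s, t) \<in> fundamental_parallelogram \<tau> \<longleftrightarrow> s \<in> {0..<1} \<and> t \<in> {0..<1}"
proof -
  have eq: "z \<in> fundamental_parallelogram \<tau> \<longleftrightarrow> Im z / Im \<tau> \<in> {0..<1} \<and> Re z - Im z / Im \<tau> * Re \<tau> \<in> {0..<1}" for z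
  proof
    assume "z \<in> fundamental_parallelogram \<tau>"
    thus "Im z / Im \<tau> \<in> {0..<1} \<and> Re z - Im z / Im \<tau> * Re \<tau> \<in> {0..<1}"
      using a by (auto simp: fundamental_parallelogram_def)
  next
    assume *: "Im z / Im \<tau> \<in> {0..<1} \<and> Re z - Im z / Im \<tau> * Re \<tau> \<in> {0..<1}"
    have "z = of_real (Im z / Im \<tau>) * \<tau> + of_real (Re z - Im z / Im \<tau> * Re \<tau>)"
      using a by (simp add: complex_eq_iff)
    thus "z \<in> fundamental_parallelogram \<tau>"
      using * unfolding fundamental_parallelogram_def by blast
  qed
  have "fundamental_parallelogram \<tau> = {z. Im z / Im \<tau> \<in> {0..<1} \<and> Re z - Im z / Im \<tau> * Re \<tau> \<in> {0..<1}}"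
    using eq by blast
  also have "\<dots> \<in> sets borel" by measurable
  finally show "fundamental_parallelogram \<tau> \<in> sets borel" .
  show "torus_map \<tau> (s, t) \<in> fundamental_parallelogram \<tau> \<longleftrightarrow> s \<in> {0..<1} \<and> t \<in> {0..<1}"
    unfolding eq using a by (simp add: torus_map_def)
qed

text \<open>For 0 < s < 1 the fibre avoids the lattice points, with a bound that may degenerate at
  the ends; hence a majorant depending on s alone. The Jacobian Im \<tau> cancels the normalisation,
  and the line s = 0 of the half-open parallelogram is a null set.\<close>

lemma modular_graph_D_eq:
  assumes a: "Im \<tau> > 0"
    and w: "integrable unit_measure w"
    and le: "\<And>s t. 0 < s \<Longrightarrow> s < 1 \<Longrightarrow> \<bar>green (of_real s * \<tau> + of_real t) \<tau> ^ l\<bar> \<le> w s"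
  shows "modular_graph_D l \<tau> = (LINT s|unit_measure. LINT t|unit_measure. green (of_real s * \<tau> + of_real t) \<tau> ^ l)"
    "(\<lambda>s. LINT t|unit_measure. green (of_real s * \<tau> + of_real t) \<tau> ^ l) \<in> borel_measurable borel"
proof -
  interpret U: finite_measure unit_measure by (rule finite_measure_unit)
  define f where "f = (\<lambda>z. green z \<tau> ^ l)"
  have f [measurable]: "f \<in> borel_measurable borel"
    unfolding f_def using green_measurable[OF a] by measurable
  note par [measurable] = parallelogram_measurable(1)[OF a]
  define F where "F = (\<lambda>s t. f (of_real s * \<tau> + of_real t))"
  have Fm [measurable]: "case_prod F \<in> borel_measurable (borel \<Otimes>\<^sub>M borel)"
    unfolding F_def by measurable
  have Fm1 [measurable]: "F s \<in> borel_measurable borel" for s unfolding F_def by measurable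
  define I where "I = (indicator {0..<1} :: real \<Rightarrow> real)"
  have Im [measurable]: "I \<in> borel_measurable borel" unfolding I_def by measurable
  have meas: "(\<lambda>s. LINT t|unit_measure. F s t) \<in> borel_measurable borel"
  proof -
    have "(\<lambda>x. case_prod F (fst x, snd x)) \<in> borel_measurable (borel \<Otimes>\<^sub>M unit_measure)"
      by (rule measurable_compose[OF _ Fm]) (intro measurable_Pair measurable_fst measurable_compose[OF measurable_snd] id_measurable)
    thus ?thesis by (intro U.borel_measurable_lebesgue_integral) (simp add: case_prod_beta')
  qed
  thus "(\<lambda>s. LINT t|unit_measure. green (of_real s * \<tau> + of_real t) \<tau> ^ l) \<in> borel_measurable borel"
    unfolding F_def f_def .
  define H where "H = (\<lambda>s t. I s * (I t * F s t))"
  have Hm [measurable]: "case_prod H \<in> borel_measurable (lborel \<Otimes>\<^sub>M lborel)"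
    unfolding H_def by measurable
  have wint: "integrable lborel (\<lambda>s. indicator {0<..<1} s *\<^sub>R w s)"
    using w unfolding unit_measure_def by (simp add: integrable_restrict_space)
  have int: "integrable (lborel \<Otimes>\<^sub>M lborel) (case_prod H)"
  proof (rule lborel_pair.Fubini_integrable[OF Hm])
    have Ii: "integrable lborel (\<lambda>t. I t * F s t)" if s: "0 < s" "s < 1" for s
    proof -
      have "norm (F s t) \<le> w s" for t using le s by (simp add: F_def f_def)
      hence "integrable lborel (\<lambda>t. indicator {0..<1} t *\<^sub>R F s t)"
        by (intro integrableI_bounded_set_indicator[where B = "w s"]) auto
      thus ?thesis by (simp add: I_def)
    qed
    have ne: "AE s in lborel. s \<noteq> (0::real)" by (rule AE_lborel_singleton)
    show "AE s in lborel. integrable lborel (\<lambda>t. case_prod H (s, t))"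
      using ne
    proof eventually_elim
      case (elim s)
      show ?case
      proof (cases "0 < s \<and> s < 1")
        case True
        thus ?thesis unfolding H_def by (auto intro!: integrable_mult_right Ii)
      next
        case False
        hence "I s = 0" using elim by (auto simp: I_def)
        thus ?thesis by (simp add: H_def)
      qed
    qed
    show "integrable lborel (\<lambda>s. LINT t|lborel. norm (case_prod H (s, t)))"
    proof (rule Bochner_Integration.integrable_bound[OF wint])
      show "AE s in lborel. norm (LINT t|lborel. norm (case_prod H (s, t))) \<le> norm (indicator {0<..<1} s *\<^sub>R w s)"
        using ne
      proof eventually_elim
        case (elim s)
        show ?case
        proof (cases "0 < s \<and> s < 1")
          case True
          have "(LINT t|lborel. norm (case_prod H (s, t))) = (LINT t|lborel. I t * \<bar>F s t\<bar>)"
            using True by (intro Bochner_Integration.integral_cong refl) (auto simp: H_def I_def abs_mult indicator_def)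
          also have "\<dots> = (LINT t|unit_measure. \<bar>F s t\<bar>)"
            unfolding I_def by (rule integral_unit') simp
          finally have e: "(LINT t|lborel. norm (case_prod H (s, t))) = (LINT t|unit_measure. \<bar>F s t\<bar>)" .
          have "\<bar>LINT t|unit_measure. \<bar>F s t\<bar>\<bar> \<le> w s"
          proof (intro integral_unit_le measurable_unit)
            show "(\<lambda>t. \<bar>F s t\<bar>) \<in> borel_measurable borel" by simp
          qed (use le True in \<open>auto simp: F_def f_def\<close>)
          also have "w s \<le> \<bar>w s\<bar>" by simp
          finally show ?thesis using True unfolding e by simp
        next
          case False
          hence "I s = 0" using elim by (auto simp: I_def)
          thus ?thesis by (simp add: H_def)
        qed
      qed
      show "(\<lambda>s. LINT t|lborel. norm (case_prod H (s, t))) \<in> borel_measurable lborel"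
        by (rule lborel.borel_measurable_lebesgue_integral) (simp add: case_prod_beta')
    qed
  qed
  have "(LINT z:fundamental_parallelogram \<tau>|lborel. f z) = 
     (LINT z|density (distr (lborel \<Otimes>\<^sub>M lborel) borel (torus_map \<tau>)) (\<lambda>_. ennreal (Im \<tau>)). indicator (fundamental_parallelogram \<tau>) z *\<^sub>R f z)"
    unfolding set_lebesgue_integral_def by (subst lborel_torus_map[OF a]) (rule refl)
  also have "\<dots> = (LINT z|distr (lborel \<Otimes>\<^sub>M lborel) borel (torus_map \<tau>). Im \<tau> *\<^sub>R (indicator (fundamental_parallelogram \<tau>) z *\<^sub>R f z))"
    using a by (intro integral_density) auto
  also have "\<dots> = (LINT p|(lborel \<Otimes>\<^sub>M lborel). Im \<tau> *\<^sub>R (indicator (fundamental_parallelogram \<tau>) (torus_map \<tau> p) *\<^sub>R f (torus_map \<tau> p)))"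
    by (intro integral_distr) auto
  also have "\<dots> = Im \<tau> * (LINT p|(lborel \<Otimes>\<^sub>M lborel). case_prod H p)"
  proof -
    have "indicator (fundamental_parallelogram \<tau>) (torus_map \<tau> p) *\<^sub>R f (torus_map \<tau> p) = case_prod H p" for p
      using parallelogram_measurable(2)[OF a, of "fst p" "snd p"]
      by (cases p) (auto simp: H_def I_def F_def torus_map_def indicator_def)
    thus ?thesis by simp
  qed
  also have "(LINT p|(lborel \<Otimes>\<^sub>M lborel). case_prod H p) = (LINT s|lborel. LINT t|lborel. H s t)"
    using lborel_pair.integral_fst[OF int] by simp
  also have "\<dots> = (LINT s|lborel. I s * (LINT t|lborel. I t * F s t))"
    unfolding H_def by simp
  also have "\<dots> = (LINT s|unit_measure. LINT t|unit_measure. F s t)"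
    unfolding I_def by (subst integral_unit', simp, rule integral_unit'[OF meas])
  finally show "modular_graph_D l \<tau> = (LINT s|unit_measure. LINT t|unit_measure. green (of_real s * \<tau> + of_real t) \<tau> ^ l)"
    unfolding modular_graph_D_def f_def F_def using a by simp
qed

section \<open>Asymptotics\<close>

lemma power_le_exp:
  fixes x y :: real assumes "0 < x" "0 \<le> y"
  shows "y ^ l \<le> fact l / x ^ l * exp (x * y)"
proof -
  have s: "(\<lambda>n. x ^ n / fact n * y ^ n) sums exp (x * y)"
    using exp_converges[of "x * y"] by (simp add: power_mult_distrib divide_inverse mult_ac)
  have "x ^ l / fact l * y ^ l \<le> (\<Sum>n<Suc l. x ^ n / fact n * y ^ n)"
    using assms by (intro member_le_sum) auto
  also have "\<dots> \<le> exp (x * y)"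
    unfolding sums_unique[OF s] using assms by (intro sum_le_suminf sums_summable[OF s]) auto
  finally show ?thesis by (rule mult_frac_le_imp_le) (use assms in auto)
qed

lemma integrable_unit_scale:
  fixes f :: "real \<Rightarrow> real"
  assumes "integrable pos_measure f" "Y > 0"
  shows "integrable unit_measure (\<lambda>s. f (s * Y))"
    "(LINT s|unit_measure. f (s * Y)) = (LINT S|pos_measure. indicator {0<..<Y} S * f S) / Y"
    "integrable pos_measure (\<lambda>S. indicator {0<..<Y} S * f S)"
proof -
  have f: "integrable lborel (\<lambda>S. indicator {0<..} S *\<^sub>R f S)"
    using assms(1) unfolding pos_measure_def by (simp add: integrable_restrict_space)
  have "integrable lborel (\<lambda>S. indicator {0<..<Y} S *\<^sub>R (indicator {0<..} S *\<^sub>R f S))"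
    by (rule integrable_mult_indicator[OF _ f]) simp
  hence g: "integrable lborel (\<lambda>S. indicator {0<..<Y} S * f S)"
    by (rule Bochner_Integration.integrable_cong[THEN iffD1, rotated -1]) (auto simp: indicator_def)
  hence "integrable lborel (\<lambda>s. indicator {0<..<Y} (0 + Y * s) * f (0 + Y * s))"
    using assms(2) by (intro lborel_integrable_real_affine) auto
  also have "(\<lambda>s. indicator {0<..<Y} (0 + Y * s) * f (0 + Y * s)) = (\<lambda>s. indicator {0<..<1} s *\<^sub>R f (s * Y))"
    using assms(2) by (auto simp: indicator_def fun_eq_iff mult.commute zero_less_mult_iff)
  finally show "integrable unit_measure (\<lambda>s. f (s * Y))"
    unfolding unit_measure_def by (simp add: integrable_restrict_space)
  have r: "(LINT S|pos_measure. indicator {0<..<Y} S * f S) = (LINT S|lborel. indicator {0<..<Y} S * f S)"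
    unfolding pos_measure_def 
    by (subst integral_restrict_space) (auto simp: indicator_def intro!: Bochner_Integration.integral_cong)
  have "(LINT S|lborel. indicator {0<..<Y} S * f S) = \<bar>Y\<bar> *\<^sub>R (LINT s|lborel. indicator {0<..<Y} (0 + Y * s) * f (0 + Y * s))"
    using assms(2) by (intro lborel_integral_real_affine) auto
  also have "(\<lambda>s. indicator {0<..<Y} (0 + Y * s) * f (0 + Y * s)) = (\<lambda>s. indicator {0<..<1} s *\<^sub>R f (s * Y))"
    using assms(2) by (auto simp: indicator_def fun_eq_iff mult.commute zero_less_mult_iff)
  finally show "(LINT s|unit_measure. f (s * Y)) = (LINT S|pos_measure. indicator {0<..<Y} S * f S) / Y"
    unfolding integral_unit r using assms(2) by simp
  show "integrable pos_measure (\<lambda>S. indicator {0<..<Y} S * f S)"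
  proof -
    have "{0<..<Y} \<in> sets pos_measure" unfolding sets_pos by (subst sets_restrict_space_iff) auto
    from integrable_mult_indicator[OF this assms(1)] show ?thesis by simp
  qed
qed

lemma integrable_unit_reflect:
  fixes f :: "real \<Rightarrow> real"
  shows "integrable unit_measure f \<Longrightarrow> integrable unit_measure (\<lambda>s. f (1 - s))"
    "(LINT s|unit_measure. f (1 - s)) = (LINT s|unit_measure. f s)"
proof -
  have eq: "(\<lambda>s. indicator {0<..<1} (1 + - 1 * s) *\<^sub>R f (1 + - 1 * s)) = (\<lambda>s. indicator {0<..<1} s *\<^sub>R f (1 - s))"
    by (auto simp: indicator_def fun_eq_iff)
  show "integrable unit_measure (\<lambda>s. f (1 - s))" if "integrable unit_measure f"
  proof -
    have "integrable lborel (\<lambda>s. indicator {0<..<1} s *\<^sub>R f s)"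
      using that unfolding unit_measure_def by (simp add: integrable_restrict_space)
    hence "integrable lborel (\<lambda>s. indicator {0<..<1} (1 + - 1 * s) *\<^sub>R f (1 + - 1 * s))"
      by (intro lborel_integrable_real_affine) auto
    thus ?thesis unfolding eq unit_measure_def by (simp add: integrable_restrict_space)
  qed
  show "(LINT s|unit_measure. f (1 - s)) = (LINT s|unit_measure. f s)"
    unfolding integral_unit using lborel_integral_real_affine[of "-1" "\<lambda>s. indicator {0<..<1} s *\<^sub>R f s" 1]
    unfolding eq by simp
qed

text \<open>One summand for each singular end, s = 0 and s = 1.\<close>

definition dominator_sum :: "real \<Rightarrow> real \<Rightarrow> real" where
  "dominator_sum Y s = dominator (s * Y) + dominator ((1 - s) * Y)"

lemma dominator_sum_integrable:
  assumes "Y \<ge> 1"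
  shows "integrable unit_measure (dominator_sum Y)" "(LINT s|unit_measure. dominator_sum Y s) \<le> 2 * (LINT S|pos_measure. dominator S)"
proof -
  have Y: "Y > 0" using assms by simp
  note i1 = integrable_unit_scale[OF dominator_integrable Y]
  note i2 = integrable_unit_reflect(1)[OF i1(1)]
  show "integrable unit_measure (dominator_sum Y)" unfolding dominator_sum_def by (intro Bochner_Integration.integrable_add i1 i2)
  have "(LINT S|pos_measure. indicator {0<..<Y} S * dominator S) \<le> (LINT S|pos_measure. dominator S)"
    by (intro integral_mono i1 dominator_integrable) (auto simp: indicator_def less_imp_le[OF dominator_pos])
  moreover have "0 \<le> (LINT S|pos_measure. dominator S)"
    by (intro integral_nonneg_AE AE_I2) (auto simp: less_imp_le[OF dominator_pos])
  moreover have "(LINT S|pos_measure. indicator {0<..<Y} S * dominator S) / Y \<le> (LINT S|pos_measure. dominator S) / 1"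
    by (intro frac_le) (use calculation assms in auto)
  ultimately have "(LINT s|unit_measure. dominator (s * Y)) \<le> (LINT S|pos_measure. dominator S)"
    unfolding i1(2) by simp
  moreover have "(LINT s|unit_measure. dominator_sum Y s) = (LINT s|unit_measure. dominator (s * Y)) + (LINT s|unit_measure. dominator (s * Y))"
    unfolding dominator_sum_def by (subst Bochner_Integration.integral_add[OF i1(1) i2]) (simp add: integrable_unit_reflect(2)[of "\<lambda>s. dominator (s * Y)"])
  ultimately show "(LINT s|unit_measure. dominator_sum Y s) \<le> 2 * (LINT S|pos_measure. dominator S)" by simp
qed

text \<open>sY and (1-s)Y add up to Y \<ge> 2, so one of them is at least 1, where
  \<open>dominator\<close> is at most 1. The sum, unlike the product, separates the two ends and is
  integrated easily.\<close>

lemma dominator_mult_le_dominator_sum: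
  assumes "Y \<ge> 2" "0 < s" "s < 1"
  shows "dominator (s * Y) * dominator ((1 - s) * Y) \<le> dominator_sum Y s" "0 < dominator_sum Y s"
proof -
  have le1: "dominator S \<le> 1" if "S \<ge> 1" for S
  proof -
    have "exp S - 1 \<ge> 1" using exp_ge_add_one_self[of S] that by linarith
    hence "sqrt (exp S - 1) \<ge> 1" by simp
    hence "1 / sqrt (exp S - 1) \<le> 1 / 1" by (intro frac_le) auto
    thus ?thesis by (simp add: dominator_def)
  qed
  have p: "dominator (s * Y) > 0" "dominator ((1 - s) * Y) > 0" using assms by (auto intro!: dominator_pos)
  thus "0 < dominator_sum Y s" by (simp add: dominator_sum_def)
  have "s * Y + (1 - s) * Y \<ge> 2" using assms by (simp add: algebra_simps)
  hence "s * Y \<ge> 1 \<or> (1 - s) * Y \<ge> 1" by linarith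
  thus "dominator (s * Y) * dominator ((1 - s) * Y) \<le> dominator_sum Y s"
  proof
    assume "s * Y \<ge> 1"
    hence "dominator (s * Y) * dominator ((1 - s) * Y) \<le> 1 * dominator ((1 - s) * Y)"
      using p by (intro mult_right_mono le1) auto
    thus ?thesis using p unfolding dominator_sum_def by linarith
  next
    assume "(1 - s) * Y \<ge> 1"
    hence "dominator (s * Y) * dominator ((1 - s) * Y) \<le> dominator (s * Y) * 1"
      using p by (intro mult_left_mono le1) auto
    thus ?thesis using p unfolding dominator_sum_def by linarith
  qed
qed

lemma exp_neg_le_quarter: "Y \<ge> 2 \<Longrightarrow> exp (- Y) \<le> (1/4 :: real)"
proof -
  assume "Y \<ge> 2"
  hence "exp (- Y) \<le> exp (- 2)" by simp
  also have "exp (- 2) \<le> 1 / (4 :: real)"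
  proof -
    have "(2::real) \<le> exp 1" using exp_ge_add_one_self[of 1] by simp
    hence "(2::real) ^ 2 \<le> exp 1 ^ 2" by (intro power_mono) auto
    hence "(4::real) \<le> exp 2" by (simp flip: exp_double)
    thus ?thesis by (simp add: exp_minus field_simps)
  qed
  finally show ?thesis .
qed

text \<open>All powers are estimated with weight 1/4. The bound Y/6 gives e^{Y/24} and the two
  potentials give e^{Y/2} h, together e^{13Y/24} h; the error e^{-Y} of the expansion leaves
  e^{-11Y/24}. The mixed part reaches the same rate as e^{Y/24 - Y/2}. Both are rounded to e^{-Y/4},
  with 9 = 8 + 1. The second claim grows with Y and provides integrability at fixed \<tau>.\<close>

lemma green_power_bounds:
  fixes Y s B P Q g :: real and l :: nat
  assumes Y: "Y \<ge> 2" and s: "0 < s" "s < 1" and B: "\<bar>B\<bar> \<le> Y / 6"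
    and P: "\<bar>P\<bar> \<le> potential_bound (s * Y)" and Q: "\<bar>Q\<bar> \<le> potential_bound ((1 - s) * Y)"
    and g: "\<bar>g - (B + P + Q)\<bar> \<le> 16 * exp (- Y)"
  shows "\<bar>g ^ l - ((B + P) ^ l + (B + Q) ^ l - B ^ l)\<bar> \<le> 9 * (fact l * 4 ^ l) * exp (- (Y / 4)) * dominator_sum Y s"
    "\<bar>g ^ l\<bar> \<le> fact l * 4 ^ l * exp (Y + 4) * dominator_sum Y s"
proof -
  define p where "p = potential_bound (s * Y)"
  define q where "q = potential_bound ((1 - s) * Y)"
  define \<epsilon> where "\<epsilon> = 16 * exp (- Y)"
  have sY: "s * Y > 0" "(1 - s) * Y > 0" using Y s by auto
  have pq: "p \<ge> 0" "q \<ge> 0" using sY by (auto simp: p_def q_def potential_bound_nonneg)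
  define h where "h = dominator (s * Y) * dominator ((1 - s) * Y)"
  have h: "0 < h" "h \<le> dominator_sum Y s" using dominator_mult_le_dominator_sum[OF Y s] sY by (auto simp: h_def dominator_pos)
  have e1: "exp (p / 4) = exp (s * Y / 2) * dominator (s * Y)" unfolding p_def by (rule exp_potential_bound[OF sY(1)])
  have e2: "exp (q / 4) = exp ((1 - s) * Y / 2) * dominator ((1 - s) * Y)" unfolding q_def by (rule exp_potential_bound[OF sY(2)])
  have "exp (p / 4) * exp (q / 4) = (exp (s * Y / 2) * exp ((1 - s) * Y / 2)) * h"
    unfolding e1 e2 h_def by (simp only: mult_ac)
  also have "exp (s * Y / 2) * exp ((1 - s) * Y / 2) = exp (Y / 2)"
    by (simp flip: exp_add add: field_simps)
  finally have epq: "exp (p / 4) * exp (q / 4) = exp (Y / 2) * h" .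
  define b where "b = Y / 6 + p + q"
  have b: "b \<ge> 0" using pq Y by (simp add: b_def)
  have eb: "exp (1/4 * b) = exp (13/24 * Y) * h"
  proof -
    have "exp (1/4 * b) = exp (Y / 24) * (exp (p / 4) * exp (q / 4))"
      by (simp add: b_def distrib_left mult.assoc flip: exp_add)
    thus ?thesis unfolding epq by (simp flip: exp_add)
  qed
  have eY: "exp (- Y) \<le> 1/4" by (rule exp_neg_le_quarter[OF Y])
  have \<epsilon>: "0 \<le> \<epsilon>" "1/4 * \<epsilon> \<le> 1" using eY by (auto simp: \<epsilon>_def)
  have X: "\<bar>B + P + Q\<bar> \<le> b" using B P Q by (simp add: b_def p_def q_def)
  let ?c = "fact l * 4 ^ l :: real"
  have c: "fact l / (1/4) ^ l = ?c" by (simp add: power_one_over)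
  have r1: "\<bar>g ^ l - (B + P + Q) ^ l\<bar> \<le> 8 * ?c * exp (- (Y / 4)) * dominator_sum Y s"
  proof -
    have "\<bar>g ^ l - (B + P + Q) ^ l\<bar> = \<bar>((g - (B + P + Q)) + (B + P + Q)) ^ l - (B + P + Q) ^ l\<bar>" by simp
    also have "\<dots> \<le> (\<epsilon> + b) ^ l - b ^ l"
      using g X unfolding \<epsilon>_def[symmetric] by (rule abs_power_diff_le)
    also have "\<dots> \<le> fact l / (1/4) ^ l * (exp (1/4 * b) * (exp (1/4 * \<epsilon>) - 1))"
      using \<epsilon> b by (intro power_diff_exp_le) auto
    also have "\<dots> \<le> ?c * (exp (1/4 * b) * (8 * exp (- Y)))"
    proof -
      \<comment> \<open>e^u - 1 \<le> 2u for 0 \<le> u \<le> 1, here with u = 4 e^{-Y}; hence the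
        constant 8.\<close>
      have "exp (1/4 * \<epsilon>) \<le> 1 + 1/4 * \<epsilon> + (1/4 * \<epsilon>)\<^sup>2" using \<epsilon> by (intro exp_bound) auto
      also have "(1/4 * \<epsilon>)\<^sup>2 \<le> 1/4 * \<epsilon> * 1" unfolding power2_eq_square using \<epsilon> by (intro mult_left_mono) auto
      finally have "exp (1/4 * \<epsilon>) - 1 \<le> 8 * exp (- Y)" by (simp add: \<epsilon>_def)
      thus ?thesis unfolding c by (intro mult_left_mono) auto
    qed
    also have "\<dots> = 8 * ?c * exp (- (11/24 * Y)) * h"
    proof -
      have "exp (13/24 * Y) * exp (- Y) = exp (- (11/24 * Y))" by (simp flip: exp_add)
      thus ?thesis unfolding eb by (simp add: mult_ac)
    qed
    also have "\<dots> \<le> 8 * ?c * exp (- (Y / 4)) * dominator_sum Y s"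
      using h Y by (intro mult_mono) auto
    finally show ?thesis .
  qed
  have r2: "\<bar>cross_term l B P Q\<bar> \<le> ?c * exp (- (Y / 4)) * dominator_sum Y s"
  proof -
    have "\<bar>cross_term l B P Q\<bar> \<le> cross_term l (Y / 6) p q"
      using B P Q unfolding p_def q_def by (rule abs_cross_term_le)
    also have "\<dots> \<le> fact l / (1/4) ^ l * (exp (1/4 * (Y / 6)) * (exp (1/4 * p) - 1) * (exp (1/4 * q) - 1))"
      using pq Y by (intro cross_term_exp_le) auto
    also have "\<dots> = ?c * (exp (Y / 24) * ((exp (p / 4) - 1) * (exp (q / 4) - 1)))"
      unfolding c by simp
    also have "\<dots> \<le> ?c * (exp (Y / 24) * (exp (- (Y / 2)) * h))"
    proof -
      \<comment> \<open>Each potential can afford its own exponential; as s + (1 - s) = 1, these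
        multiply to e^{Y/2} for every s, which makes the mixed part uniformly small.\<close>
      have "(exp (s * Y / 2) * (exp (p / 4) - 1)) * (exp ((1 - s) * Y / 2) * (exp (q / 4) - 1)) \<le> h"
        unfolding h_def p_def q_def using exp_potential_bound_le[OF sY(1)] exp_potential_bound_le[OF sY(2)] pq dominator_pos[OF sY(1)]
        by (intro mult_mono) (auto simp: q_def)
      moreover have "exp (s * Y / 2) * exp ((1 - s) * Y / 2) = exp (Y / 2)"
        by (simp flip: exp_add add: field_simps)
      ultimately have "exp (Y / 2) * ((exp (p / 4) - 1) * (exp (q / 4) - 1)) \<le> h"
        by (simp add: mult_ac) (metis (no_types, lifting) mult.assoc mult.commute mult.left_commute)
      hence "exp (- (Y / 2)) * (exp (Y / 2) * ((exp (p / 4) - 1) * (exp (q / 4) - 1))) \<le> exp (- (Y / 2)) * h"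
        by (intro mult_left_mono) auto
      hence "(exp (p / 4) - 1) * (exp (q / 4) - 1) \<le> exp (- (Y / 2)) * h"
        by (simp add: mult.assoc[symmetric] flip: exp_add)
      thus ?thesis by (intro mult_left_mono) auto
    qed
    also have "\<dots> = ?c * exp (- (11/24 * Y)) * h"
    proof -
      have "exp (Y / 24) * exp (- (Y / 2)) = exp (- (11/24 * Y))" by (simp flip: exp_add)
      thus ?thesis by (simp add: mult_ac)
    qed
    also have "\<dots> \<le> ?c * exp (- (Y / 4)) * dominator_sum Y s"
      using h Y by (intro mult_mono) auto
    finally show ?thesis .
  qed
  have "g ^ l - ((B + P) ^ l + (B + Q) ^ l - B ^ l) = (g ^ l - (B + P + Q) ^ l) + cross_term l B P Q"
    by (simp add: cross_term_def)
  also have "\<bar>\<dots>\<bar> \<le> 8 * ?c * exp (- (Y / 4)) * dominator_sum Y s + ?c * exp (- (Y / 4)) * dominator_sum Y s"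
    using r1 r2 by linarith
  finally show "\<bar>g ^ l - ((B + P) ^ l + (B + Q) ^ l - B ^ l)\<bar> \<le> 9 * ?c * exp (- (Y / 4)) * dominator_sum Y s"
    by (simp add: algebra_simps)
  have "\<bar>g\<bar> \<le> b + \<epsilon>" using X g unfolding \<epsilon>_def by linarith
  hence "\<bar>g\<bar> ^ l \<le> (b + \<epsilon>) ^ l" by (intro power_mono) auto
  also have "\<dots> \<le> fact l / (1/4) ^ l * exp (1/4 * (b + \<epsilon>))"
    using b \<epsilon> by (intro power_le_exp) auto
  also have "exp (1/4 * (b + \<epsilon>)) = exp (1/4 * b) * exp (1/4 * \<epsilon>)" by (simp only: distrib_left exp_add)
  also have "\<dots> = exp (13/24 * Y) * exp (1/4 * \<epsilon>) * h" unfolding eb by (simp only: mult_ac)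
  also have "fact l / (1/4) ^ l * (exp (13/24 * Y) * exp (1/4 * \<epsilon>) * h) \<le> ?c * (exp (Y + 4) * dominator_sum Y s)"
  proof -
    have "exp (13/24 * Y) * exp (1/4 * \<epsilon>) \<le> exp (Y + 4)"
      unfolding exp_add[symmetric] using \<epsilon> Y by simp
    thus ?thesis unfolding c using h by (intro mult_left_mono mult_mono) auto
  qed
  finally show "\<bar>g ^ l\<bar> \<le> ?c * exp (Y + 4) * dominator_sum Y s" by (simp add: power_abs mult.assoc)
qed

section \<open>One end of the interval as a combination of moments\<close>

definition one_sided_integral :: "nat \<Rightarrow> real \<Rightarrow> real \<Rightarrow> real" where
  "one_sided_integral l Y s = (LINT t|unit_measure. (Y * (s\<^sup>2 - s + 1/6) + log_potential (s * Y) t) ^ l - (Y * (s\<^sup>2 - s + 1/6)) ^ l)"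

text \<open>The numerical factor of the term with exponents n, m and l - n - m in ((P - S) + S^2/Y +
  Y/6)^l.\<close>

definition tri_coeff :: "nat \<Rightarrow> nat \<Rightarrow> nat \<Rightarrow> real" where
  "tri_coeff l n m = real (l choose n) * real ((l - n) choose m) / 6 ^ (l - n - m)"

text \<open>With S = sY the base is a - S, where a = S^2/Y + Y/6. The -S is grouped with the
  potential, so a contributes only the even powers S^(2m).\<close>

lemma one_sided_integral_eq:
  assumes Y: "Y > 0" and s: "0 < s"
  shows "one_sided_integral l Y s = (\<Sum>n\<le>l. \<Sum>m\<le>l-n. tri_coeff l n m * Y ^ (l - n - m) / Y ^ m * ((s * Y) ^ (2 * m) * fibre_moment n 1 (s * Y)))"
proof -
  define S where "S = s * Y"
  have S: "S > 0" using Y s by (simp add: S_def)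
  define a where "a = S\<^sup>2 / Y + Y / 6"
  have B: "Y * (s\<^sup>2 - s + 1/6) = a - S"
    using Y by (simp add: a_def S_def power2_eq_square field_simps)
  have "(a - S + log_potential S t) ^ l - (a - S) ^ l = (\<Sum>n\<le>l. real (l choose n) * a ^ (l - n) * ((log_potential S t - 1 * S) ^ n - (- 1 * S) ^ n))" for t
  proof -
    have "(a - S + log_potential S t) ^ l = ((log_potential S t - 1 * S) + a) ^ l" "(a - S) ^ l = (- 1 * S + a) ^ l"
      by (auto simp: algebra_simps)
    thus ?thesis unfolding binomial_ring by (simp add: right_diff_distrib sum_subtractf mult_ac)
  qed
  hence "one_sided_integral l Y s = (\<Sum>n\<le>l. LINT t|unit_measure. real (l choose n) * a ^ (l - n) * ((log_potential S t - 1 * S) ^ n - (- 1 * S) ^ n))"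
    unfolding one_sided_integral_def B S_def[symmetric] using S
    by (simp only:) (intro Bochner_Integration.integral_sum integrable_mult_right moment_integrable, auto)
  also have "\<dots> = (\<Sum>n\<le>l. real (l choose n) * a ^ (l - n) * fibre_moment n 1 S)"
    by (simp only: integral_mult_right_zero fibre_moment_def[symmetric])
  also have "\<dots> = (\<Sum>n\<le>l. \<Sum>m\<le>l-n. tri_coeff l n m * Y ^ (l - n - m) / Y ^ m * (S ^ (2 * m) * fibre_moment n 1 S))"
  proof (rule sum.cong[OF refl])
    fix n
    have "a ^ (l - n) = (\<Sum>m\<le>l-n. real ((l - n) choose m) * (S\<^sup>2 / Y) ^ m * (Y / 6) ^ (l - n - m))"
      unfolding a_def by (rule binomial_ring)
    hence "real (l choose n) * a ^ (l - n) * fibre_moment n 1 S = 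
       (\<Sum>m\<le>l-n. real (l choose n) * (real ((l - n) choose m) * (S\<^sup>2 / Y) ^ m * (Y / 6) ^ (l - n - m)) * fibre_moment n 1 S)"
      by (simp add: sum_distrib_left sum_distrib_right)
    also have "\<dots> = (\<Sum>m\<le>l-n. tri_coeff l n m * Y ^ (l - n - m) / Y ^ m * (S ^ (2 * m) * fibre_moment n 1 S))"
    proof (intro sum.cong refl)
      fix m
      have "(S\<^sup>2 / Y) ^ m = S ^ (2 * m) / Y ^ m" by (simp only: power_divide power_mult)
      thus "real (l choose n) * (real ((l - n) choose m) * (S\<^sup>2 / Y) ^ m * (Y / 6) ^ (l - n - m)) * fibre_moment n 1 S
          = tri_coeff l n m * Y ^ (l - n - m) / Y ^ m * (S ^ (2 * m) * fibre_moment n 1 S)"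
        by (simp only: tri_coeff_def power_divide[of Y 6]) (simp add: mult_ac)
    qed
    finally show "real (l choose n) * a ^ (l - n) * fibre_moment n 1 S = (\<Sum>m\<le>l-n. tri_coeff l n m * Y ^ (l - n - m) / Y ^ m * (S ^ (2 * m) * fibre_moment n 1 S))" .
  qed
  finally show ?thesis by (simp add: S_def)
qed

definition truncated_moment :: "nat \<Rightarrow> nat \<Rightarrow> real \<Rightarrow> real" where
  "truncated_moment j n Y = (LINT S|pos_measure. indicator {0<..<Y} S * (S ^ j * fibre_moment n 1 S))"

text \<open>Under S = sY the unit interval becomes (0,Y). Beyond Y the factor e^{-S/4} of
  \<open>weighted_moment_bound\<close> is at most e^{-Y/4}, and \<open>dominator\<close> remains to
  be integrated.\<close>

lemma truncated_moment_tail: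
  assumes "Y > 0"
  shows "\<bar>truncated_moment j n Y - weighted_moment j n\<bar> \<le> fact (j + n) * 4 ^ (j + n) * exp (- (Y / 4)) * (LINT S|pos_measure. dominator S)"
proof -
  let ?c = "fact (j + n) * 4 ^ (j + n) :: real"
  note i = integrable_unit_scale(3)[OF weighted_moment_integrable[of j n] assms]
  have I1: "integrable pos_measure (\<lambda>S. \<bar>indicator {0<..<Y} S * (S ^ j * fibre_moment n 1 S) - S ^ j * fibre_moment n 1 S\<bar>)"
    by (intro integrable_abs Bochner_Integration.integrable_diff[OF i weighted_moment_integrable])
  have I2: "integrable pos_measure (\<lambda>S. ?c * exp (- (Y / 4)) * dominator S)"
    by (rule integrable_mult_right) (rule dominator_integrable)
  have diff: "truncated_moment j n Y - weighted_moment j n = (LINT S|pos_measure. indicator {0<..<Y} S * (S ^ j * fibre_moment n 1 S) - S ^ j * fibre_moment n 1 S)"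
    unfolding truncated_moment_def weighted_moment_def by (rule Bochner_Integration.integral_diff[OF i weighted_moment_integrable, symmetric])
  have "\<bar>truncated_moment j n Y - weighted_moment j n\<bar> \<le> (LINT S|pos_measure. \<bar>indicator {0<..<Y} S * (S ^ j * fibre_moment n 1 S) - S ^ j * fibre_moment n 1 S\<bar>)"
    unfolding diff using integral_norm_bound[of pos_measure "\<lambda>S. indicator {0<..<Y} S * (S ^ j * fibre_moment n 1 S) - S ^ j * fibre_moment n 1 S"] by simp
  also have "\<dots> \<le> (LINT S|pos_measure. ?c * exp (- (Y / 4)) * dominator S)"
  proof (rule integral_mono[OF I1 I2])
    fix S assume "S \<in> space pos_measure"
    hence S: "S > 0" by simp
    show "\<bar>indicator {0<..<Y} S * (S ^ j * fibre_moment n 1 S) - S ^ j * fibre_moment n 1 S\<bar> \<le> ?c * exp (- (Y / 4)) * dominator S"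
    proof (cases "S < Y")
      case True
      thus ?thesis using S dominator_pos[OF S] by (simp add: indicator_def)
    next
      case False
      have "\<bar>S ^ j * fibre_moment n 1 S\<bar> \<le> ?c * (exp (- (S / 4)) * dominator S)" by (rule weighted_moment_bound[OF S])
      also have "\<dots> \<le> ?c * (exp (- (Y / 4)) * dominator S)"
        using False dominator_pos[OF S] by (intro mult_left_mono mult_right_mono) auto
      finally show ?thesis using False by (simp add: indicator_def mult.assoc)
    qed
  qed
  finally show ?thesis by simp
qed

lemma one_sided_integral_integral:
  assumes Y: "Y > 0"
  shows "integrable unit_measure (one_sided_integral l Y)"
    "(LINT s|unit_measure. one_sided_integral l Y s) = (\<Sum>n\<le>l. \<Sum>m\<le>l-n. tri_coeff l n m * Y ^ (l - n - m) / Y ^ m / Y * truncated_moment (2 * m) n Y)"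
proof -
  let ?g = "\<lambda>s. \<Sum>n\<le>l. \<Sum>m\<le>l-n. tri_coeff l n m * Y ^ (l - n - m) / Y ^ m * ((s * Y) ^ (2 * m) * fibre_moment n 1 (s * Y))"
  note K = integrable_unit_scale[OF weighted_moment_integrable Y]
  have g: "integrable unit_measure ?g"
    by (intro Bochner_Integration.integrable_sum integrable_mult_right K)
  have eq: "one_sided_integral l Y s = ?g s" if "s \<in> space unit_measure" for s
    using that by (intro one_sided_integral_eq[OF Y]) auto
  show "integrable unit_measure (one_sided_integral l Y)"
    using g by (subst Bochner_Integration.integrable_cong[OF refl eq])
  have "(LINT s|unit_measure. one_sided_integral l Y s) = (LINT s|unit_measure. ?g s)"
    by (rule Bochner_Integration.integral_cong[OF refl eq])
  also have "\<dots> = (\<Sum>n\<le>l. \<Sum>m\<le>l-n. LINT s|unit_measure. tri_coeff l n m * Y ^ (l - n - m) / Y ^ m * ((s * Y) ^ (2 * m) * fibre_moment n 1 (s * Y)))"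
    by (subst Bochner_Integration.integral_sum, intro Bochner_Integration.integrable_sum integrable_mult_right K,
        intro sum.cong refl Bochner_Integration.integral_sum integrable_mult_right K)
  also have "\<dots> = (\<Sum>n\<le>l. \<Sum>m\<le>l-n. tri_coeff l n m * Y ^ (l - n - m) / Y ^ m / Y * truncated_moment (2 * m) n Y)"
    by (intro sum.cong refl) (simp add: K(2) truncated_moment_def)
  finally show "(LINT s|unit_measure. one_sided_integral l Y s) = (\<Sum>n\<le>l. \<Sum>m\<le>l-n. tri_coeff l n m * Y ^ (l - n - m) / Y ^ m / Y * truncated_moment (2 * m) n Y)" .
qed

section \<open>The potential-free part: moments of the second Bernoulli polynomial\<close>

definition bernoulli_moment :: "nat \<Rightarrow> nat \<Rightarrow> real" where
  "bernoulli_moment j l = (LINT s|unit_measure. s ^ j * (s\<^sup>2 - s + 1/6) ^ l)"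

lemma unit_integrable_continuous:
  fixes f :: "real \<Rightarrow> real"
  assumes "continuous_on UNIV f"
  shows "integrable unit_measure f"
proof -
  have "set_integrable lborel {0..1} f"
    unfolding set_integrable_def by (rule borel_integrable_compact) (use assms in \<open>auto intro: continuous_on_subset\<close>)
  hence "set_integrable lborel {0<..<1} f" by (rule set_integrable_subset) auto
  thus ?thesis by (simp add: unit_measure_def integrable_restrict_space set_integrable_def)
qed

text \<open>The weight s^j is there for this induction on l: expanding one factor s^2 - s + 1/6
  raises j by 2, 1 and 0 with rational coefficients.\<close>

lemma bernoulli_moment_rat: "bernoulli_moment j l \<in> \<rat>"
proof (induction l arbitrary: j)
  case 0
  have "((\<lambda>s. s ^ j) has_integral (1 ^ Suc j / real (Suc j) - 0 ^ Suc j / real (Suc j))) {0..1::real}"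
  proof (rule fundamental_theorem_of_calculus)
    fix x :: real
    have "((\<lambda>s. s ^ Suc j / real (Suc j)) has_real_derivative x ^ j) (at x within {0..1})"
      by (auto intro!: derivative_eq_intros simp del: of_nat_Suc power_Suc)
    thus "((\<lambda>s. s ^ Suc j / real (Suc j)) has_vector_derivative x ^ j) (at x within {0..1})"
      by (simp add: has_real_derivative_iff_has_vector_derivative)
  qed simp
  hence "((\<lambda>s. s ^ j) has_integral (1 / real (Suc j))) {0<..<1::real}"
    by (simp add: has_integral_Icc_iff_Ioo)
  moreover have "set_integrable lborel {0<..<1} (\<lambda>s::real. s ^ j)"
    using unit_integrable_continuous[of "\<lambda>s. s ^ j"]
    by (simp add: unit_measure_def integrable_restrict_space set_integrable_def continuous_intros)
  ultimately have "(LINT s:{0<..<1}|lborel. s ^ j) = 1 / real (Suc j)"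
    using set_borel_integral_eq_integral(2) integral_unique by metis
  hence "bernoulli_moment j 0 = 1 / real (Suc j)"
    by (simp add: bernoulli_moment_def integral_unit set_lebesgue_integral_def)
  thus ?case by simp
next
  case (Suc l)
  have i: "integrable unit_measure (\<lambda>s. s ^ i * (s\<^sup>2 - s + 1/6) ^ l)" for i
    by (intro unit_integrable_continuous continuous_intros)
  have "bernoulli_moment j (Suc l) = (LINT s|unit_measure. s ^ (j + 2) * (s\<^sup>2 - s + 1/6) ^ l - s ^ (j + 1) * (s\<^sup>2 - s + 1/6) ^ l
        + 1/6 * (s ^ j * (s\<^sup>2 - s + 1/6) ^ l))"
    unfolding bernoulli_moment_def by (simp add: algebra_simps power2_eq_square)
  also have "\<dots> = bernoulli_moment (j + 2) l - bernoulli_moment (j + 1) l + 1/6 * bernoulli_moment j l"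
    unfolding bernoulli_moment_def
    by (subst Bochner_Integration.integral_add, intro Bochner_Integration.integrable_diff i, intro integrable_mult_right i,
        subst Bochner_Integration.integral_diff[OF i i]) simp
  also have "\<dots> \<in> \<rat>" using Suc by (intro Rats_add Rats_diff Rats_mult) auto
  finally show ?case .
qed

text \<open>Periodicity in t removes the shift c, a multiple of Re \<tau> in the application. This
  is where the dependence on Re \<tau> is lost.\<close>

lemma integral_shifted_power:
  assumes S: "S > 0"
  shows "integrable unit_measure (\<lambda>t. (B + log_potential S (t + c)) ^ l)"
    "(LINT t|unit_measure. (B + log_potential S (t + c)) ^ l) = (LINT t|unit_measure. (B + log_potential S t) ^ l - B ^ l) + B ^ l"
proof -
  have bd: "norm ((B + log_potential S t) ^ l) \<le> (\<bar>B\<bar> + potential_bound S) ^ l" for t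
    unfolding real_norm_def power_abs using log_potential_le[OF S, of t] by (intro power_mono) auto
  have i: "integrable unit_measure (\<lambda>t. (B + log_potential S (t + c)) ^ l)" for c
    by (rule integrable_unit_bounded[OF _ bd]) (intro measurable_unit, measurable)
  show "integrable unit_measure (\<lambda>t. (B + log_potential S (t + c)) ^ l)" by (rule i)
  have "(LINT t|unit_measure. (B + log_potential S (t + c)) ^ l) = (LINT t|unit_measure. (B + log_potential S t) ^ l)"
    by (rule integral_unit_shift[of "\<lambda>t. (B + log_potential S t) ^ l", OF _ bd]) (measurable, simp add: log_potential_plus_int)
  moreover have "(LINT t|unit_measure. (B + log_potential S t) ^ l - B ^ l) = (LINT t|unit_measure. (B + log_potential S t) ^ l) - (LINT t|unit_measure. B ^ l)"
    using i[of 0] integrable_unit_bounded[of "\<lambda>_. B ^ l" "norm (B ^ l)"]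
    by (intro Bochner_Integration.integral_diff) auto
  ultimately show "(LINT t|unit_measure. (B + log_potential S (t + c)) ^ l) = (LINT t|unit_measure. (B + log_potential S t) ^ l - B ^ l) + B ^ l"
    by simp
qed

text \<open>The factor 2 counts the two ends, which contribute equally after reflection; the
  additional division by Y comes from ds = dS/Y.\<close>

definition main_term :: "nat \<Rightarrow> real \<Rightarrow> real" where
  "main_term l Y = Y ^ l * bernoulli_moment 0 l
     + (\<Sum>n\<le>l. \<Sum>m\<le>l-n. tri_coeff l n m * Y ^ (l - n - m) / Y ^ m / Y * (2 * weighted_moment (2 * m) n))"

definition dominator_mass :: real where "dominator_mass = (LINT S|pos_measure. dominator S)"

lemma dominator_mass_nonneg: "dominator_mass \<ge> 0"
  unfolding dominator_mass_def by (intro integral_nonneg_AE AE_I2) (auto simp: less_imp_le[OF dominator_pos])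

text \<open>(B+P+Q)^l is replaced by (B+P)^l + (B+Q)^l - B^l. Relative to B^l each end leaves a
  \<open>one_sided_integral\<close>, the second one at 1 - s because s^2 - s + 1/6 is symmetric
  about 1/2.\<close>

lemma fibre_integral_approx:
  fixes \<tau> :: complex and l :: nat
  defines "Y \<equiv> 2 * pi * Im \<tau>"
  assumes Y: "Y \<ge> 2" and s: "0 < s" "s < 1"
  shows "\<bar>(LINT t|unit_measure. green (of_real s * \<tau> + of_real t) \<tau> ^ l) -
      (one_sided_integral l Y s + one_sided_integral l Y (1 - s) + Y ^ l * (s ^ 0 * (s\<^sup>2 - s + 1/6) ^ l))\<bar> \<le> 9 * (fact l * 4 ^ l) * exp (- (Y / 4)) * dominator_sum Y s"
    "\<bar>green (of_real s * \<tau> + of_real t) \<tau> ^ l\<bar> \<le> fact l * 4 ^ l * exp (Y + 4) * dominator_sum Y s"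
proof -
  have im: "Im \<tau> > 0"
  proof (rule ccontr)
    assume "\<not> Im \<tau> > 0"
    hence "Y \<le> 0" by (simp add: Y_def mult_nonneg_nonpos)
    thus False using Y by simp
  qed
  define g where "g = (\<lambda>t. green (of_real s * \<tau> + of_real t) \<tau>)"
  define B where "B = Y * (s\<^sup>2 - s + 1/6)"
  define P where "P = (\<lambda>t. log_potential (s * Y) (t + s * Re \<tau>))"
  define Q where "Q = (\<lambda>t. log_potential ((1 - s) * Y) (t + (s - 1) * Re \<tau>))"
  have sY: "s * Y > 0" "(1 - s) * Y > 0" using Y s by auto
  have B: "\<bar>B\<bar> \<le> Y / 6"
  proof -
    \<comment> \<open>Hence s^2 - s + 1/6 ranges over [-1/12, 1/6].\<close>
    have "s * (1 - s) \<le> 1/4" using zero_le_power2[of "s - 1/2"] by (simp add: power2_eq_square algebra_simps)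
    moreover have "s * (1 - s) \<ge> 0" using s by simp
    moreover have "s\<^sup>2 - s = - (s * (1 - s))" by (simp add: power2_eq_square algebra_simps)
    ultimately have "\<bar>s\<^sup>2 - s + 1/6\<bar> \<le> 1/6" by linarith
    hence "Y * \<bar>s\<^sup>2 - s + 1/6\<bar> \<le> Y * (1/6)" using Y by (intro mult_left_mono) auto
    thus ?thesis using Y by (simp add: B_def abs_mult)
  qed
  have PQ: "\<bar>P t\<bar> \<le> potential_bound (s * Y)" "\<bar>Q t\<bar> \<le> potential_bound ((1 - s) * Y)" for t
    using sY by (auto simp: P_def Q_def log_potential_le)
  have gx: "\<bar>g t - (B + P t + Q t)\<bar> \<le> 16 * exp (- Y)" for t
    using green_expansion[of \<tau> s t] exp_neg_le_quarter[OF Y] s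
    unfolding Y_def[symmetric] g_def B_def P_def Q_def by (simp add: add.commute)
  note bounds = green_power_bounds[OF Y s B PQ gx]
  show "\<bar>green (of_real s * \<tau> + of_real t) \<tau> ^ l\<bar> \<le> fact l * 4 ^ l * exp (Y + 4) * dominator_sum Y s"
    using bounds(2)[of t l] unfolding g_def .
  have gm: "(\<lambda>t. g t ^ l) \<in> borel_measurable borel"
    unfolding g_def using green_measurable[OF im] by measurable
  have gi: "integrable unit_measure (\<lambda>t. g t ^ l)"
    by (rule integrable_unit_bounded[OF measurable_unit[OF gm]]) (use bounds(2)[of _ l] in auto)
  have Pi: "integrable unit_measure (\<lambda>t. (B + P t) ^ l)" "(LINT t|unit_measure. (B + P t) ^ l) = one_sided_integral l Y s + B ^ l"
    unfolding P_def one_sided_integral_def B_def by (rule integral_shifted_power[OF sY(1)])+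
  have sq: "(1 - s)\<^sup>2 - (1 - s) + 1/6 = s\<^sup>2 - s + 1/6" by (simp add: power2_eq_square algebra_simps)
  have R': "one_sided_integral l Y (1 - s) = (LINT t|unit_measure. (B + log_potential ((1 - s) * Y) t) ^ l - B ^ l)"
    unfolding one_sided_integral_def B_def sq ..
  have Qi: "integrable unit_measure (\<lambda>t. (B + Q t) ^ l)" "(LINT t|unit_measure. (B + Q t) ^ l) = one_sided_integral l Y (1 - s) + B ^ l"
    unfolding Q_def R' by (rule integral_shifted_power[OF sY(2)])+
  have Bi: "integrable unit_measure (\<lambda>t. B ^ l)" by (rule integrable_unit_bounded[where B = "norm (B ^ l)"]) auto
  have hi: "integrable unit_measure (\<lambda>t. (B + P t) ^ l + (B + Q t) ^ l - B ^ l)"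
    by (intro Bochner_Integration.integrable_add Bochner_Integration.integrable_diff Pi Qi Bi)
  have h: "(LINT t|unit_measure. (B + P t) ^ l + (B + Q t) ^ l - B ^ l) = one_sided_integral l Y s + one_sided_integral l Y (1 - s) + B ^ l"
    using Pi Qi Bi by (simp add: Bochner_Integration.integral_diff Bochner_Integration.integral_add)
  have "(LINT t|unit_measure. g t ^ l) - (one_sided_integral l Y s + one_sided_integral l Y (1 - s) + B ^ l) = 
      (LINT t|unit_measure. g t ^ l - ((B + P t) ^ l + (B + Q t) ^ l - B ^ l))"
    unfolding h[symmetric] by (rule Bochner_Integration.integral_diff[OF gi hi, symmetric])
  moreover have "\<bar>LINT t|unit_measure. g t ^ l - ((B + P t) ^ l + (B + Q t) ^ l - B ^ l)\<bar> \<le> 9 * (fact l * 4 ^ l) * exp (- (Y / 4)) * dominator_sum Y s"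
    by (rule integral_unit_le[OF borel_measurable_integrable[OF Bochner_Integration.integrable_diff[OF gi hi]] bounds(1)])
  ultimately have "\<bar>(LINT t|unit_measure. g t ^ l) - (one_sided_integral l Y s + one_sided_integral l Y (1 - s) + B ^ l)\<bar> \<le> 9 * (fact l * 4 ^ l) * exp (- (Y / 4)) * dominator_sum Y s"
    by (simp only:)
  moreover have "B ^ l = Y ^ l * (s ^ 0 * (s\<^sup>2 - s + 1/6) ^ l)" by (simp add: B_def power_mult_distrib)
  ultimately show "\<bar>(LINT t|unit_measure. green (of_real s * \<tau> + of_real t) \<tau> ^ l) -
      (one_sided_integral l Y s + one_sided_integral l Y (1 - s) + Y ^ l * (s ^ 0 * (s\<^sup>2 - s + 1/6) ^ l))\<bar> \<le> 9 * (fact l * 4 ^ l) * exp (- (Y / 4)) * dominator_sum Y s"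
    unfolding g_def by (simp only:)
qed

text \<open>18 is the fibrewise constant 9 times 2, as \<open>dominator_sum\<close> has mass at most
  twice \<open>dominator_mass\<close>. The double sum collects the tails cut off at S = Y, once for
  each end.\<close>

definition D_error :: "nat \<Rightarrow> real" where
  "D_error l = 18 * (fact l * 4 ^ l) * dominator_mass
     + (\<Sum>n\<le>l. \<Sum>m\<le>l-n. tri_coeff l n m * (2 * (fact (2 * m + n) * 4 ^ (2 * m + n) * dominator_mass)))"

lemma tri_coeff_nonneg: "tri_coeff l n m \<ge> 0" by (simp add: tri_coeff_def)

text \<open>There are two errors of rate e^{-Y/4}: the replacement on each fibre, integrated over s,
  and the extension of the moments from (0,Y) to the half-line. The power Y^l bounds the Laurent
  monomials that multiply the tails.\<close>

lemma modular_graph_D_asymptotic: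
  fixes \<tau> :: complex and l :: nat
  defines "Y \<equiv> 2 * pi * Im \<tau>"
  assumes Y: "Y \<ge> 2"
  shows "\<bar>modular_graph_D l \<tau> - main_term l Y\<bar> \<le> D_error l * Y ^ l * exp (- (Y / 4))"
proof -
  have im: "Im \<tau> > 0"
  proof (rule ccontr)
    assume "\<not> Im \<tau> > 0"
    hence "Y \<le> 0" by (simp add: Y_def mult_nonneg_nonpos)
    thus False using Y by simp
  qed
  have Y0: "Y > 0" and Y1: "Y \<ge> 1" using Y by auto
  note fib = fibre_integral_approx[of \<tau>, folded Y_def, OF Y]
  let ?c = "fact l * 4 ^ l :: real"
  define A where "A = (\<lambda>s. LINT t|unit_measure. green (of_real s * \<tau> + of_real t) \<tau> ^ l)"
  define R where "R = (\<lambda>s. one_sided_integral l Y s + one_sided_integral l Y (1 - s) + Y ^ l * (s ^ 0 * (s\<^sup>2 - s + 1/6) ^ l))"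
  define w where "w = (\<lambda>s. ?c * exp (Y + 4) * dominator_sum Y s)"
  have ei: "integrable unit_measure (dominator_sum Y)" "(LINT s|unit_measure. dominator_sum Y s) \<le> 2 * dominator_mass"
    using dominator_sum_integrable[OF Y1] by (auto simp: dominator_mass_def)
  have wi: "integrable unit_measure w" unfolding w_def by (rule integrable_mult_right) (rule ei)
  have D: "modular_graph_D l \<tau> = (LINT s|unit_measure. A s)" and Am: "A \<in> borel_measurable borel"
    using modular_graph_D_eq[OF im wi, of l] fib(2) unfolding A_def w_def by auto
  have Rfi: "integrable unit_measure (one_sided_integral l Y)" by (rule one_sided_integral_integral(1)[OF Y0])
  have Ri: "integrable unit_measure (\<lambda>s. one_sided_integral l Y (1 - s))" by (rule integrable_unit_reflect(1)[OF Rfi])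
  have Bi: "integrable unit_measure (\<lambda>s. s ^ 0 * (s\<^sup>2 - s + 1/6) ^ l)"
    by (intro unit_integrable_continuous continuous_intros)
  have Bi': "integrable unit_measure (\<lambda>s. Y ^ l * (s ^ 0 * (s\<^sup>2 - s + 1/6) ^ l))"
    by (rule integrable_mult_right) (rule Bi)
  have RRi: "integrable unit_measure (\<lambda>s. one_sided_integral l Y s + one_sided_integral l Y (1 - s))"
    by (rule Bochner_Integration.integrable_add[OF Rfi Ri])
  have Rint: "integrable unit_measure R" unfolding R_def
    by (rule Bochner_Integration.integrable_add[OF RRi Bi'])
  have LR: "(LINT s|unit_measure. R s) = 2 * (LINT s|unit_measure. one_sided_integral l Y s) + Y ^ l * bernoulli_moment 0 l"
  proof -
    have "(LINT s|unit_measure. R s) = (LINT s|unit_measure. one_sided_integral l Y s) + (LINT s|unit_measure. one_sided_integral l Y (1 - s)) + (LINT s|unit_measure. Y ^ l * (s ^ 0 * (s\<^sup>2 - s + 1/6) ^ l))"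
      unfolding R_def Bochner_Integration.integral_add[OF RRi Bi'] Bochner_Integration.integral_add[OF Rfi Ri] ..
    thus ?thesis unfolding integrable_unit_reflect(2)[of "one_sided_integral l Y"] bernoulli_moment_def by simp
  qed
  have Ai: "integrable unit_measure A"
  proof (rule Bochner_Integration.integrable_bound[OF wi measurable_unit[OF Am]])
    show "AE s in unit_measure. norm (A s) \<le> norm (w s)"
    proof (rule AE_I2)
      fix s assume "s \<in> space unit_measure"
      hence s: "0 < s" "s < 1" by auto
      have "\<bar>A s\<bar> \<le> w s"
        unfolding A_def w_def
      proof (rule integral_unit_le)
        have "(\<lambda>t. green (of_real s * \<tau> + of_real t) \<tau> ^ l) \<in> borel_measurable borel"
          using green_measurable[OF im] by measurable
        thus "(\<lambda>t. green (of_real s * \<tau> + of_real t) \<tau> ^ l) \<in> borel_measurable unit_measure"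
          by (rule measurable_unit)
      qed (rule fib(2)[OF s])
      thus "norm (A s) \<le> norm (w s)" by simp
    qed
  qed
  have "\<bar>(LINT s|unit_measure. A s) - (LINT s|unit_measure. R s)\<bar> \<le> 9 * ?c * exp (- (Y / 4)) * (2 * dominator_mass)"
  proof -
    have ARi: "integrable unit_measure (\<lambda>s. A s - R s)" by (rule Bochner_Integration.integrable_diff[OF Ai Rint])
    have eq: "(LINT s|unit_measure. A s) - (LINT s|unit_measure. R s) = (LINT s|unit_measure. A s - R s)"
      by (rule Bochner_Integration.integral_diff[OF Ai Rint, symmetric])
    have "\<bar>LINT s|unit_measure. A s - R s\<bar> \<le> (LINT s|unit_measure. \<bar>A s - R s\<bar>)"
      using integral_norm_bound[of unit_measure "\<lambda>s. A s - R s"] by simp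
    also have "\<dots> \<le> (LINT s|unit_measure. 9 * ?c * exp (- (Y / 4)) * dominator_sum Y s)"
    proof (rule integral_mono)
      show "integrable unit_measure (\<lambda>s. \<bar>A s - R s\<bar>)" using ARi by (rule integrable_abs)
      show "integrable unit_measure (\<lambda>s. 9 * ?c * exp (- (Y / 4)) * dominator_sum Y s)"
        by (rule integrable_mult_right) (rule ei)
      fix s assume "s \<in> space unit_measure"
      hence s: "0 < s" "s < 1" by auto
      show "\<bar>A s - R s\<bar> \<le> 9 * ?c * exp (- (Y / 4)) * dominator_sum Y s"
        unfolding A_def R_def by (rule fib(1)[OF s])
    qed
    also have "\<dots> = 9 * ?c * exp (- (Y / 4)) * (LINT s|unit_measure. dominator_sum Y s)" by simp
    also have "\<dots> \<le> 9 * ?c * exp (- (Y / 4)) * (2 * dominator_mass)"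
      by (intro mult_left_mono ei) auto
    finally show ?thesis unfolding eq .
  qed
  hence 1: "\<bar>modular_graph_D l \<tau> - (2 * (LINT s|unit_measure. one_sided_integral l Y s) + Y ^ l * bernoulli_moment 0 l)\<bar> \<le> 18 * ?c * dominator_mass * Y ^ l * exp (- (Y / 4))"
  proof -
    assume *: "\<bar>(LINT s|unit_measure. A s) - (LINT s|unit_measure. R s)\<bar> \<le> 9 * ?c * exp (- (Y / 4)) * (2 * dominator_mass)"
    have "9 * ?c * exp (- (Y / 4)) * (2 * dominator_mass) = 18 * ?c * dominator_mass * exp (- (Y / 4)) * 1" by simp
    also have "\<dots> \<le> 18 * ?c * dominator_mass * exp (- (Y / 4)) * Y ^ l"
      using dominator_mass_nonneg Y1 by (intro mult_left_mono one_le_power) auto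
    finally show ?thesis using * unfolding D LR by (simp add: mult_ac)
  qed
  have 2: "\<bar>(2 * (LINT s|unit_measure. one_sided_integral l Y s) + Y ^ l * bernoulli_moment 0 l) - main_term l Y\<bar> \<le> 
     (\<Sum>n\<le>l. \<Sum>m\<le>l-n. tri_coeff l n m * (2 * (fact (2 * m + n) * 4 ^ (2 * m + n) * dominator_mass))) * Y ^ l * exp (- (Y / 4))"
  proof -
    have diff: "(2 * (LINT s|unit_measure. one_sided_integral l Y s) + Y ^ l * bernoulli_moment 0 l) - main_term l Y
       = (\<Sum>n\<le>l. \<Sum>m\<le>l-n. tri_coeff l n m * Y ^ (l - n - m) / Y ^ m / Y * (2 * (truncated_moment (2 * m) n Y - weighted_moment (2 * m) n)))"
      unfolding main_term_def one_sided_integral_integral(2)[OF Y0]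
      by (simp add: sum_distrib_left right_diff_distrib sum_subtractf mult_ac)
    have "\<bar>(2 * (LINT s|unit_measure. one_sided_integral l Y s) + Y ^ l * bernoulli_moment 0 l) - main_term l Y\<bar>
        \<le> (\<Sum>n\<le>l. \<Sum>m\<le>l-n. \<bar>tri_coeff l n m * Y ^ (l - n - m) / Y ^ m / Y * (2 * (truncated_moment (2 * m) n Y - weighted_moment (2 * m) n))\<bar>)"
      unfolding diff by (intro order.trans[OF sum_abs] sum_mono sum_abs)
    also have "\<dots> \<le> (\<Sum>n\<le>l. \<Sum>m\<le>l-n. tri_coeff l n m * (2 * (fact (2 * m + n) * 4 ^ (2 * m + n) * dominator_mass)) * (Y ^ l * exp (- (Y / 4))))"
    proof (intro sum_mono)
      fix n m
      define F where "F = (fact (2 * m + n) * 4 ^ (2 * m + n) :: real)"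
      have F: "F > 0" by (simp add: F_def)
      have K: "\<bar>truncated_moment (2 * m) n Y - weighted_moment (2 * m) n\<bar> \<le> F * exp (- (Y / 4)) * dominator_mass"
        using truncated_moment_tail[OF Y0, of "2 * m" n] by (simp add: F_def dominator_mass_def)
      have yy: "Y ^ (l - n - m) / Y ^ m / Y \<le> Y ^ l"
      proof -
        have "Y ^ (l - n - m) \<le> Y ^ l" using Y1 by (intro power_increasing) auto
        moreover have "1 * 1 \<le> Y ^ m * Y" using Y1 by (intro mult_mono one_le_power) auto
        ultimately have "Y ^ (l - n - m) / (Y ^ m * Y) \<le> Y ^ l / 1" using Y1 by (intro frac_le) auto
        thus ?thesis by simp
      qed
      have "\<bar>tri_coeff l n m * Y ^ (l - n - m) / Y ^ m / Y * (2 * (truncated_moment (2 * m) n Y - weighted_moment (2 * m) n))\<bar>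
        = tri_coeff l n m * (2 * ((Y ^ (l - n - m) / Y ^ m / Y) * \<bar>truncated_moment (2 * m) n Y - weighted_moment (2 * m) n\<bar>))"
      proof -
        have gen: "\<bar>a * b / c / d * (2 * x)\<bar> = a * (2 * ((b / c / d) * \<bar>x\<bar>))" if "a \<ge> 0" "b > 0" "c > 0" "d > 0" for a b c d x :: real
          using that by (simp add: abs_mult)
        show ?thesis by (rule gen) (use tri_coeff_nonneg[of l n m] Y0 in auto)
      qed
      also have "\<dots> \<le> tri_coeff l n m * (2 * (Y ^ l * (F * exp (- (Y / 4)) * dominator_mass)))"
        using K yy Y0 tri_coeff_nonneg[of l n m] by (intro mult_left_mono mult_mono) auto
      finally show "\<bar>tri_coeff l n m * Y ^ (l - n - m) / Y ^ m / Y * (2 * (truncated_moment (2 * m) n Y - weighted_moment (2 * m) n))\<bar> \<le>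
         tri_coeff l n m * (2 * (fact (2 * m + n) * 4 ^ (2 * m + n) * dominator_mass)) * (Y ^ l * exp (- (Y / 4)))"
        unfolding F_def[symmetric] by (simp add: mult_ac)
    qed
    finally show ?thesis by (simp add: sum_distrib_right mult.assoc)
  qed
  have "D_error l * Y ^ l * exp (- (Y / 4)) = 18 * ?c * dominator_mass * Y ^ l * exp (- (Y / 4)) + 
    (\<Sum>n\<le>l. \<Sum>m\<le>l-n. tri_coeff l n m * (2 * (fact (2 * m + n) * 4 ^ (2 * m + n) * dominator_mass))) * Y ^ l * exp (- (Y / 4))"
    unfolding D_error_def by (simp only: distrib_right)
  thus ?thesis using 1 2 by linarith
qed

section \<open>Laurent polynomials\<close>

lemma laurent_eval_superset:
  assumes "finite K" "Poly_Mapping.keys p \<subseteq> K"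
  shows "laurent_eval p Y = (\<Sum>k\<in>K. Poly_Mapping.lookup p k * Y powi k)"
  unfolding laurent_eval_def using assms by (intro sum.mono_neutral_left) (auto simp: in_keys_iff)

lemma laurent_eval_add: "laurent_eval (p + q) Y = laurent_eval p Y + laurent_eval q Y"
proof -
  let ?K = "Poly_Mapping.keys p \<union> Poly_Mapping.keys q"
  have "Poly_Mapping.keys (p + q) \<subseteq> ?K" by (rule keys_add)
  hence "laurent_eval (p + q) Y = (\<Sum>k\<in>?K. Poly_Mapping.lookup (p + q) k * Y powi k)"
    by (intro laurent_eval_superset) auto
  also have "\<dots> = (\<Sum>k\<in>?K. Poly_Mapping.lookup p k * Y powi k) + (\<Sum>k\<in>?K. Poly_Mapping.lookup q k * Y powi k)"
    by (simp add: lookup_add distrib_right sum.distrib)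
  also have "\<dots> = laurent_eval p Y + laurent_eval q Y"
    by (simp add: laurent_eval_superset[of ?K p] laurent_eval_superset[of ?K q])
  finally show ?thesis .
qed

lemma laurent_eval_diff: "laurent_eval (p - q) Y = laurent_eval p Y - laurent_eval q Y"
  using laurent_eval_add[of "p - q" q Y] by simp

lemma laurent_eval_single: "laurent_eval (Poly_Mapping.single k c) Y = c * Y powi k"
  by (subst laurent_eval_superset[of "{k}"]) auto

lemma laurent_eval_sum: "laurent_eval (sum p I) Y = (\<Sum>i\<in>I. laurent_eval (p i) Y)"
  by (induction I rule: infinite_finite_induct) (auto simp: laurent_eval_add, auto simp: laurent_eval_def)

text \<open>The exponent l - n - 2m - 1 combines the powers of Y/6 and S^2/Y with ds = dS/Y.
  Distinct pairs (n,m) can share an exponent; addition of the families merges them.\<close>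

definition laurent_D :: "nat \<Rightarrow> laurent_poly" where
  "laurent_D l = Poly_Mapping.single (int l) (bernoulli_moment 0 l)
     + (\<Sum>n\<le>l. \<Sum>m\<le>l-n. Poly_Mapping.single (int (l - n - m) - int m - 1) (tri_coeff l n m * (2 * weighted_moment (2 * m) n)))"

lemma laurent_D_eval:
  assumes "Y > 0" shows "laurent_eval (laurent_D l) Y = main_term l Y"
proof -
  have "Y powi (int (l - n - m) - int m - 1) = Y ^ (l - n - m) / Y ^ m / Y" for n m
    using assms by (simp add: power_int_diff)
  note powi = this
  show ?thesis
    unfolding laurent_D_def main_term_def laurent_eval_add laurent_eval_sum laurent_eval_single powi
    by (simp add: mult_ac)
qed

lemma laurent_D_in_ring: "Poly_Mapping.lookup (laurent_D l) k \<in> odd_zeta_ring"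
proof -
  have "tri_coeff l n m * (2 * weighted_moment (2 * m) n) \<in> odd_zeta_ring" for n m
  proof -
    have "tri_coeff l n m * 2 \<in> \<rat>" unfolding tri_coeff_def by (intro Rats_mult Rats_divide Rats_power) auto
    from ring_mult_rat[OF this weighted_moment_even_in_ring[of m n]] show ?thesis by (simp only: mult.assoc)
  qed
  thus ?thesis unfolding laurent_D_def lookup_add lookup_sum lookup_single
    by (intro odd_zeta_ring.add ring_sum) (auto simp: when_def intro: odd_zeta_ring.rat bernoulli_moment_rat)
qed

lemma laurent_D_describes: "describes_D_at_infinity l (laurent_D l)"
  unfolding describes_D_at_infinity_def
proof (intro exI conjI)
  \<comment> \<open>Half of the available rate 1/4; the other half absorbs Y^l.\<close>
  show "(0::real) < 1/8" by simp
  show "(\<lambda>\<tau>. modular_graph_D l \<tau> - laurent_eval (laurent_D l) (2 * pi * Im \<tau>))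
    \<in> O[filtercomap (\<lambda>\<tau>. 2 * pi * Im \<tau>) at_top](\<lambda>\<tau>. exp (- (1/8) * (2 * pi * Im \<tau>)))"
  proof (rule bigoI)
    have "norm (modular_graph_D l \<tau> - laurent_eval (laurent_D l) (2 * pi * Im \<tau>)) \<le>
        D_error l * (fact l / (1/8) ^ l) * norm (exp (- (1/8) * (2 * pi * Im \<tau>)))" if Y: "2 \<le> 2 * pi * Im \<tau>" for \<tau>
    proof -
      define Y where "Y = 2 * pi * Im \<tau>"
      have Y2: "Y \<ge> 2" using Y by (simp add: Y_def)
      have e0: "D_error l \<ge> 0" unfolding D_error_def
        using dominator_mass_nonneg tri_coeff_nonneg by (intro add_nonneg_nonneg mult_nonneg_nonneg sum_nonneg) auto
      have "\<bar>modular_graph_D l \<tau> - laurent_eval (laurent_D l) Y\<bar> \<le> D_error l * Y ^ l * exp (- (Y / 4))"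
        using modular_graph_D_asymptotic[of \<tau> l] Y2 laurent_D_eval[of Y l] by (simp add: Y_def)
      also have "\<dots> \<le> D_error l * (fact l / (1/8) ^ l * exp (1/8 * Y)) * exp (- (Y / 4))"
        using Y2 e0 by (intro mult_right_mono mult_left_mono power_le_exp) auto
      also have "\<dots> = D_error l * (fact l / (1/8) ^ l) * exp (- (1/8) * Y)"
      proof -
        have "exp (1/8 * Y) * exp (- (Y / 4)) = exp (- (1/8) * Y)" by (simp flip: exp_add)
        thus ?thesis by (simp only: mult.assoc)
      qed
      finally show ?thesis by (simp add: Y_def)
    qed
    thus "\<forall>\<^sub>F \<tau> in filtercomap (\<lambda>\<tau>. 2 * pi * Im \<tau>) at_top.
      norm (modular_graph_D l \<tau> - laurent_eval (laurent_D l) (2 * pi * Im \<tau>)) \<le>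
        D_error l * (fact l / (1/8) ^ l) * norm (exp (- (1/8) * (2 * pi * Im \<tau>)))"
      unfolding eventually_filtercomap_at_top_linorder by blast
  qed
qed

section \<open>Uniqueness of the Laurent polynomial\<close>

lemma describes_D_imp_bound:
  assumes "describes_D_at_infinity l d"
  obtains c C N where "c > 0"
    "\<And>\<tau>. 2 * pi * Im \<tau> \<ge> N \<Longrightarrow> \<bar>modular_graph_D l \<tau> - laurent_eval d (2 * pi * Im \<tau>)\<bar> \<le> C * exp (- c * (2 * pi * Im \<tau>))"
proof -
  from assms obtain c where c: "c > 0" 
    "(\<lambda>\<tau>. modular_graph_D l \<tau> - laurent_eval d (2 * pi * Im \<tau>))
        \<in> O[filtercomap (\<lambda>\<tau>. 2 * pi * Im \<tau>) at_top](\<lambda>\<tau>. exp (- c * (2 * pi * Im \<tau>)))"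
    unfolding describes_D_at_infinity_def by blast
  from c(2) obtain C where "\<forall>\<^sub>F \<tau> in filtercomap (\<lambda>\<tau>. 2 * pi * Im \<tau>) at_top.
      norm (modular_graph_D l \<tau> - laurent_eval d (2 * pi * Im \<tau>)) \<le> C * norm (exp (- c * (2 * pi * Im \<tau>)))"
    by (elim landau_o.bigE)
  then obtain N where "\<forall>\<tau>. 2 * pi * Im \<tau> \<ge> N \<longrightarrow>
      norm (modular_graph_D l \<tau> - laurent_eval d (2 * pi * Im \<tau>)) \<le> C * norm (exp (- c * (2 * pi * Im \<tau>)))"
    unfolding eventually_filtercomap_at_top_linorder by blast
  with c(1) show ?thesis by (intro that[of c N C]) auto
qed

lemma power_int_neg_tendsto_0:
  assumes "k < 0" shows "((\<lambda>Y::real. Y powi k) \<longlongrightarrow> 0) at_top"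
proof -
  have "filterlim (\<lambda>Y::real. Y ^ nat (- k)) at_top at_top"
    using assms by (intro filterlim_pow_at_top filterlim_ident) auto
  hence "((\<lambda>Y::real. inverse (Y ^ nat (- k))) \<longlongrightarrow> 0) at_top"
    by (rule tendsto_inverse_0_at_top)
  moreover have "Y powi k = inverse (Y ^ nat (- k))" for Y :: real
    using assms by (simp add: power_int_def power_inverse)
  ultimately show ?thesis by simp
qed

lemma power_int_exp_tendsto_0:
  assumes "c > 0" shows "((\<lambda>Y::real. Y powi k * exp (- c * Y)) \<longlongrightarrow> 0) at_top"
proof (rule Lim_null_comparison)
  let ?m = "nat \<bar>k\<bar>"
  show "\<forall>\<^sub>F Y in at_top. norm (Y powi k * exp (- c * Y)) \<le> fact ?m / (c/2) ^ ?m * exp (- (c/2) * Y)"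
    using eventually_ge_at_top[of 1]
  proof eventually_elim
    case (elim Y)
    have "Y powi k \<le> Y powi (int ?m)" using elim by (intro power_int_increasing) auto
    also have "\<dots> \<le> fact ?m / (c/2) ^ ?m * exp (c/2 * Y)"
      unfolding power_int_of_nat using elim assms by (intro power_le_exp) auto
    finally have "Y powi k * exp (- c * Y) \<le> fact ?m / (c/2) ^ ?m * exp (c/2 * Y) * exp (- c * Y)"
      by (intro mult_right_mono) auto
    also have "\<dots> = fact ?m / (c/2) ^ ?m * exp (- (c/2) * Y)"
    proof -
      have "exp (c/2 * Y) * exp (- c * Y) = exp (- (c/2) * Y)" by (simp flip: exp_add add: field_simps)
      thus ?thesis by (simp only: mult.assoc)
    qed
    finally show ?case using elim by (simp add: abs_mult)
  qed
  have "((\<lambda>Y. exp (- (c/2) * Y)) \<longlongrightarrow> 0) at_top" using assms by real_asymp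
  from tendsto_mult[OF tendsto_const[of "fact ?m / (c/2) ^ ?m"] this]
  show "((\<lambda>Y. fact ?m / (c/2) ^ ?m * exp (- (c/2) * Y)) \<longlongrightarrow> 0) at_top" by simp
qed

text \<open>Divided by its highest power of Y, a nonzero Laurent polynomial tends to its leading
  coefficient, while the exponential bounds divided by that power tend to 0. The two rates come from
  two competing descriptions.\<close>

lemma laurent_poly_eq_0:
  assumes c: "c > 0" "c' > 0"
    and le: "\<And>Y. Y \<ge> N \<Longrightarrow> \<bar>laurent_eval p Y\<bar> \<le> C * exp (- c * Y) + C' * exp (- c' * Y)"
  shows "p = 0"
proof (rule ccontr)
  assume "p \<noteq> 0"
  hence ne: "Poly_Mapping.keys p \<noteq> {}" by simp
  define k where "k = Max (Poly_Mapping.keys p)"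
  have k: "k \<in> Poly_Mapping.keys p" "\<And>j. j \<in> Poly_Mapping.keys p \<Longrightarrow> j \<le> k"
    using ne by (auto simp: k_def)
  have "((\<lambda>Y. \<Sum>j\<in>Poly_Mapping.keys p. Poly_Mapping.lookup p j * Y powi (j - k)) \<longlongrightarrow>
      (\<Sum>j\<in>Poly_Mapping.keys p. if j = k then Poly_Mapping.lookup p k else 0)) at_top"
  proof (rule tendsto_sum)
    fix j assume j: "j \<in> Poly_Mapping.keys p"
    show "((\<lambda>Y. Poly_Mapping.lookup p j * Y powi (j - k)) \<longlongrightarrow> (if j = k then Poly_Mapping.lookup p k else 0)) at_top"
    proof (cases "j = k")
      case False
      hence "j - k < 0" using k(2)[OF j] by simp
      from tendsto_mult[OF tendsto_const power_int_neg_tendsto_0[OF this]] show ?thesis using False by simp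
    qed simp
  qed
  hence "((\<lambda>Y. \<Sum>j\<in>Poly_Mapping.keys p. Poly_Mapping.lookup p j * Y powi (j - k)) \<longlongrightarrow> Poly_Mapping.lookup p k) at_top"
    using k(1) by simp
  moreover have "((\<lambda>Y. \<Sum>j\<in>Poly_Mapping.keys p. Poly_Mapping.lookup p j * Y powi (j - k)) \<longlongrightarrow> 0) at_top"
  proof (rule Lim_null_comparison)
    show "\<forall>\<^sub>F Y in at_top. norm (\<Sum>j\<in>Poly_Mapping.keys p. Poly_Mapping.lookup p j * Y powi (j - k)) \<le>
       C * (Y powi (- k) * exp (- c * Y)) + C' * (Y powi (- k) * exp (- c' * Y))"
      using eventually_ge_at_top[of N] eventually_gt_at_top[of 0]
    proof eventually_elim
      case (elim Y)
      have "Poly_Mapping.lookup p j * Y powi (j - k) = Y powi (- k) * (Poly_Mapping.lookup p j * Y powi j)" for j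
        using elim by (simp add: power_int_diff power_int_minus field_simps)
      hence "(\<Sum>j\<in>Poly_Mapping.keys p. Poly_Mapping.lookup p j * Y powi (j - k)) = Y powi (- k) * laurent_eval p Y"
        unfolding laurent_eval_def sum_distrib_left by (intro sum.cong refl)
      hence "norm (\<Sum>j\<in>Poly_Mapping.keys p. Poly_Mapping.lookup p j * Y powi (j - k)) = Y powi (- k) * \<bar>laurent_eval p Y\<bar>"
        using elim by (simp add: abs_mult)
      also have "\<dots> \<le> Y powi (- k) * (C * exp (- c * Y) + C' * exp (- c' * Y))"
        using elim by (intro mult_left_mono le) auto
      finally show ?case by (simp add: distrib_left mult_ac)
    qed
    have "((\<lambda>Y. C * (Y powi (- k) * exp (- c * Y)) + C' * (Y powi (- k) * exp (- c' * Y))) \<longlongrightarrow> C * 0 + C' * 0) at_top"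
      by (intro tendsto_add tendsto_mult tendsto_const power_int_exp_tendsto_0 c)
    thus "((\<lambda>Y. C * (Y powi (- k) * exp (- c * Y)) + C' * (Y powi (- k) * exp (- c' * Y))) \<longlongrightarrow> 0) at_top" by simp
  qed
  ultimately have "Poly_Mapping.lookup p k = 0"
    by (rule tendsto_unique[rotated]) simp
  thus False using k(1) by (simp add: in_keys_iff)
qed

lemma describes_D_unique:
  assumes "describes_D_at_infinity l d" "describes_D_at_infinity l d'"
  shows "d = d'"
proof -
  obtain c C N where 1: "c > 0"
    "\<And>\<tau>. 2 * pi * Im \<tau> \<ge> N \<Longrightarrow> \<bar>modular_graph_D l \<tau> - laurent_eval d (2 * pi * Im \<tau>)\<bar> \<le> C * exp (- c * (2 * pi * Im \<tau>))"
    by (rule describes_D_imp_bound[OF assms(1)]) blast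
  obtain c' C' N' where 2: "c' > 0"
    "\<And>\<tau>. 2 * pi * Im \<tau> \<ge> N' \<Longrightarrow> \<bar>modular_graph_D l \<tau> - laurent_eval d' (2 * pi * Im \<tau>)\<bar> \<le> C' * exp (- c' * (2 * pi * Im \<tau>))"
    by (rule describes_D_imp_bound[OF assms(2)]) blast
  have "d - d' = 0"
  proof (rule laurent_poly_eq_0[OF 1(1) 2(1), of "max N N'"])
    fix Y assume Y: "max N N' \<le> Y"
    \<comment> \<open>A purely imaginary \<tau> realises any prescribed Y; this ray already
      separates Laurent polynomials.\<close>
    define \<tau> where "\<tau> = Complex 0 (Y / (2 * pi))"
    have \<tau>: "2 * pi * Im \<tau> = Y" by (simp add: \<tau>_def)
    show "\<bar>laurent_eval (d - d') Y\<bar> \<le> C * exp (- c * Y) + C' * exp (- c' * Y)"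
      using 1(2)[of \<tau>] 2(2)[of \<tau>] Y unfolding \<tau> laurent_eval_diff by auto
  qed
  thus ?thesis by simp
qed

theorem theoremA:
  fixes l :: nat
  shows "(\<exists>!d. describes_D_at_infinity l d) \<and>
         (\<forall>d. describes_D_at_infinity l d \<longrightarrow>
            (\<forall>k. Poly_Mapping.lookup d k \<in> odd_zeta_ring))"
  using laurent_D_describes laurent_D_in_ring describes_D_unique by metis

end
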